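(* Let $R'=\mathbb Z[X,Y,Z,U,V,W]/(XU+YV+ZW)$, where $X,Y,Z,U,V,W$ are independent indeterminates, graded so that (the images of) $X,Y,Z$ have degree $0$ and (the images of) $U,V,W$ have degree $1$; thus $R'_0$ is identified with $\mathbb Z[X,Y,Z]$. Let $d\ge 3$ be an integer and let $p$ be a prime number. Then: (i) $p\mathbb Z\in\operatorname{Ass}_{\mathbb Z}\bigl(H^3_{R'_+}(R')_{-d}\bigr)$ if and only if $p\in\Pi(d-2)$; (ii) $\operatorname{Ass}_{R'_0}\bigl(H^3_{R'_+}(R')_{-d}\bigr)=\{(X,Y,Z)\}\cup\{(q,X,Y,Z): q\in\Pi(d-2)\}$; (iii) the set of integers $\bigl\{\#\bigl(\operatorname{Ass}_{R'_0}(H^3_{R'_+}(R')_{-j})\bigr): j\ge 3\bigr\}$ is unbounded; (iv) the sets $\{j\in\mathbb Z: j\ge3\text{ and }(p,X,Y,Z)\in\operatorname{Ass}_{R'_0}(H^3_{R'_+}(R')_{-j})\}$ and $\{j\in\mathbb Z: j\ge3\text{ and }(p,X,Y,Z)\notin\operatorname{Ass}_{R'_0}(H^3_{R'_+}(R')_{-j})\}$ are both infinite; and (v) $\operatorname{Ass}_{R'_0}\bigl(H^3_{R'_+}(R')_n\bigr)$ is not asymptotically increasing for $n\to-\infty$.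
   Context: $R'_+$ is the ideal of $R'$ generated by all homogeneous elements of positive degree, i.e. by the images of $U,V,W$. Local cohomology modules $H^i_{R'_+}(R')$ carry their natural $\mathbb Z$-grading, and the subscript $n$ denotes the component of degree $n$, an $R'_0$-module. For a positive integer $n$, $\Pi(n)$ denotes the set of all primes $p$ such that $p$ is a prime factor of $\binom{n}{i}$ for some $i\in\{0,\dots,n\}$. $\operatorname{Ass}_{R'_0}(H^3_{R'_+}(R')_n)$ is called asymptotically increasing for $n\to-\infty$ if there exists $n_0\in\mathbb Z$ such that $\operatorname{Ass}_{R'_0}(H^3_{R'_+}(R')_n)\subseteq\operatorname{Ass}_{R'_0}(H^3_{R'_+}(R')_{n-1})$ for all $n\le n_0$. $\#$ denotes cardinality. *)

theory Defs
  imports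
    "HOL-Algebra.Algebra"
    "HOL-Algebra.Algebraic_Closure_Type"
    "HOL-Library.Poly_Mapping"
begin

section \<open>Graded rings and graded modules\<close>

definition is_grading :: "('b, 'x) ring_scheme \<Rightarrow> (int \<Rightarrow> 'b set) \<Rightarrow> bool" where
  "is_grading M B \<longleftrightarrow>
     (\<forall>n. subgroup (B n) (add_monoid M)) \<and>
     (\<forall>x\<in>carrier M. \<exists>!c. (\<forall>n. c n \<in> B n) \<and> finite {n. c n \<noteq> \<zero>\<^bsub>M\<^esub>} \<and>
        x = (\<Oplus>\<^bsub>M\<^esub>n\<in>{n. c n \<noteq> \<zero>\<^bsub>M\<^esub>}. c n))"

locale graded_ring = cring R for R (structure) +
  fixes A :: "int \<Rightarrow> 'a set"
  assumes grading: "is_grading R A"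
    and mult_graded: "\<lbrakk>a \<in> A m; b \<in> A n\<rbrakk> \<Longrightarrow> a \<otimes> b \<in> A (m + n)"

locale graded_module = graded_ring R A + module R M
  for R :: "('a, 'x) ring_scheme" (structure) and A
    and M :: "('a, 'b, 'y) module_scheme" (structure) +
  fixes B :: "int \<Rightarrow> 'b set"
  assumes module_grading: "is_grading M B"
    and smult_graded: "\<lbrakk>a \<in> A m; x \<in> B n\<rbrakk> \<Longrightarrow> a \<odot>\<^bsub>M\<^esub> x \<in> B (m + n)"

text \<open>Homomorphisms of graded modules are homogeneous of degree 0.\<close>

definition graded_hom ::
    "('a, 'x) ring_scheme \<Rightarrow> ('a, 'b, 'y) module_scheme \<Rightarrow> (int \<Rightarrow> 'b set) \<Rightarrow>
     ('a, 'c, 'z) module_scheme \<Rightarrow> (int \<Rightarrow> 'c set) \<Rightarrow> ('b \<Rightarrow> 'c) set" where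
  "graded_hom R M B N C =
     {f \<in> carrier M \<rightarrow> carrier N.
        (\<forall>x\<in>carrier M. \<forall>y\<in>carrier M. f (x \<oplus>\<^bsub>M\<^esub> y) = f x \<oplus>\<^bsub>N\<^esub> f y) \<and>
        (\<forall>r\<in>carrier R. \<forall>x\<in>carrier M. f (r \<odot>\<^bsub>M\<^esub> x) = r \<odot>\<^bsub>N\<^esub> f x) \<and>
        (\<forall>n. f ` B n \<subseteq> C n)}"

text \<open>
  Injective objects of the category of graded \<open>R\<close>-modules. A definition cannot quantify over
  types, so the modules \<open>L\<close>, \<open>N\<close> of the lifting problem range over all graded modules whose
  elements are taken from the element type of \<open>R\<close>. No generality is lost: by the graded form of
  Baer's criterion, the shifts of the inclusions of homogeneous ideals into \<open>R\<close>, which are among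
  these, already detect injectivity.
\<close>

definition graded_injective ::
    "('a, 'x) ring_scheme \<Rightarrow> (int \<Rightarrow> 'a set) \<Rightarrow>
     ('a, 'm) module \<Rightarrow> (int \<Rightarrow> 'm set) \<Rightarrow> bool" where
  "graded_injective R A E C \<longleftrightarrow>
     graded_module R A E C \<and>
     (\<forall>(L :: ('a, 'a) module) B (N :: ('a, 'a) module) B' i g.
        graded_module R A L B \<and> graded_module R A N B' \<and>
        i \<in> graded_hom R L B N B' \<and> inj_on i (carrier L) \<and> g \<in> graded_hom R L B E C \<longrightarrow>
        (\<exists>h\<in>graded_hom R N B' E C. \<forall>x\<in>carrier L. h (i x) = g x))"

text \<open>
  The exact sequence \<open>0 \<rightarrow> M \<rightarrow> E 0 \<rightarrow> E 1 \<rightarrow> \<dots>\<close> with augmentation \<open>e : M \<rightarrow> E 0\<close> and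
  differentials \<open>d i : E i \<rightarrow> E (i + 1)\<close>.
\<close>

definition graded_injective_resolution ::
    "('a, 'x) ring_scheme \<Rightarrow> (int \<Rightarrow> 'a set) \<Rightarrow> ('a, 'b) module \<Rightarrow> (int \<Rightarrow> 'b set) \<Rightarrow>
     ('b \<Rightarrow> 'm) \<Rightarrow> (nat \<Rightarrow> ('a, 'm) module) \<Rightarrow> (nat \<Rightarrow> int \<Rightarrow> 'm set) \<Rightarrow>
     (nat \<Rightarrow> 'm \<Rightarrow> 'm) \<Rightarrow> bool" where
  "graded_injective_resolution R A M B e E C d \<longleftrightarrow>
     graded_module R A M B \<and>
     (\<forall>i. graded_injective R A (E i) (C i)) \<and>
     e \<in> graded_hom R M B (E 0) (C 0) \<and>
     (\<forall>i. d i \<in> graded_hom R (E i) (C i) (E (Suc i)) (C (Suc i))) \<and>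
     inj_on e (carrier M) \<and>
     e ` carrier M = a_kernel (E 0) (E 1) (d 0) \<and>
     (\<forall>i. d i ` carrier (E i) = a_kernel (E (Suc i)) (E (Suc (Suc i))) (d (Suc i)))"


section \<open>Local cohomology\<close>

text \<open>\<open>\<Gamma>\<^sub>a(M)\<close>; the power \<open>a\<^sup>n\<close> is formed in the multiplicative monoid of ideals.\<close>

definition torsion_part ::
    "('a, 'x) ring_scheme \<Rightarrow> 'a set \<Rightarrow> ('a, 'b, 'y) module_scheme \<Rightarrow> 'b set" where
  "torsion_part R a M =
     {m \<in> carrier M. \<exists>n::nat. \<forall>r \<in> a [^]\<^bsub>ideals_set R\<^esub> n. r \<odot>\<^bsub>M\<^esub> m = \<zero>\<^bsub>M\<^esub>}"

text \<open>The fields \<open>mult\<close> and \<open>one\<close> of a module record carry no information.\<close>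

definition quotient_module :: "('a, 'b, 'y) module_scheme \<Rightarrow> 'b set \<Rightarrow> ('a, 'b set) module" where
  "quotient_module M N =
     \<lparr>carrier = a_rcosets\<^bsub>M\<^esub> N, monoid.mult = undefined, one = undefined,
      ring.zero = N, add = set_add M,
      module.smult = (\<lambda>r x. \<Union>m\<in>x. N +>\<^bsub>M\<^esub> (r \<odot>\<^bsub>M\<^esub> m))\<rparr>"

definition torsion_cocycles ::
    "('a, 'x) ring_scheme \<Rightarrow> 'a set \<Rightarrow> (nat \<Rightarrow> ('a, 'm) module) \<Rightarrow> (nat \<Rightarrow> 'm \<Rightarrow> 'm) \<Rightarrow>
     nat \<Rightarrow> 'm set" where
  "torsion_cocycles R a E d i = {m \<in> torsion_part R a (E i). d i m = \<zero>\<^bsub>E (Suc i)\<^esub>}"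

primrec torsion_coboundaries ::
    "('a, 'x) ring_scheme \<Rightarrow> 'a set \<Rightarrow> (nat \<Rightarrow> ('a, 'm) module) \<Rightarrow> (nat \<Rightarrow> 'm \<Rightarrow> 'm) \<Rightarrow>
     nat \<Rightarrow> 'm set" where
  "torsion_coboundaries R a E d 0 = {\<zero>\<^bsub>E 0\<^esub>}"
| "torsion_coboundaries R a E d (Suc i) = d i ` torsion_part R a (E i)"

text \<open>
  The \<open>i\<close>-th right derived functor of \<open>\<Gamma>\<^sub>a\<close> on graded modules, computed from an injective
  resolution \<open>(E, d)\<close> in the category of graded modules (with gradings \<open>C\<close>): the \<open>i\<close>-th cohomology
  of the complex \<open>\<Gamma>\<^sub>a(E)\<close>. Its natural grading is the one inherited from \<open>E i\<close>, so its component
  of degree \<open>n\<close> consists of the classes of the cocycles that are homogeneous of degree \<open>n\<close>.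
\<close>

definition local_cohomology ::
    "('a, 'x) ring_scheme \<Rightarrow> 'a set \<Rightarrow> (nat \<Rightarrow> ('a, 'm) module) \<Rightarrow> (nat \<Rightarrow> 'm \<Rightarrow> 'm) \<Rightarrow>
     nat \<Rightarrow> ('a, 'm set) module" where
  "local_cohomology R a E d i =
     quotient_module ((E i)\<lparr>carrier := torsion_cocycles R a E d i\<rparr>)
       (torsion_coboundaries R a E d i)"

definition local_cohomology_component ::
    "('a, 'x) ring_scheme \<Rightarrow> 'a set \<Rightarrow> (nat \<Rightarrow> ('a, 'm) module) \<Rightarrow> (nat \<Rightarrow> int \<Rightarrow> 'm set) \<Rightarrow>
     (nat \<Rightarrow> 'm \<Rightarrow> 'm) \<Rightarrow> nat \<Rightarrow> int \<Rightarrow> ('a, 'm set) module" where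
  "local_cohomology_component R a E C d i n =
     (local_cohomology R a E d i)\<lparr>carrier :=
        {torsion_coboundaries R a E d i +>\<^bsub>E i\<^esub> m | m. m \<in> torsion_cocycles R a E d i \<inter> C i n}\<rparr>"


section \<open>Associated primes\<close>

definition Ass :: "('a, 'x) ring_scheme \<Rightarrow> ('a, 'b, 'y) module_scheme \<Rightarrow> 'a set set" where
  "Ass R M = {P. primeideal P R \<and>
     (\<exists>m\<in>carrier M. P = {r \<in> carrier R. r \<odot>\<^bsub>M\<^esub> m = \<zero>\<^bsub>M\<^esub>})}"

text \<open>The \<open>\<int>\<close>-module underlying an abelian group or a module.\<close>

definition int_module :: "('b, 'x) ring_scheme \<Rightarrow> (int, 'b) module" where
  "int_module M =
     \<lparr>carrier = carrier M, monoid.mult = monoid.mult M, one = \<one>\<^bsub>M\<^esub>,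
      ring.zero = \<zero>\<^bsub>M\<^esub>, add = add M,
      module.smult = (\<lambda>k m. [k] \<cdot>\<^bsub>M\<^esub> m)\<rparr>"

definition asymptotically_increasing :: "(int \<Rightarrow> 'a set) \<Rightarrow> bool" where
  "asymptotically_increasing S \<longleftrightarrow> (\<exists>n0. \<forall>n\<le>n0. S n \<subseteq> S (n - 1))"

definition binom_primes :: "nat \<Rightarrow> nat set" where
  "binom_primes n = {p. Factorial_Ring.prime p \<and> (\<exists>i\<in>{0..n}. p dvd (n choose i))}"


section \<open>The hypersurface \<open>\<int>[X,Y,Z,U,V,W]/(XU + YV + ZW)\<close>\<close>

definition regular_module :: "('a, 'x) ring_scheme \<Rightarrow> ('a, 'a) module" where
  "regular_module R =
     \<lparr>carrier = carrier R, monoid.mult = monoid.mult R, one = \<one>\<^bsub>R\<^esub>,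
      ring.zero = \<zero>\<^bsub>R\<^esub>, add = add R,
      module.smult = monoid.mult R\<rparr>"

definition irrelevant_ideal :: "('a, 'x) ring_scheme \<Rightarrow> (int \<Rightarrow> 'a set) \<Rightarrow> 'a set" where
  "irrelevant_ideal R A = Idl\<^bsub>R\<^esub> (\<Union>n\<in>{0<..}. A n)"

definition degree_zero_ring :: "'a ring \<Rightarrow> (int \<Rightarrow> 'a set) \<Rightarrow> 'a ring" where
  "degree_zero_ring R A = R\<lparr>carrier := A 0\<rparr>"

datatype indet = iX | iY | iZ | iU | iV | iW

text \<open>A polynomial is a finitely supported family of coefficients, indexed by exponent vectors.\<close>

type_synonym zpoly = "(indet \<Rightarrow>\<^sub>0 nat) \<Rightarrow>\<^sub>0 int"

definition Var :: "indet \<Rightarrow> zpoly" where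
  "Var v = Poly_Mapping.single (Poly_Mapping.single v 1) 1"

definition zpoly_ring :: "zpoly ring" where
  "zpoly_ring = ring_of_type_algebra"

definition hyp_ideal :: "zpoly set" where
  "hyp_ideal = PIdl\<^bsub>zpoly_ring\<^esub> (Var iX * Var iU + Var iY * Var iV + Var iZ * Var iW)"

definition R' :: "zpoly set ring" where
  "R' = zpoly_ring Quot hyp_ideal"

definition cls :: "zpoly \<Rightarrow> zpoly set" where
  "cls f = hyp_ideal +>\<^bsub>zpoly_ring\<^esub> f"

text \<open>\<open>X, Y, Z\<close> have degree 0 and \<open>U, V, W\<close> have degree 1; the parts of negative degree are zero.\<close>

definition zpoly_part :: "int \<Rightarrow> zpoly set" where
  "zpoly_part n = {f. \<forall>m \<in> Poly_Mapping.keys f.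
     int (Poly_Mapping.lookup m iU + Poly_Mapping.lookup m iV + Poly_Mapping.lookup m iW) = n}"

definition R'_part :: "int \<Rightarrow> zpoly set set" where
  "R'_part n = cls ` zpoly_part n"

definition R'0 :: "zpoly set ring" where
  "R'0 = degree_zero_ring R' R'_part"

text \<open>
  \<open>H\<^sup>3\<^bsub>R'\<^sub>+\<^esub>(R')\<^sub>n\<close>, computed from the resolution \<open>(E, C, d)\<close>. Its scalar multiplication is
  that of the whole module, to be restricted to \<open>R'0\<close>.
\<close>

definition H3 :: "(nat \<Rightarrow> (zpoly set, 'm) module) \<Rightarrow> (nat \<Rightarrow> int \<Rightarrow> 'm set) \<Rightarrow>
    (nat \<Rightarrow> 'm \<Rightarrow> 'm) \<Rightarrow> int \<Rightarrow> (zpoly set, 'm set) module" where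
  "H3 E C d n = local_cohomology_component R' (irrelevant_ideal R' R'_part) E C d 3 n"

definition ideal_XYZ :: "zpoly set set" where
  "ideal_XYZ = Idl\<^bsub>R'0\<^esub> {cls (Var iX), cls (Var iY), cls (Var iZ)}"

definition ideal_qXYZ :: "nat \<Rightarrow> zpoly set set" where
  "ideal_qXYZ q = Idl\<^bsub>R'0\<^esub> {cls (of_nat q), cls (Var iX), cls (Var iY), cls (Var iZ)}"

end

theory Submission
  imports Defs
begin

text \<open>
  Put \<open>N = d - 2\<close> and \<open>h = XU + YV + ZW\<close>. Since \<open>U, V, W\<close> are nonzerodivisors modulo \<open>h\<close>, powers
  of \<open>U\<close> and \<open>V\<close> stay nonzerodivisors modulo \<open>(h, W\<^sup>k)\<close>, and syzygies of high powers of \<open>U, V, W\<close> become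
  Koszul relations in lower powers, a graded form of Baer's criterion makes every graded injective
  module acyclic for the Cech complex of \<open>U, V, W\<close>. A diagram chase along the resolution then
  identifies the component of degree \<open>-d\<close> of the third local cohomology with the fractions
  \<open>s / (UVW)\<^sup>k\<close> of degree \<open>-d\<close> modulo those in which one of the variables cancels; only the
  annihilators of the elements matter.

  Because \<open>XU = - (YV + ZW)\<close>, the variables \<open>X, Y, Z\<close> act nilpotently on each fraction, so the question
  is which primes \<open>p\<close> divide the torsion. For \<open>i \<le> N\<close> the fraction \<open>X\<^sup>iY\<^bsup>N-i\<^esup> / (UVW\<^sup>N)\<close> is a torsion
  element of order \<open>N choose i\<close>. Conversely let \<open>p\<close> divide no \<open>N choose i\<close>. The fractions decompose into
  cokernels of the contraction \<open>\<alpha> \<mapsto> \<Sum>\<^sub>i (\<alpha> - e\<^sub>i)\<close> on truncated exponent vectors of weight \<open>N\<close>. A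
  solution modulo \<open>p\<close> of the homogeneous system is determined by its values \<open>f\<^sub>i\<close> at \<open>(i, N - i, 0)\<close>, and
  the truncation conditions say exactly that \<open>\<Sum>\<^sub>i (N choose i) f\<^sub>i t\<^sup>i\<close> has bounded degree and is
  divisible by certain powers of \<open>t\<close> and \<open>t - 1\<close>. Such polynomials lift to the integers, hence so do
  the solutions, and there is no \<open>p\<close>-torsion.
\<close>

text \<open>The shift by 2 comes from degrees. A basic fraction involves
  \<open>U^(-1-a) V^(-1-b) W^(-1-c)\<close>, so degree \<open>-d\<close> means
  \<open>a + b + c = d - 3\<close>; the multiples of \<open>hyp\<close> come from degree
  \<open>-d - 1\<close>, that is from weight \<open>d - 2 = N\<close>. The resolution is abstract,
  so all knowledge of its terms comes from \<open>baer_three\<close>, the lifting property for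
  ideals with at most three homogeneous generators. Localizations are never formed: homogeneous
  nonzerodivisors act surjectively on graded injectives, so each fraction has a representative in
  the module itself, and Cech cochains are families of elements compared by \<open>loc_eq\<close>.
  For torsion, let \<open>\<psi>\<close> solve the contraction system for \<open>p * \<phi>\<close>.
  Modulo \<open>p\<close> it solves the homogeneous system. Subtracting an integral lift of this
  solution leaves a multiple of \<open>p\<close>, and the quotient solves the system for
  \<open>\<phi>\<close>. The lift comes from an integer polynomial whose coefficients must be
  divided by the numbers \<open>N choose i\<close>; a common multiple \<open>c\<close> of them,
  prime to \<open>p\<close>, is carried along and removed by Bezout.\<close>

section \<open>The coordinate ring\<close>

text \<open>The order on the indeterminates serves only to make \<^typ>\<open>zpoly\<close> an integral domain.\<close>

instantiation indet :: linorder
begin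

definition less_eq_indet :: "indet \<Rightarrow> indet \<Rightarrow> bool" where
  "less_eq_indet a b \<longleftrightarrow> (case_indet 0 1 2 3 4 5 a :: nat) \<le> case_indet 0 1 2 3 4 5 b"

definition less_indet :: "indet \<Rightarrow> indet \<Rightarrow> bool" where
  "less_indet a b \<longleftrightarrow> (case_indet 0 1 2 3 4 5 a :: nat) < case_indet 0 1 2 3 4 5 b"

instance
  by standard (auto simp: less_eq_indet_def less_indet_def split: indet.splits)

end

section \<open>Coefficients of polynomials and divisibility by powers of a variable\<close>

abbreviation lkp :: "('b \<Rightarrow>\<^sub>0 'c::zero) \<Rightarrow> 'b \<Rightarrow> 'c" where "lkp \<equiv> Poly_Mapping.lookup"

abbreviation kys :: "('b \<Rightarrow>\<^sub>0 'c::zero) \<Rightarrow> 'b set" where "kys \<equiv> Poly_Mapping.keys"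

abbreviation sng :: "'b \<Rightarrow> 'c \<Rightarrow> ('b \<Rightarrow>\<^sub>0 'c::zero)" where "sng \<equiv> Poly_Mapping.single"

lemma lookup_monomial_mult_add:
  fixes f :: zpoly
  shows "lkp (sng a 1 * f) (a + m) = lkp f m"
proof -
  have "lkp (sng a 1 * f) (a + m) = (\<Sum>l. (\<Sum>q. lkp f q when a + m = a + q) when a = l)"
    unfolding lookup_mult by (rule arg_cong[where f=Sum_any]) (simp add: fun_eq_iff lookup_single when_def)
  also have "\<dots> = lkp f m"
    by simp
  finally show ?thesis .
qed

lemma lookup_monomial_mult_eq_0:
  fixes f :: zpoly
  assumes "\<And>m'. m \<noteq> a + m'"
  shows "lkp (sng a 1 * f) m = 0"
proof -
  have "kys (sng a 1 * f) \<subseteq> {a + b |a' b. b \<in> kys f}"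
    using keys_mult[of "sng a 1" f] by auto
  hence "m \<notin> kys (sng a 1 * f)" using assms by auto
  thus ?thesis by (simp add: in_keys_iff)
qed

lemma Var_power: "Var v ^ k = sng (sng v k) 1"
  by (induction k) (auto simp: Var_def mult_single single_add[symmetric] add.commute)

lemma lookup_Var_power_mult:
  "lkp (Var v ^ k * f) m = (if k \<le> lkp m v then lkp f (m - sng v k) else 0)"
proof (cases "k \<le> lkp m v")
  case True
  have "m = sng v k + (m - sng v k)"
    using True by (intro poly_mapping_eqI) (auto simp: lookup_add lookup_minus lookup_single when_def)
  then show ?thesis
    using lookup_monomial_mult_add[of "sng v k" f "m - sng v k"] True by (simp add: Var_power)
next
  case False
  then have "m \<noteq> sng v k + m'" for m'
    by (auto simp: lookup_add)
  then show ?thesis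
    using lookup_monomial_mult_eq_0 False by (auto simp: Var_power)
qed

lemma lookup_Var_mult:
  "lkp (Var v * f) m = (if 1 \<le> lkp m v then lkp f (m - sng v 1) else 0)"
  using lookup_Var_power_mult[of v 1 f m] by simp

definition restr :: "((indet \<Rightarrow>\<^sub>0 nat) \<Rightarrow> bool) \<Rightarrow> zpoly \<Rightarrow> zpoly" where
  "restr P f = Poly_Mapping.mapp (\<lambda>m c. c when P m) f"

lemma lookup_restr: "lkp (restr P f) m = (lkp f m when P m)"
  by (auto simp: restr_def lookup_mapp when_def in_keys_iff)

lemma keys_restr: "kys (restr P f) = {m \<in> kys f. P m}"
  by (auto simp: in_keys_iff lookup_restr)

lemma restr_add: "restr P (f + g) = restr P f + restr P g"
  by (intro poly_mapping_eqI) (simp add: lookup_restr lookup_add when_def)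

lemma restr_split: "f = restr P f + restr (\<lambda>m. \<not> P m) f"
  by (intro poly_mapping_eqI) (simp add: lookup_restr lookup_add when_def)

lemma Var_power_dvd_iff: "Var v ^ k dvd f \<longleftrightarrow> (\<forall>m\<in>kys f. k \<le> lkp m v)"
proof
  assume "Var v ^ k dvd f"
  then obtain g where "f = Var v ^ k * g" ..
  then show "\<forall>m\<in>kys f. k \<le> lkp m v"
    by (auto simp: in_keys_iff lookup_Var_power_mult split: if_splits)
next
  assume *: "\<forall>m\<in>kys f. k \<le> lkp m v"
  define g where "g = Poly_Mapping.map_key (\<lambda>m. sng v k + m) f"
  have g: "lkp g m = lkp f (sng v k + m)" for m
    unfolding g_def by (subst map_key.rep_eq) (auto simp: inj_def)
  have "f = Var v ^ k * g"
  proof (rule poly_mapping_eqI)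
    fix m
    show "lkp f m = lkp (Var v ^ k * g) m"
    proof (cases "k \<le> lkp m v")
      case True
      have "m = sng v k + (m - sng v k)"
        using True by (intro poly_mapping_eqI) (auto simp: lookup_add lookup_minus lookup_single when_def)
      then show ?thesis using True by (simp add: lookup_Var_power_mult g)
    next
      case False
      then show ?thesis using * by (auto simp: lookup_Var_power_mult in_keys_iff)
    qed
  qed
  then show "Var v ^ k dvd f" by simp
qed

lemma Var_power_neq_0 [simp]: "Var v ^ k \<noteq> 0"
  by (simp add: Var_power)

lemma Var_neq_0 [simp]: "Var v \<noteq> 0"
  by (simp add: Var_def)

lemma restr_free_eq_0:
  assumes "Var v dvd f" "\<forall>m\<in>kys f. lkp m v = 0"
  shows "f = 0"
proof -
  have "kys f = {}" using Var_power_dvd_iff[of v 1 f] assms by auto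
  then show ?thesis by simp
qed

lemma keys_free_mult:
  fixes f g :: zpoly
  assumes "\<forall>m\<in>kys f. lkp m v = 0" "\<forall>m\<in>kys g. lkp m v = 0"
  shows "\<forall>m\<in>kys (f * g). lkp m v = 0"
  using keys_mult[of f g] assms by (fastforce simp: lookup_add)

lemma keys_free_add:
  fixes f g :: zpoly
  assumes "\<forall>m\<in>kys f. lkp m v = 0" "\<forall>m\<in>kys g. lkp m v = 0"
  shows "\<forall>m\<in>kys (f + g). lkp m v = 0"
  using keys_add[of f g] assms by blast

lemma keys_Var [simp]: "kys (Var a) = {sng a 1}"
  by (simp add: Var_def)

lemma keys_free_Var: "a \<noteq> v \<Longrightarrow> \<forall>m\<in>kys (Var a). lkp m v = 0"
  by (simp add: lookup_single)

lemma free_part: obtains f0 f1 where "f = f0 + Var v * f1" "\<forall>m\<in>kys f0. lkp m v = 0"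
proof -
  let ?f0 = "restr (\<lambda>m. lkp m v = 0) f" and ?f1 = "restr (\<lambda>m. lkp m v \<noteq> 0) f"
  have "Var v dvd ?f1"
    using Var_power_dvd_iff[of v 1 ?f1] by (auto simp: keys_restr)
  then obtain f1 where f1: "?f1 = Var v * f1" ..
  have "f = ?f0 + ?f1" by (rule restr_split)
  then have "f = ?f0 + Var v * f1" unfolding f1 .
  then show ?thesis by (rule that) (simp add: keys_restr)
qed

text \<open>Splitting each factor into a \<open>v\<close>-free part and a multiple of
  \<open>v\<close> reduces the claim to the \<open>v\<close>-free parts. Their product is
  \<open>v\<close>-free and divisible by \<open>v\<close>, hence 0, and polynomials form a
  domain.\<close>

lemma Var_prime:
  assumes "Var v dvd f * g"
  shows "Var v dvd f \<or> Var v dvd g"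
proof -
  obtain f0 f1 where f: "f = f0 + Var v * f1" "\<forall>m\<in>kys f0. lkp m v = 0" by (rule free_part)
  obtain g0 g1 where g: "g = g0 + Var v * g1" "\<forall>m\<in>kys g0. lkp m v = 0" by (rule free_part)
  have "f * g = f0 * g0 + Var v * (f1 * g + f0 * g1)"
    by (simp add: f g algebra_simps)
  then have "Var v dvd f0 * g0"
    using assms by (metis dvd_add_times_triv_right_iff mult.commute)
  then have "f0 * g0 = 0"
    using restr_free_eq_0 keys_free_mult f g by blast
  then have "f0 = 0 \<or> g0 = 0" by simp
  then show ?thesis using f g by auto
qed

section \<open>Regularity of U, V, W modulo the hypersurface equation\<close>

definition hyp :: zpoly where "hyp = Var iX * Var iU + Var iY * Var iV + Var iZ * Var iW"

lemma Var_mult_eq_sng: "Var a * Var b = sng (sng a 1 + sng b 1) 1"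
  by (simp add: Var_def mult_single)

lemma Var_not_dvd_sum:
  assumes "distinct [v, a, b, c, e]"
  shows "\<not> Var v dvd Var a * Var b + Var c * Var e"
    and "Var a * Var b + Var c * Var e \<noteq> 0"
proof -
  let ?m = "sng a 1 + sng b (1::nat)"
  have d: "v \<noteq> a" "v \<noteq> b" "c \<noteq> a" "e \<noteq> a"
    using assms by auto
  have "lkp (sng c 1 + sng e (1::nat)) a = 0" "lkp ?m a \<noteq> 0"
    using d by (simp_all add: lookup_add lookup_single_not_eq)
  then have ne: "sng c 1 + sng e (1::nat) \<noteq> ?m" by metis
  have "lkp (Var a * Var b + Var c * Var e) ?m = 1"
    using ne by (simp add: Var_mult_eq_sng lookup_add lookup_single when_def)
  then have "?m \<in> kys (Var a * Var b + Var c * Var e)"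
    by (simp add: in_keys_iff)
  moreover have "lkp ?m v = 0" using d by (simp add: lookup_add lookup_single_not_eq)
  ultimately show "\<not> Var v dvd Var a * Var b + Var c * Var e"
    using Var_power_dvd_iff[of v 1 "Var a * Var b + Var c * Var e"] by fastforce
  then show "Var a * Var b + Var c * Var e \<noteq> 0" by auto
qed

lemma Var_not_dvd_Var_mult:
  assumes "v \<noteq> a" "v \<noteq> b"
  shows "\<not> Var v dvd Var a * Var b"
  using Var_power_dvd_iff[of v 1 "Var a * Var b"] assms
  by (auto simp: Var_mult_eq_sng lookup_add lookup_single)

lemma Var_not_dvd_hyp:
  assumes "v \<in> {iU, iV, iW}"
  shows "\<not> Var v dvd hyp"
proof
  assume *: "Var v dvd hyp"
  consider "v = iU" | "v = iV" | "v = iW" using assms by auto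
  then show False
  proof cases
    case 1
    then show ?thesis using * Var_not_dvd_sum(1)[of iU iY iV iZ iW]
      unfolding hyp_def by (simp add: add.assoc)
  next
    case 2
    have "hyp = (Var iX * Var iU + Var iZ * Var iW) + Var iY * Var iV" by (simp add: hyp_def)
    then show ?thesis using 2 * Var_not_dvd_sum(1)[of iV iX iU iZ iW]
      dvd_add_left_iff[of "Var iV" "Var iY * Var iV" "Var iX * Var iU + Var iZ * Var iW"] by simp
  next
    case 3
    then show ?thesis using * Var_not_dvd_sum(1)[of iW iX iU iY iV]
      unfolding hyp_def by simp
  qed
qed

lemma hyp_neq_0 [simp]: "hyp \<noteq> 0"
  using Var_not_dvd_hyp[of iU] by auto

text \<open>\<open>v\<close> is prime and does not divide \<open>hyp\<close>, so it divides the
  cofactor of \<open>hyp\<close> and cancels.\<close>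

lemma hyp_dvd_Var_mult:
  assumes "v \<in> {iU, iV, iW}" "hyp dvd Var v * f"
  shows "hyp dvd f"
proof -
  obtain q where q: "Var v * f = hyp * q" using assms by (elim dvdE)
  then have "Var v dvd q" using Var_prime[of v hyp q] Var_not_dvd_hyp assms by (metis dvd_triv_left)
  then obtain q' where "q = Var v * q'" ..
  with q have "Var v * f = Var v * (hyp * q')" by (simp add: mult_ac)
  then have "f = hyp * q'" by simp
  then show ?thesis by simp
qed

text \<open>Induction on \<open>k\<close>. Comparing \<open>W\<close>-free parts turns
  \<open>hyp\<close> into \<open>XU + YV\<close>, which \<open>v\<close> does not divide, so
  \<open>f\<close> is a multiple of \<open>W\<close> modulo \<open>hyp\<close>; one factor
  \<open>W\<close> is then cancelled modulo \<open>hyp\<close>.\<close>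

lemma regular_mod_hyp_W:
  assumes v: "v \<in> {iU, iV}" and eq: "hyp dvd Var v * f + Var iW ^ k * a"
  shows "\<exists>b. hyp dvd f + Var iW ^ k * b"
  using eq
proof (induction k arbitrary: f a)
  case 0
  have "f + Var iW ^ 0 * - f = 0" by (simp only: power_0 mult_1_left right_minus)
  then show ?case by (metis dvd_0_right)
next
  case (Suc k)
  let ?h0 = "Var iX * Var iU + Var iY * Var iV"
  obtain q where q: "Var v * f + Var iW ^ Suc k * a = hyp * q" using Suc.prems by (elim dvdE)
  obtain f0 f1 where f: "f = f0 + Var iW * f1" "\<forall>m\<in>kys f0. lkp m iW = 0" by (rule free_part)
  obtain q0 q1 where q0: "q = q0 + Var iW * q1" "\<forall>m\<in>kys q0. lkp m iW = 0" by (rule free_part)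
  \<comment> \<open>\<open>?d\<close> is the \<open>W\<close>-free part of
    \<open>Var v * f - hyp * q\<close>, and this difference is a multiple of \<open>W\<close>; hence
    \<open>?d\<close> is 0.\<close>
  let ?d = "Var v * f0 + (-?h0) * q0"
  have "?d = Var iW * (Var iZ * (q0 + Var iW * q1) + ?h0 * q1 - Var iW ^ k * a - Var v * f1)
      + (Var v * (f0 + Var iW * f1) + Var iW ^ Suc k * a - hyp * (q0 + Var iW * q1))"
    unfolding hyp_def by (simp add: algebra_simps)
  then have "?d = Var iW * (Var iZ * (q0 + Var iW * q1) + ?h0 * q1 - Var iW ^ k * a - Var v * f1)"
    using q by (simp only: f(1)[symmetric] q0(1)[symmetric] diff_self add_0_right)
  then have "Var iW dvd ?d" by simp
  moreover have "\<forall>m\<in>kys ?d. lkp m iW = 0"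
  proof (intro keys_free_add keys_free_mult)
    show "\<forall>m\<in>kys (Var v). lkp m iW = 0" using v by (intro keys_free_Var) auto
    show "\<forall>m\<in>kys (- ?h0). lkp m iW = 0"
      unfolding keys_minus by (intro keys_free_add keys_free_mult keys_free_Var) simp_all
  qed (use f q0 in auto)
  ultimately have "?d = 0" by (rule restr_free_eq_0)
  then have d: "Var v * f0 = ?h0 * q0" by (simp add: algebra_simps)
  have nd: "\<not> Var v dvd ?h0"
  proof (cases "v = iU")
    case True
    then show ?thesis using Var_not_dvd_Var_mult[of iU iY iV] by simp
  next
    case False
    then have "v = iV" using v by auto
    then show ?thesis using Var_not_dvd_Var_mult[of iV iX iU] by simp
  qed
  have "Var v dvd ?h0 * q0" using d by (metis dvd_triv_left)
  then have "Var v dvd q0" using Var_prime[of v ?h0 q0] nd by auto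
  then obtain q2 where "q0 = Var v * q2" ..
  with d have "Var v * f0 = Var v * (?h0 * q2)" by (simp add: mult_ac)
  then have f0: "f0 = ?h0 * q2" by simp
  \<comment> \<open>Replacing \<open>?h0 * q2\<close> by \<open>hyp * q2\<close> costs
    \<open>Var iZ * Var iW * q2\<close>, which is absorbed into the coefficient of
    \<open>W\<close>.\<close>
  define f' where "f' = f1 - Var iZ * q2"
  have ff: "f = hyp * q2 + Var iW * f'" unfolding f(1) f0 f'_def hyp_def by (simp add: algebra_simps)
  have "Var iW * (Var v * f' + Var iW ^ k * a)
      = (Var v * (hyp * q2 + Var iW * f') + Var iW ^ Suc k * a - hyp * q) + hyp * (q - Var v * q2)"
    by (simp add: algebra_simps)
  then have "Var iW * (Var v * f' + Var iW ^ k * a) = hyp * (q - Var v * q2)"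
    using q by (simp only: ff[symmetric] diff_self add_0_left)
  then have "hyp dvd Var v * f' + Var iW ^ k * a"
    using hyp_dvd_Var_mult[of iW] by (metis dvd_triv_left insertCI)
  from Suc.IH[OF this] obtain b where "hyp dvd f' + Var iW ^ k * b" by auto
  then have "hyp dvd hyp * q2 + Var iW * (f' + Var iW ^ k * b)" by simp
  also have "hyp * q2 + Var iW * (f' + Var iW ^ k * b) = f + Var iW ^ Suc k * b"
    unfolding ff by (simp add: algebra_simps)
  finally show ?case by blast
qed

text \<open>The product \<open>UV\<close> is included for the splitting of torsion over the triple
  overlap.\<close>

lemma regular_mod_hyp_W_power:
  assumes "Y \<in> {Var iU, Var iV, Var iU * Var iV}" and "hyp dvd Y ^ l * f + Var iW ^ k * a"
  shows "\<exists>b. hyp dvd f + Var iW ^ k * b"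
  using assms(2)
proof (induction l arbitrary: a)
  case 0
  then show ?case by (auto simp only: power_0 mult_1_left)
next
  case (Suc l)
  let ?g = "Y ^ l * f"
  from Suc.prems have eq: "hyp dvd Y * ?g + Var iW ^ k * a" by (simp only: power_Suc mult.assoc)
  have "\<exists>b. hyp dvd ?g + Var iW ^ k * b"
    using assms(1)
  proof (elim insertE)
    assume "Y = Var iU * Var iV"
    then have "hyp dvd Var iU * (Var iV * ?g) + Var iW ^ k * a"
      using eq by (simp only: mult.assoc)
    then obtain b where "hyp dvd Var iV * ?g + Var iW ^ k * b"
      using regular_mod_hyp_W[of iU] by blast
    then show ?thesis using regular_mod_hyp_W[of iV] by blast
  qed (use eq regular_mod_hyp_W[of iU] regular_mod_hyp_W[of iV] in blast)+
  then show ?case using Suc.IH by blast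
qed

section \<open>The grading by the degree in U, V, W\<close>

definition wdeg :: "(indet \<Rightarrow>\<^sub>0 nat) \<Rightarrow> nat" where
  "wdeg m = lkp m iU + lkp m iV + lkp m iW"

definition hpart :: "int \<Rightarrow> zpoly \<Rightarrow> zpoly" where
  "hpart n = restr (\<lambda>m. int (wdeg m) = n)"

lemma zpoly_part_iff: "f \<in> zpoly_part n \<longleftrightarrow> (\<forall>m\<in>kys f. int (wdeg m) = n)"
  by (simp add: zpoly_part_def wdeg_def)

lemma wdeg_add: "wdeg (m + m') = wdeg m + wdeg m'"
  by (simp add: wdeg_def lookup_add)

lemma zpoly_part_0 [simp]: "0 \<in> zpoly_part n"
  by (simp add: zpoly_part_iff)

lemma zpoly_part_1 [simp]: "1 \<in> zpoly_part 0"
  by (simp add: zpoly_part_iff wdeg_def)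

lemma zpoly_part_of_int [simp]: "of_int c \<in> zpoly_part 0"
proof -
  have "kys (of_int c :: zpoly) \<subseteq> {0}" by (auto simp: in_keys_iff lookup_of_int when_def split: if_splits)
  then show ?thesis by (auto simp: zpoly_part_iff wdeg_def)
qed

lemma zpoly_part_add: "f \<in> zpoly_part n \<Longrightarrow> g \<in> zpoly_part n \<Longrightarrow> f + g \<in> zpoly_part n"
  using keys_add[of f g] by (auto simp: zpoly_part_iff)

lemma zpoly_part_uminus: "f \<in> zpoly_part n \<Longrightarrow> - f \<in> zpoly_part n"
  by (simp add: zpoly_part_iff keys_minus)

lemma zpoly_part_diff: "f \<in> zpoly_part n \<Longrightarrow> g \<in> zpoly_part n \<Longrightarrow> f - g \<in> zpoly_part n"
  using zpoly_part_add[of f n "-g"] zpoly_part_uminus by simp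

lemma zpoly_part_mult: "f \<in> zpoly_part n \<Longrightarrow> g \<in> zpoly_part k \<Longrightarrow> f * g \<in> zpoly_part (n + k)"
  using keys_mult[of f g] by (fastforce simp: zpoly_part_iff wdeg_add)

lemma zpoly_part_mult': "f \<in> zpoly_part n \<Longrightarrow> g \<in> zpoly_part k \<Longrightarrow> n' = n + k \<Longrightarrow> f * g \<in> zpoly_part n'"
  using zpoly_part_mult by blast

lemma zpoly_part_power: "f \<in> zpoly_part n \<Longrightarrow> f ^ k \<in> zpoly_part (int k * n)"
  by (induction k) (auto simp: algebra_simps intro: zpoly_part_mult')

lemma zpoly_part_Var:
  "Var v \<in> zpoly_part (if v \<in> {iU, iV, iW} then 1 else 0)"
  by (auto simp: zpoly_part_iff wdeg_def lookup_single)

lemma zpoly_part_Vars [simp]: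
  "Var iU \<in> zpoly_part 1" "Var iV \<in> zpoly_part 1" "Var iW \<in> zpoly_part 1"
  "Var iX \<in> zpoly_part 0" "Var iY \<in> zpoly_part 0" "Var iZ \<in> zpoly_part 0"
  using zpoly_part_Var[of iU] zpoly_part_Var[of iV] zpoly_part_Var[of iW]
    zpoly_part_Var[of iX] zpoly_part_Var[of iY] zpoly_part_Var[of iZ] by simp_all

lemma zpoly_part_Var_power [simp]:
  "Var iU ^ k \<in> zpoly_part (int k)" "Var iV ^ k \<in> zpoly_part (int k)" "Var iW ^ k \<in> zpoly_part (int k)"
  using zpoly_part_power[of "Var iU" 1 k] zpoly_part_power[of "Var iV" 1 k]
    zpoly_part_power[of "Var iW" 1 k] by simp_all

lemma zpoly_part_hyp [simp]: "hyp \<in> zpoly_part 1"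
  unfolding hyp_def by (intro zpoly_part_add zpoly_part_mult'[where n=0 and k=1]) simp_all

lemma hpart_in_part [simp]: "hpart n f \<in> zpoly_part n"
  by (auto simp: hpart_def zpoly_part_iff keys_restr)

lemma lookup_hpart: "lkp (hpart n f) m = (lkp f m when int (wdeg m) = n)"
  by (simp add: hpart_def lookup_restr)

lemma hpart_of_part: "f \<in> zpoly_part n \<Longrightarrow> hpart k f = (if k = n then f else 0)"
  by (rule poly_mapping_eqI) (auto simp: zpoly_part_iff lookup_hpart when_def in_keys_iff)

lemma hpart_add: "hpart n (f + g) = hpart n f + hpart n g"
  by (simp add: hpart_def restr_add)

lemma hpart_mult:
  assumes "x \<in> zpoly_part k"
  shows "hpart n (x * f) = x * hpart (n - k) f"
proof -
  define r where "r = restr (\<lambda>m. \<not> int (wdeg m) = n - k) f"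
  have f: "f = hpart (n - k) f + r"
    unfolding hpart_def r_def by (rule restr_split)
  have r: "hpart n (x * r) = 0"
  proof (rule poly_mapping_eqI)
    fix m
    have "lkp (x * r) m = 0" if "int (wdeg m) = n"
    proof -
      have "m \<notin> kys (x * r)"
        using keys_mult[of x r] assms that
        by (fastforce simp: r_def keys_restr wdeg_add zpoly_part_iff)
      then show ?thesis by (simp add: in_keys_iff)
    qed
    then show "lkp (hpart n (x * r)) m = lkp 0 m" by (simp add: lookup_hpart when_def)
  qed
  have "hpart n (x * f) = hpart n (x * hpart (n - k) f + x * r)"
    by (subst f) (simp only: distrib_left)
  also have "\<dots> = hpart n (x * hpart (n - k) f)" by (simp add: hpart_add r)
  also have "x * hpart (n - k) f \<in> zpoly_part n"
    using zpoly_part_mult[OF assms hpart_in_part[of "n - k" f]] by simp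
  then have "hpart n (x * hpart (n - k) f) = x * hpart (n - k) f" by (simp add: hpart_of_part)
  finally show ?thesis .
qed

lemma hpart_neg: "n < 0 \<Longrightarrow> hpart n f = 0"
  by (rule poly_mapping_eqI) (auto simp: lookup_hpart when_def)

lemma sum_hpart:
  assumes "finite D" "\<And>m. m \<in> kys f \<Longrightarrow> int (wdeg m) \<in> D"
  shows "(\<Sum>n\<in>D. hpart n f) = f"
proof (rule poly_mapping_eqI)
  fix m
  have "(\<Sum>n\<in>D. lkp (hpart n f) m) = (\<Sum>n\<in>D. if n = int (wdeg m) then lkp f m else 0)"
    by (intro sum.cong) (auto simp: lookup_hpart when_def)
  also have "\<dots> = lkp f m"
    using assms by (auto simp: sum.delta in_keys_iff)
  finally show "lkp (\<Sum>n\<in>D. hpart n f) m = lkp f m" by (simp add: lookup_sum)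
qed

section \<open>The monomial ideals of powers of U, V, W and their syzygies\<close>

lemma monomial_ideal_iff:
  "(\<exists>a b c. f = Var iU ^ k * a + Var iV ^ k * b + Var iW ^ k * c) \<longleftrightarrow>
   (\<forall>m\<in>kys f. k \<le> lkp m iU \<or> k \<le> lkp m iV \<or> k \<le> lkp m iW)" (is "?L \<longleftrightarrow> ?R")
proof
  assume ?L
  then show ?R by (auto simp: in_keys_iff lookup_add lookup_Var_power_mult split: if_splits)
next
  assume R: ?R
  let ?P = "\<lambda>m. k \<le> lkp m iU" and ?Q = "\<lambda>m. k \<le> lkp m iV"
  let ?f1 = "restr (\<lambda>m. \<not> ?P m) f"
  have 1: "f = restr ?P f + ?f1" by (rule restr_split)
  have 2: "?f1 = restr ?Q ?f1 + restr (\<lambda>m. \<not> ?Q m) ?f1" by (rule restr_split)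
  have "Var iU ^ k dvd restr ?P f" "Var iV ^ k dvd restr ?Q ?f1"
    "Var iW ^ k dvd restr (\<lambda>m. \<not> ?Q m) ?f1"
    using R by (auto simp: Var_power_dvd_iff keys_restr)
  then obtain a b c where "restr ?P f = Var iU ^ k * a" "restr ?Q ?f1 = Var iV ^ k * b"
    "restr (\<lambda>m. \<not> ?Q m) ?f1 = Var iW ^ k * c" by (auto elim!: dvdE)
  then have "f = Var iU ^ k * a + Var iV ^ k * b + Var iW ^ k * c"
    using 1 2 by (metis add.assoc)
  then show ?L by blast
qed

text \<open>A monomial with all three exponents below \<open>j\<close> has degree at most
  \<open>3 * j - 3\<close>. Multiplied by \<open>hyp\<close>, the component of \<open>q\<close> in
  that degree lands below degree \<open>3 * j\<close>, where the left-hand side has no terms; since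
  \<open>hyp\<close> is not 0, the component vanishes.\<close>

lemma hyp_multiple_in_monomial_ideal:
  assumes "Var iU ^ (3 * j) * a + Var iV ^ (3 * j) * b + Var iW ^ (3 * j) * c = hyp * q"
  shows "\<exists>a b c. q = Var iU ^ j * a + Var iV ^ j * b + Var iW ^ j * c"
  unfolding monomial_ideal_iff
proof (rule ballI, rule ccontr)
  fix m assume m: "m \<in> kys q" and "\<not> (j \<le> lkp m iU \<or> j \<le> lkp m iV \<or> j \<le> lkp m iW)"
  then have "lkp m iU < j" "lkp m iV < j" "lkp m iW < j" by auto
  then have lt: "int (wdeg m) + 1 - int (3 * j) < 0" by (simp add: wdeg_def)
  let ?n = "int (wdeg m) + 1"
  have "hyp * hpart (int (wdeg m)) q = hpart ?n (hyp * q)"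
    by (simp add: hpart_mult[where k=1])
  also have "\<dots> = 0"
    unfolding assms[symmetric] hpart_add
    using hpart_mult[OF zpoly_part_Var_power(1), of ?n "3 * j" a]
      hpart_mult[OF zpoly_part_Var_power(2), of ?n "3 * j" b]
      hpart_mult[OF zpoly_part_Var_power(3), of ?n "3 * j" c] hpart_neg[OF lt] by simp
  finally have "hpart (int (wdeg m)) q = 0" by simp
  then have "lkp (hpart (int (wdeg m)) q) m = 0" by simp
  then show False using m by (simp add: lookup_hpart in_keys_iff)
qed

lemma Var_power_dvd_Var_power_mult:
  assumes "v \<noteq> w" "Var w ^ k dvd Var v ^ l * f"
  shows "Var w ^ k dvd f"
  unfolding Var_power_dvd_iff
proof
  fix m assume "m \<in> kys f"
  then have "m + sng v l \<in> kys (Var v ^ l * f)"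
    by (simp add: in_keys_iff lookup_Var_power_mult lookup_add)
  then have "k \<le> lkp (m + sng v l) w" using assms(2) Var_power_dvd_iff by blast
  then show "k \<le> lkp m w" using assms(1) by (simp add: lookup_add lookup_single)
qed

text \<open>A monomial of \<open>a\<close> divisible by neither \<open>V^j\<close> nor
  \<open>W^j\<close> could not cancel after multiplication by \<open>U^j\<close>. Splitting
  \<open>a\<close> accordingly leaves a relation between \<open>V^j\<close> and \<open>W^j\<close>
  alone, and divisibility by \<open>W^j\<close> produces \<alpha>.\<close>

lemma koszul_relation:
  assumes eq: "Var iU ^ j * a + Var iV ^ j * b + Var iW ^ j * c = 0"
  shows "\<exists>\<alpha> \<beta> \<gamma>. a = \<beta> * Var iV ^ j + \<gamma> * Var iW ^ j \<and> b = \<alpha> * Var iW ^ j - \<beta> * Var iU ^ j \<and>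
    c = - \<gamma> * Var iU ^ j - \<alpha> * Var iV ^ j"
proof -
  have keys: "j \<le> lkp m iV \<or> j \<le> lkp m iW" if "m \<in> kys a" for m
  proof (rule ccontr)
    assume *: "\<not> ?thesis"
    let ?m = "m + sng iU j"
    have "lkp (Var iU ^ j * a + Var iV ^ j * b + Var iW ^ j * c) ?m = lkp a m"
      using * by (simp add: lookup_Var_power_mult lookup_add lookup_single)
    then show False using that eq by (simp add: in_keys_iff)
  qed
  let ?P = "\<lambda>m. j \<le> lkp m iV"
  have "Var iV ^ j dvd restr ?P a" "Var iW ^ j dvd restr (\<lambda>m. \<not> ?P m) a"
    using keys by (auto simp: Var_power_dvd_iff keys_restr)
  then obtain \<beta> \<gamma> where "restr ?P a = Var iV ^ j * \<beta>" "restr (\<lambda>m. \<not> ?P m) a = Var iW ^ j * \<gamma>"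
    by (auto elim!: dvdE)
  then have a: "a = \<beta> * Var iV ^ j + \<gamma> * Var iW ^ j"
    using restr_split[of a ?P] by (simp only: mult.commute)
  have *: "Var iV ^ j * (b + \<beta> * Var iU ^ j) + Var iW ^ j * (c + \<gamma> * Var iU ^ j) = 0"
    using eq unfolding a by (simp add: algebra_simps)
  then have "Var iV ^ j * (b + \<beta> * Var iU ^ j) = Var iW ^ j * (- (c + \<gamma> * Var iU ^ j))"
    by (metis eq_neg_iff_add_eq_0 mult_minus_right)
  then have "Var iW ^ j dvd Var iV ^ j * (b + \<beta> * Var iU ^ j)" by (metis dvd_triv_left)
  then have "Var iW ^ j dvd b + \<beta> * Var iU ^ j" by (rule Var_power_dvd_Var_power_mult[rotated]) simp
  then obtain \<alpha> where \<alpha>: "b + \<beta> * Var iU ^ j = Var iW ^ j * \<alpha>" ..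
  then have b: "b = \<alpha> * Var iW ^ j - \<beta> * Var iU ^ j" by (simp add: algebra_simps)
  have "Var iW ^ j * (Var iV ^ j * \<alpha> + (c + \<gamma> * Var iU ^ j)) = 0"
    using * unfolding \<alpha> by (simp add: algebra_simps)
  then have "Var iV ^ j * \<alpha> + (c + \<gamma> * Var iU ^ j) = 0" by simp
  then have "c = - \<gamma> * Var iU ^ j - \<alpha> * Var iV ^ j" by (simp add: algebra_simps eq_neg_iff_add_eq_0)
  with a b show ?thesis by blast
qed

section \<open>Truncated contraction systems\<close>

text \<open>\<open>\<phi> a b\<close> and \<open>\<psi> a b\<close> are the values at the exponent vectors \<open>(a, b, N - 1 - a - b)\<close> and
  \<open>(a, b, N - a - b)\<close>; vectors that exceed \<open>(g1, g2, g3)\<close> carry the value 0.\<close>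

definition contraction_eq ::
    "nat \<Rightarrow> nat \<Rightarrow> nat \<Rightarrow> nat \<Rightarrow> (nat \<Rightarrow> nat \<Rightarrow> int) \<Rightarrow> (nat \<Rightarrow> nat \<Rightarrow> int) \<Rightarrow> bool" where
  "contraction_eq N g1 g2 g3 \<phi> \<psi> \<longleftrightarrow>
     (\<forall>a b. g1 < a \<or> g2 < b \<or> N < a + b \<or> g3 < N - a - b \<longrightarrow> \<psi> a b = 0) \<and>
     (\<forall>a b. a + b < N \<longrightarrow> \<phi> a b = \<psi> (Suc a) b + \<psi> a (Suc b) + \<psi> a b)"

text \<open>Pascal's rule under the sum: the binomially weighted sum over level \<open>t + 1\<close>
  becomes one over level \<open>t\<close> of sums of two neighbours, which are the terms that a
  contraction produces.\<close>

lemma sum_choose_Suc: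
  fixes F :: "nat \<Rightarrow> nat \<Rightarrow> int"
  shows "(\<Sum>a\<le>Suc t. int (Suc t choose a) * F a (Suc t - a)) =
    (\<Sum>a\<le>t. int (t choose a) * (F (Suc a) (t - a) + F a (Suc t - a)))"
proof -
  have "(\<Sum>a\<le>t. int (t choose a) * F a (Suc t - a)) = (\<Sum>a\<le>Suc t. int (t choose a) * F a (Suc t - a))"
    by simp
  also have "\<dots> = F 0 (Suc t) + (\<Sum>a\<le>t. int (t choose Suc a) * F (Suc a) (t - a))"
    by (subst sum.atMost_Suc_shift) simp
  finally have *: "(\<Sum>a\<le>t. int (t choose a) * F a (Suc t - a)) =
    F 0 (Suc t) + (\<Sum>a\<le>t. int (t choose Suc a) * F (Suc a) (t - a))" .
  have "(\<Sum>a\<le>Suc t. int (Suc t choose a) * F a (Suc t - a)) =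
    F 0 (Suc t) + (\<Sum>a\<le>t. int (Suc t choose Suc a) * F (Suc a) (t - a))"
    by (subst sum.atMost_Suc_shift) simp
  also have "\<dots> = (F 0 (Suc t) + (\<Sum>a\<le>t. int (t choose Suc a) * F (Suc a) (t - a)))
      + (\<Sum>a\<le>t. int (t choose a) * F (Suc a) (t - a))"
    by (simp add: sum.distrib algebra_simps)
  also have "\<dots> = (\<Sum>a\<le>t. int (t choose a) * (F (Suc a) (t - a) + F a (Suc t - a)))"
    unfolding *[symmetric] by (simp add: sum.distrib algebra_simps)
  finally show ?thesis .
qed

text \<open>The weighted sums \<open>S t\<close> start at \<open>S 0 = \<psi> 0 0\<close>, which is
  0 because the third entry \<open>N\<close> exceeds \<open>N - 1\<close>. From
  \<open>S 1 = c\<close> on they only change sign. On the last level the bounds \<open>i\<close> and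
  \<open>N - i\<close> leave the single term \<open>(N choose i) * \<psi> i (N - i)\<close>.\<close>

lemma choose_dvd_of_contraction_eq:
  assumes "contraction_eq N i (N - i) (N - 1) (\<lambda>a b. if a = 0 \<and> b = 0 then c else 0) \<psi>"
    and N: "0 < N" "i \<le> N"
  shows "int (N choose i) dvd c"
proof -
  have zero: "\<psi> a b = 0" if "i < a \<or> N - i < b \<or> N < a + b \<or> N - 1 < N - a - b" for a b
    using assms(1) that unfolding contraction_eq_def by blast
  have eq: "\<psi> (Suc a) b + \<psi> a (Suc b) = (if a = 0 \<and> b = 0 then c else 0) - \<psi> a b" if "a + b < N" for a b
    using assms(1) that unfolding contraction_eq_def by (smt (verit, best))
  \<comment> \<open>binomial weights turn the system into the recursion \<open>S (t + 1) = - S t\<close> for \<open>t > 0\<close>\<close>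
  define S where "S t = (\<Sum>a\<le>t. int (t choose a) * \<psi> a (t - a))" for t
  have S_Suc: "S (Suc t) = (if t = 0 then c else 0) - S t" if "t < N" for t
  proof -
    have "S (Suc t) = (\<Sum>a\<le>t. int (t choose a) * (\<psi> (Suc a) (t - a) + \<psi> a (Suc (t - a))))"
      unfolding S_def sum_choose_Suc by (intro sum.cong) (auto simp: Suc_diff_le)
    also have "\<dots> = (\<Sum>a\<le>t. int (t choose a) * ((if a = 0 \<and> t = 0 then c else 0) - \<psi> a (t - a)))"
      using that by (intro sum.cong refl) (auto simp: eq)
    also have "\<dots> = (if t = 0 then c else 0) - S t"
      unfolding S_def by (cases "t = 0") (auto simp: right_diff_distrib sum_negf sum_subtractf)
    finally show ?thesis .
  qed
  have S: "S (Suc t) = (-1) ^ t * c" if "t < N" for t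
    using that
  proof (induction t)
    case 0
    have "S 0 = 0" unfolding S_def using zero[of 0 0] N by simp
    then show ?case using S_Suc[of 0] 0 by simp
  next
    case (Suc t)
    then show ?case using S_Suc[of "Suc t"] by simp
  qed
  have "S N = (\<Sum>a\<in>{i}. int (N choose a) * \<psi> a (N - a))"
    unfolding S_def
  proof (rule sum.mono_neutral_right)
    show "\<forall>a\<in>{..N} - {i}. int (N choose a) * \<psi> a (N - a) = 0"
    proof
      fix a assume "a \<in> {..N} - {i}"
      then have "i < a \<or> N - i < N - a" using N by auto
      then have "\<psi> a (N - a) = 0" using zero by blast
      then show "int (N choose a) * \<psi> a (N - a) = 0" by simp
    qed
  qed (use N in auto)
  then have "int (N choose i) dvd S N" by simp
  moreover have "S N = (-1) ^ (N - 1) * c" using S[of "N - 1"] N by simp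
  ultimately show ?thesis
    by (metis dvd_mult_unit_iff' is_unit_power_iff dvd_minus_iff one_dvd dvd_refl)
qed

text \<open>The solution of the homogeneous system with the values \<open>f i\<close> at \<open>(i, N - i, 0)\<close>.\<close>

definition kernel_ext :: "nat \<Rightarrow> (nat \<Rightarrow> int) \<Rightarrow> nat \<Rightarrow> nat \<Rightarrow> int" where
  "kernel_ext N f a b =
     (if N < a + b then 0 else (-1) ^ (N - a - b) * (\<Sum>l\<le>N - a - b. int ((N - a - b) choose l) * f (a + l)))"

text \<open>Iterating \<open>\<psi> a b = - \<psi> (Suc a) b - \<psi> a (Suc b)\<close> up to the
  line \<open>a + b = N\<close> produces binomial weights, so Pascal's rule is the equation
  itself.\<close>

lemma kernel_ext_contraction:
  assumes "a + b < N"
  shows "kernel_ext N f (Suc a) b + kernel_ext N f a (Suc b) + kernel_ext N f a b = 0"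
proof -
  obtain k where k: "N - a - b = Suc k" using assms by (metis Suc_diff_Suc diff_diff_left)
  then have k': "N - Suc a - b = k" "N - a - Suc b = k" by auto
  have "kernel_ext N f a b = - ((-1) ^ k * (\<Sum>l\<le>k. int (k choose l) * (f (a + Suc l) + f (a + l))))"
    using assms sum_choose_Suc[of k "\<lambda>l _. f (a + l)"] unfolding kernel_ext_def k by simp
  then show ?thesis
    using assms unfolding kernel_ext_def k'
    by (simp add: sum.distrib algebra_simps)
qed

text \<open>The entry at \<open>(a, b)\<close> involves only \<open>f i\<close> with
  \<open>a \<le> i \<le> N - b\<close>, which settles the first two bounds. The third is assumed
  only on the row \<open>b = 0\<close>: the contraction equation carries it to larger
  \<open>b\<close>, since the two other entries it uses still exceed \<open>g3\<close>.\<close>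

lemma kernel_ext_eq_0:
  assumes f1: "\<And>i. g1 < i \<Longrightarrow> f i = 0" and f2: "\<And>i. i < N - g2 \<Longrightarrow> f i = 0"
    and f3: "\<And>m. m < N - g3 \<Longrightarrow> kernel_ext N f m 0 = 0"
    and "g1 < a \<or> g2 < b \<or> N < a + b \<or> g3 < N - a - b"
  shows "kernel_ext N f a b = 0"
proof -
  consider "N < a + b" | "g1 < a" | "g2 < b" "a + b \<le> N" | "g3 < N - a - b" "a + b \<le> N"
    using assms(4) by linarith
  then show ?thesis
  proof cases
    case 1
    then show ?thesis by (simp add: kernel_ext_def)
  next
    case 2
    then show ?thesis by (simp add: kernel_ext_def f1)
  next
    case 3
    then show ?thesis by (auto simp: kernel_ext_def intro!: sum.neutral f2)
  next
    case 4
    then show ?thesis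
    proof (induction b arbitrary: a)
      case 0
      then show ?case using f3[of a] by simp
    next
      case (Suc b)
      have "kernel_ext N f (Suc a) b = 0" "kernel_ext N f a b = 0"
        using Suc.prems by (auto intro!: Suc.IH)
      then show ?case using kernel_ext_contraction[of a b N f] Suc.prems by simp
    qed
  qed
qed

lemma kernel_ext_cong_dvd:
  assumes "\<And>i. i \<le> N \<Longrightarrow> p dvd f i - f' i"
  shows "p dvd kernel_ext N f a b - kernel_ext N f' a b"
proof (cases "N < a + b")
  case False
  have "kernel_ext N f a b - kernel_ext N f' a b =
    (-1) ^ (N - a - b) * (\<Sum>l\<le>N - a - b. int ((N - a - b) choose l) * (f (a + l) - f' (a + l)))"
    using False by (simp add: kernel_ext_def right_diff_distrib sum_subtractf)
  also have "p dvd \<dots>"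
    using False by (intro dvd_mult dvd_sum dvd_mult assms) auto
  finally show ?thesis .
qed (simp add: kernel_ext_def)

lemma kernel_ext_mult: "kernel_ext N (\<lambda>i. c * f i) a b = c * kernel_ext N f a b"
  by (simp add: kernel_ext_def sum_distrib_left mult_ac)

text \<open>Each equation expresses an entry through two entries closer to the line
  \<open>a + b = N\<close>, so modulo \<open>p\<close> the values on that line determine the
  rest.\<close>

lemma kernel_ext_cong_solution:
  assumes eq: "\<And>a b. a + b < N \<Longrightarrow> p dvd \<psi> (Suc a) b + \<psi> a (Suc b) + \<psi> a b"
    and f: "\<And>i. i \<le> N \<Longrightarrow> f i = \<psi> i (N - i)"
    and "a + b \<le> N"
  shows "p dvd \<psi> a b - kernel_ext N f a b"
  using assms(3)
proof (induction "N - a - b" arbitrary: a b)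
  case 0
  then have "b = N - a" "a \<le> N" by auto
  then show ?case by (simp add: kernel_ext_def f)
next
  case (Suc k)
  have IH: "p dvd \<psi> (Suc a) b - kernel_ext N f (Suc a) b" "p dvd \<psi> a (Suc b) - kernel_ext N f a (Suc b)"
    using Suc.hyps by (auto intro!: Suc.hyps(1))
  have lt: "a + b < N" using Suc.hyps by auto
  have "\<psi> a b - kernel_ext N f a b =
    (\<psi> (Suc a) b + \<psi> a (Suc b) + \<psi> a b)
      - (\<psi> (Suc a) b - kernel_ext N f (Suc a) b) - (\<psi> a (Suc b) - kernel_ext N f a (Suc b))"
    using kernel_ext_contraction[OF lt, of f] by simp
  then show ?case using IH eq[OF lt] by (metis dvd_diff)
qed

section \<open>Integer polynomials with prescribed zeros at 0 and 1 modulo p\<close>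

abbreviation taylor1 :: "int poly \<Rightarrow> int poly" where "taylor1 G \<equiv> pcompose G [:1, 1:]"

lemma taylor1_power: "taylor1 (P ^ n) = taylor1 P ^ n"
  by (induction n) (simp_all add: pcompose_1 pcompose_mult)

text \<open>With these weights the coefficients after the substitution \<open>t + 1\<close> are
  multiples of \<open>kernel_ext N f m 0\<close>. Thus the third truncation bound becomes a zero at
  1, while the other two restrict the exponents that occur.\<close>

definition binom_poly :: "nat \<Rightarrow> (nat \<Rightarrow> int) \<Rightarrow> int poly" where
  "binom_poly N f = (\<Sum>i\<le>N. monom (int (N choose i) * f i) i)"

lemma coeff_binom_poly: "coeff (binom_poly N f) i = int (N choose i) * f i"
  by (simp add: binom_poly_def coeff_sum coeff_monom sum.delta)

text \<open>The identity \<open>(N choose i) * (i choose m) = (N choose m) * ((N - m) choose (i -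
  m))\<close> pulls the factor \<open>N choose m\<close> out of the Taylor coefficient.\<close>

lemma coeff_taylor1_binom_poly:
  assumes "m \<le> N"
  shows "coeff (taylor1 (binom_poly N f)) m = int (N choose m) * ((-1) ^ (N - m) * kernel_ext N f m 0)"
proof -
  have "taylor1 (monom c i) = smult c ([:1, 1:] ^ i)" for c :: int and i
    by (simp add: monom_altdef pcompose_smult taylor1_power pcompose_pCons)
  moreover have "coeff ([:1, 1::int:] ^ i) m = int (i choose m)" for i
    by (cases "m \<le> i") (simp_all add: coeff_linear_poly_power coeff_eq_0 degree_linear_power binomial_eq_0 not_le)
  ultimately have "coeff (taylor1 (monom c i)) m = c * int (i choose m)" for c :: int and i
    by simp
  then have "coeff (taylor1 (binom_poly N f)) m = (\<Sum>i\<le>N. int (N choose i) * f i * int (i choose m))"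
    by (simp add: binom_poly_def pcompose_sum coeff_sum)
  also have "\<dots> = (\<Sum>i=m..N. int (N choose i) * f i * int (i choose m))"
    by (rule sum.mono_neutral_right) (auto simp: not_le binomial_eq_0)
  also have "\<dots> = (\<Sum>i=0+m..(N - m)+m. int (N choose i) * f i * int (i choose m))"
    using assms by simp
  also have "\<dots> = (\<Sum>l=0..N - m. int (N choose (l + m)) * f (l + m) * int ((l + m) choose m))"
    by (rule sum.shift_bounds_cl_nat_ivl)
  also have "\<dots> = (\<Sum>l\<le>N - m. int (N choose m) * (int ((N - m) choose l) * f (m + l)))"
  proof (rule sum.cong)
    fix l assume "l \<in> {..N - m}"
    then have "(N choose (l + m)) * ((l + m) choose m) = (N choose m) * ((N - m) choose l)"
      using choose_mult[of m "l + m" N] assms by simp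
    then have "int (N choose (l + m)) * int ((l + m) choose m) = int (N choose m) * int ((N - m) choose l)"
      by (metis of_nat_mult)
    then show "int (N choose (l + m)) * f (l + m) * int ((l + m) choose m) =
        int (N choose m) * (int ((N - m) choose l) * f (m + l))"
      by (simp add: mult_ac add.commute)
  qed auto
  also have "\<dots> = int (N choose m) * ((-1) ^ (N - m) * kernel_ext N f m 0)"
    using assms by (simp add: kernel_ext_def sum_distrib_left power_mult_distrib[symmetric] flip: mult.assoc)
  finally show ?thesis .
qed

text \<open>\<open>t^a\<close> has value 1 at 1, so \<open>G\<close> itself vanishes there to order
  \<open>b\<close> modulo \<open>p\<close>; synthetic division extracts one factor
  \<open>t - 1\<close> at a time. The degree bound later keeps the lift inside the truncation by
  \<open>g1\<close>.\<close>

lemma linear_power_dvd_mod: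
  fixes G :: "int poly"
  assumes "\<And>m. m < b \<Longrightarrow> p dvd coeff (taylor1 ([:0, 1:] ^ a * G)) m"
  shows "\<exists>Q. [:p:] dvd G - [:-1, 1:] ^ b * Q \<and> degree ([:-1, 1:] ^ b * Q) \<le> degree G"
  using assms
proof (induction b arbitrary: G)
  case 0
  then show ?case by (intro exI[of _ G]) simp
next
  case (Suc b)
  define c where "c = poly G 1"
  have "coeff (taylor1 ([:0, 1:] ^ a * G)) 0 = c"
    by (simp add: coeff_pcompose_0 c_def)
  then have c: "p dvd c" using Suc.prems[of 0] by simp
  define Q1 where "Q1 = synthetic_div G 1"
  have G: "G = [:-1, 1:] * Q1 + [:c:]"
    using synthetic_div_correct'[of 1 G] by (simp add: Q1_def c_def)
  have X: "taylor1 [:-1, 1:] = [:0, 1:]" by (simp add: pcompose_pCons)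
  \<comment> \<open>Dividing by \<open>t - 1\<close> shifts the Taylor expansion at 1 by one place,
    up to a multiple of \<open>c\<close>, which is 0 modulo \<open>p\<close>.\<close>
  have t: "taylor1 ([:0, 1:] ^ a * G) = pCons 0 (taylor1 ([:0, 1:] ^ a * Q1)) + smult c (taylor1 ([:0, 1:] ^ a))"
  proof -
    have "[:0, 1:] ^ a * G = [:-1, 1:] * ([:0, 1:] ^ a * Q1) + smult c ([:0, 1:] ^ a)"
      unfolding G distrib_left by (simp only: mult.left_commute[of "[:0, 1:] ^ a"]) simp
    then show ?thesis by (simp only: pcompose_mult[of "[:-1, 1:]"] pcompose_add pcompose_smult X) simp
  qed
  have "p dvd coeff (taylor1 ([:0, 1:] ^ a * Q1)) m" if "m < b" for m
  proof -
    have "coeff (taylor1 ([:0, 1:] ^ a * G)) (Suc m) =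
      coeff (taylor1 ([:0, 1:] ^ a * Q1)) m + c * coeff (taylor1 ([:0, 1:] ^ a)) (Suc m)"
      unfolding t by simp
    then show ?thesis using Suc.prems[of "Suc m"] that c
      by (metis Suc_less_eq dvd_add_left_iff dvd_mult2)
  qed
  from Suc.IH[OF this] obtain Q where Q: "[:p:] dvd Q1 - [:-1, 1:] ^ b * Q"
    "degree ([:-1, 1:] ^ b * Q) \<le> degree Q1" by blast
  show ?case
  \<comment> \<open>A constant leaves no room for a factor \<open>t - 1\<close>, but then
    \<open>G\<close> is \<open>[:c:]\<close> with \<open>p dvd c\<close>, and the cofactor 0
    respects the degree bound.\<close>
  proof (cases "degree G = 0")
    case True
    then have "Q1 = 0" by (simp add: Q1_def synthetic_div_eq_0_iff)
    then have "G = [:c:]" using G by simp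
    then have "[:p:] dvd G" using c by simp
    then show ?thesis by (intro exI[of _ 0]) simp
  next
    case False
    have "G - [:-1, 1:] ^ Suc b * Q = [:-1, 1:] * (Q1 - [:-1, 1:] ^ b * Q) + [:c:]"
      unfolding G by (simp add: algebra_simps del: mult_pCons_left mult_pCons_right)
    moreover have "[:p:] dvd [:c:]" using c by simp
    ultimately have "[:p:] dvd G - [:-1, 1:] ^ Suc b * Q"
      using Q(1) by (metis dvd_add dvd_mult)
    moreover have "degree ([:-1, 1:] ^ Suc b * Q) \<le> degree G"
    proof -
      have "degree ([:-1, 1:] ^ Suc b * Q) \<le> degree [:-1, 1::int:] + degree ([:-1, 1:] ^ b * Q)"
        unfolding power_Suc mult.assoc by (rule degree_mult_le)
      also have "\<dots> \<le> 1 + degree Q1" using Q(2) by simp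
      also have "\<dots> = degree G" using False by (simp add: Q1_def degree_synthetic_div)
      finally show ?thesis .
    qed
    ultimately show ?thesis by blast
  qed
qed

text \<open>The coefficients below \<open>a\<close> vanish modulo \<open>p\<close> and are dropped;
  the rest is \<open>t^a * G1\<close>, and the zero at 1 is then extracted from
  \<open>G1\<close>.\<close>

lemma two_linear_powers_dvd_mod:
  fixes G :: "int poly"
  assumes 1: "\<And>i. i < a \<Longrightarrow> p dvd coeff G i" and 2: "\<And>m. m < b \<Longrightarrow> p dvd coeff (taylor1 G) m"
  shows "\<exists>Q. [:p:] dvd G - [:0, 1:] ^ a * ([:-1, 1:] ^ b * Q) \<and>
    degree ([:0, 1:] ^ a * ([:-1, 1:] ^ b * Q)) \<le> degree G"
proof -
  define G1 where "G1 = poly_shift a G"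
  have X: "coeff ([:0, 1:] ^ a * P) i = (if a \<le> i then coeff P (i - a) else 0)" for P :: "int poly" and i
    by (simp add: coeff_monom_mult flip: monom_altdef[of 1 a, simplified])
  have G: "[:p:] dvd G - [:0, 1:] ^ a * G1"
    using 1 by (auto simp: const_poly_dvd_iff X G1_def coeff_poly_shift)
  show ?thesis
  \<comment> \<open>A nonzero \<open>G1\<close> forces \<open>a \<le> degree G\<close>, on which the
    degree count with natural subtraction relies.\<close>
  proof (cases "G1 = 0")
    case True
    then show ?thesis using G by (intro exI[of _ 0]) simp
  next
    case False
    then have "coeff G (degree G1 + a) \<noteq> 0"
      by (metis G1_def coeff_poly_shift leading_coeff_0_iff)
    then have a: "a \<le> degree G" using le_degree by fastforce
    have "p dvd coeff (taylor1 ([:0, 1:] ^ a * G1)) m" if "m < b" for m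
    proof -
      obtain D where D: "G - [:0, 1:] ^ a * G1 = smult p D" using G by (auto elim!: dvdE)
      have "taylor1 ([:0, 1:] ^ a * G1) = taylor1 G - smult p (taylor1 D)"
        unfolding pcompose_smult[symmetric] D[symmetric] pcompose_diff by simp
      then show ?thesis using 2[OF that] by simp
    qed
    from linear_power_dvd_mod[OF this] obtain Q where Q: "[:p:] dvd G1 - [:-1, 1:] ^ b * Q"
      "degree ([:-1, 1:] ^ b * Q) \<le> degree G1" by blast
    have "[:p:] dvd (G - [:0, 1:] ^ a * G1) + [:0, 1:] ^ a * (G1 - [:-1, 1:] ^ b * Q)"
      using G Q by (intro dvd_add dvd_mult) auto
    also have "(G - [:0, 1:] ^ a * G1) + [:0, 1:] ^ a * (G1 - [:-1, 1:] ^ b * Q)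
        = G - [:0, 1:] ^ a * ([:-1, 1:] ^ b * Q)"
      by (simp only: right_diff_distrib diff_add_eq add_diff_eq diff_add_cancel)
    finally have 1: "[:p:] dvd G - [:0, 1:] ^ a * ([:-1, 1:] ^ b * Q)" .
    have "degree ([:0, 1:] ^ a * ([:-1, 1:] ^ b * Q)) \<le> degree ([:0, 1::int:] ^ a) + degree ([:-1, 1:] ^ b * Q)"
      by (rule degree_mult_le)
    also have "\<dots> \<le> a + degree G1" using Q(2) degree_power_le[of "[:0, 1::int:]" a] by simp
    also have "\<dots> \<le> degree G"
    proof -
      have "degree G1 \<le> degree G - a"
        by (rule degree_le) (auto simp: G1_def coeff_poly_shift intro!: coeff_eq_0)
      then show ?thesis using a by simp
    qed
    finally show ?thesis using 1 by blast
  qed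
qed

lemma contraction_eq_torsion_free:
  assumes p: "Factorial_Ring.prime (p :: int)" and np: "\<And>i. i \<le> N \<Longrightarrow> \<not> p dvd int (N choose i)"
    and \<psi>: "contraction_eq N g1 g2 g3 (\<lambda>a b. p * \<phi> a b) \<psi>"
  shows "\<exists>\<psi>'. contraction_eq N g1 g2 g3 \<phi> \<psi>'"
proof -
  have zero: "\<psi> a b = 0" if "g1 < a \<or> g2 < b \<or> N < a + b \<or> g3 < N - a - b" for a b
    using \<psi> that unfolding contraction_eq_def by blast
  have eq: "p * \<phi> a b = \<psi> (Suc a) b + \<psi> a (Suc b) + \<psi> a b" if "a + b < N" for a b
    using \<psi> that unfolding contraction_eq_def by blast
  \<comment> \<open>Modulo \<open>p\<close> the values on the line \<open>a + b = N\<close>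
    determine \<open>\<psi>\<close>; they are the data to be lifted.\<close>
  define f where "f i = (if i \<le> N then \<psi> i (N - i) else 0)" for i
  have cong: "p dvd \<psi> a b - kernel_ext N f a b" if "a + b \<le> N" for a b
    using that
    by (intro kernel_ext_cong_solution) (simp_all add: f_def flip: eq)
  have f1: "f i = 0" if "g1 < i \<or> i < N - g2" for i
  proof -
    have "i \<le> N \<Longrightarrow> g1 < i \<or> g2 < N - i" using that by linarith
    then show ?thesis unfolding f_def using zero[of i "N - i"] by auto
  qed
  define G where "G = binom_poly N f"
  have "p dvd coeff G i" if "i < N - g2" for i
    using f1 that by (simp add: G_def coeff_binom_poly)
  moreover have "p dvd coeff (taylor1 G) m" if "m < N - g3" for m
  proof -
    have "g3 < N - m - 0" using that by linarith
    then have "\<psi> m 0 = 0" using zero[of m 0] by blast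
    then have "p dvd kernel_ext N f m 0" using cong[of m 0] that by simp
    then show ?thesis using that by (simp add: G_def coeff_taylor1_binom_poly)
  qed
  ultimately obtain Q where Q: "[:p:] dvd G - [:0, 1:] ^ (N - g2) * ([:-1, 1:] ^ (N - g3) * Q)"
    and deg: "degree ([:0, 1:] ^ (N - g2) * ([:-1, 1:] ^ (N - g3) * Q)) \<le> degree G"
    using two_linear_powers_dvd_mod by blast
  \<comment> \<open>\<open>H\<close> agrees with \<open>G\<close> modulo \<open>p\<close>, but has
    its zeros at 0 and 1 over the integers, and its degree does not exceed that of
    \<open>G\<close>.\<close>
  define H where "H = [:0, 1:] ^ (N - g2) * ([:-1, 1:] ^ (N - g3) * Q)"
  have "coeff G i = 0" if "min N g1 < i" for i
    using that f1 by (auto simp: G_def coeff_binom_poly min_less_iff_disj)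
  then have "degree G \<le> min N g1" by (simp add: degree_le)
  then have H1: "coeff H i = 0" if "N < i \<or> g1 < i" for i
    using deg that by (intro coeff_eq_0) (auto simp: H_def)
  have H2: "coeff H i = 0" if "i < N - g2" for i
    using that by (simp add: H_def coeff_monom_mult flip: monom_altdef[of 1, simplified])
  have H3: "coeff (taylor1 H) m = 0" if "m < N - g3" for m
  proof -
    have X: "taylor1 ([:-1, 1:] ^ n) = [:0, 1:] ^ n" for n
      by (simp add: taylor1_power pcompose_pCons)
    have "taylor1 H = [:0, 1:] ^ (N - g3) * (taylor1 ([:0, 1:] ^ (N - g2)) * taylor1 Q)"
      unfolding H_def pcompose_mult X by (simp only: mult_ac)
    then show ?thesis using that
      by (simp add: coeff_monom_mult flip: monom_altdef[of 1, simplified])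
  qed
  have H4: "p dvd coeff G i - coeff H i" for i
    using Q unfolding H_def[symmetric] const_poly_dvd_iff by simp
  \<comment> \<open>\<open>coeff H i\<close> need not be divisible by \<open>N choose i\<close>. The
    common multiple \<open>c\<close> makes the division exact and is prime to \<open>p\<close> by
    hypothesis.\<close>
  define c where "c = (\<Prod>i\<le>N. int (N choose i))"
  define f' where "f' i = (c div int (N choose i)) * coeff H i" for i
  have f': "int (N choose i) * f' i = c * coeff H i" for i
  proof (cases "i \<le> N")
    case True
    then have "int (N choose i) dvd c" unfolding c_def by (intro dvd_prodI) auto
    then show ?thesis by (simp add: f'_def flip: mult.assoc)
  next
    case False
    then show ?thesis using H1 by (simp add: f'_def)
  qed
  have B: "binom_poly N f' = smult c H"
    by (rule poly_eqI) (simp add: coeff_binom_poly f')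
  have cp: "coprime c p"
    unfolding c_def using p np
    by (intro prod_coprime_left) (simp add: coprime_commute prime_imp_coprime)
  have ker0: "kernel_ext N f' a b = 0" if "g1 < a \<or> g2 < b \<or> N < a + b \<or> g3 < N - a - b" for a b
  proof (rule kernel_ext_eq_0[OF _ _ _ that])
    show "f' i = 0" if "g1 < i" for i using H1 that by (simp add: f'_def)
    show "f' i = 0" if "i < N - g2" for i using H2 that by (simp add: f'_def)
    show "kernel_ext N f' m 0 = 0" if "m < N - g3" for m
    proof -
      have "int (N choose m) * ((-1) ^ (N - m) * kernel_ext N f' m 0) = 0"
        using coeff_taylor1_binom_poly[of m N f'] H3[OF that] that by (simp add: B pcompose_smult)
      then show ?thesis using that by auto
    qed
  qed
  have ff': "p dvd c * f i - f' i" if "i \<le> N" for i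
  proof -
    have "int (N choose i) * (c * f i - f' i) = c * (coeff G i - coeff H i)"
      unfolding right_diff_distrib f' by (simp add: G_def coeff_binom_poly)
    then have "p dvd int (N choose i) * (c * f i - f' i)" using H4 by simp
    then show ?thesis using np[OF that] p by (simp add: prime_dvd_mult_iff)
  qed
  \<comment> \<open>The two terms agree modulo \<open>p\<close>, and the second solves the
    homogeneous system, so \<open>\<chi>\<close> is an integral solution for
    \<open>c * \<phi>\<close>.\<close>
  define \<chi> where "\<chi> a b = (c * \<psi> a b - kernel_ext N f' a b) div p" for a b
  have \<chi>: "p * \<chi> a b = c * \<psi> a b - kernel_ext N f' a b" for a b
  proof (cases "N < a + b")
    case True
    then show ?thesis using zero ker0 by (simp add: \<chi>_def)
  next
    case False
    have "p dvd kernel_ext N (\<lambda>i. c * f i) a b - kernel_ext N f' a b"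
      using ff' by (rule kernel_ext_cong_dvd)
    moreover have "p dvd c * (\<psi> a b - kernel_ext N f a b)" using cong False by simp
    ultimately have "p dvd c * (\<psi> a b - kernel_ext N f a b)
        + (kernel_ext N (\<lambda>i. c * f i) a b - kernel_ext N f' a b)" by (rule dvd_add[rotated])
    also have "\<dots> = c * \<psi> a b - kernel_ext N f' a b"
      by (simp add: kernel_ext_mult right_diff_distrib)
    finally show ?thesis by (simp add: \<chi>_def)
  qed
  have p0: "p \<noteq> 0" using p by auto
  have \<chi>0: "\<chi> a b = 0" if "g1 < a \<or> g2 < b \<or> N < a + b \<or> g3 < N - a - b" for a b
    using \<chi>[of a b] zero[OF that] ker0[OF that] p0 by simp
  have \<chi>eq: "c * \<phi> a b = \<chi> (Suc a) b + \<chi> a (Suc b) + \<chi> a b" if "a + b < N" for a b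
  proof -
    have "p * (\<chi> (Suc a) b + \<chi> a (Suc b) + \<chi> a b) = c * (\<psi> (Suc a) b + \<psi> a (Suc b) + \<psi> a b)
      - (kernel_ext N f' (Suc a) b + kernel_ext N f' a (Suc b) + kernel_ext N f' a b)"
      unfolding distrib_left \<chi> by simp
    also have "\<dots> = p * (c * \<phi> a b)"
      unfolding kernel_ext_contraction[OF that] eq[OF that, symmetric] by simp
    finally show ?thesis using p0 by simp
  qed
  \<comment> \<open>The solutions for \<open>c * \<phi>\<close> and for \<open>p * \<phi>\<close>
    combine to one for \<open>\<phi>\<close>.\<close>
  obtain x y where xy: "x * c + y * p = 1"
    using cp bezout_int[of c p] by auto
  have "\<phi> a b = (x * c + y * p) * \<phi> a b" for a b by (simp add: xy)
  then have \<phi>: "\<phi> a b = x * (c * \<phi> a b) + y * (p * \<phi> a b)" for a b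
    by (simp add: algebra_simps)
  have "contraction_eq N g1 g2 g3 \<phi> (\<lambda>a b. x * \<chi> a b + y * \<psi> a b)"
    unfolding contraction_eq_def
  proof (intro conjI allI impI)
    fix a b assume "a + b < N"
    then show "\<phi> a b = x * \<chi> (Suc a) b + y * \<psi> (Suc a) b + (x * \<chi> a (Suc b) + y * \<psi> a (Suc b))
        + (x * \<chi> a b + y * \<psi> a b)"
      by (subst \<phi>) (simp only: \<chi>eq eq, simp add: algebra_simps)
  qed (simp add: zero \<chi>0)
  then show ?thesis by blast
qed

section \<open>Fractions modulo the Cech coboundaries\<close>

definition UVW :: zpoly where "UVW = Var iU * Var iV * Var iW"

text \<open>Membership of \<open>f\<close> says that in \<open>R'\<close> the fraction
  \<open>f / (UVW)^K\<close> is a sum of fractions with denominators \<open>(VW)^K\<close>,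
  \<open>(UW)^K\<close> and \<open>(UV)^K\<close>; the multiples of \<open>hyp\<close> account for
  polynomial representatives.\<close>

definition cech_ideal :: "nat \<Rightarrow> zpoly set" where
  "cech_ideal K = {Var iU ^ K * a + Var iV ^ K * b + Var iW ^ K * c + hyp * q | a b c q. True}"

lemma cech_idealI: "f = Var iU ^ K * a + Var iV ^ K * b + Var iW ^ K * c + hyp * q \<Longrightarrow> f \<in> cech_ideal K"
  unfolding cech_ideal_def by blast

lemma cech_idealE:
  assumes "f \<in> cech_ideal K"
  obtains a b c q where "f = Var iU ^ K * a + Var iV ^ K * b + Var iW ^ K * c + hyp * q"
  using assms unfolding cech_ideal_def by blast

lemma cech_ideal_add:
  assumes "f \<in> cech_ideal K" "g \<in> cech_ideal K"
  shows "f + g \<in> cech_ideal K"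
proof -
  obtain a b c q where f: "f = Var iU ^ K * a + Var iV ^ K * b + Var iW ^ K * c + hyp * q"
    by (rule cech_idealE[OF assms(1)])
  obtain a' b' c' q' where g: "g = Var iU ^ K * a' + Var iV ^ K * b' + Var iW ^ K * c' + hyp * q'"
    by (rule cech_idealE[OF assms(2)])
  show ?thesis unfolding f g
    by (rule cech_idealI[of _ _ "a + a'" "b + b'" "c + c'" "q + q'"]) (simp add: algebra_simps)
qed

lemma cech_ideal_mult:
  assumes "f \<in> cech_ideal K"
  shows "r * f \<in> cech_ideal K"
proof -
  obtain a b c q where f: "f = Var iU ^ K * a + Var iV ^ K * b + Var iW ^ K * c + hyp * q"
    by (rule cech_idealE[OF assms(1)])
  show ?thesis unfolding f
    by (rule cech_idealI[of _ _ "r * a" "r * b" "r * c" "r * q"]) (simp add: algebra_simps)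
qed

lemma cech_ideal_gens:
  "Var iU ^ K * f \<in> cech_ideal K" "Var iV ^ K * f \<in> cech_ideal K"
  "Var iW ^ K * f \<in> cech_ideal K" "hyp * f \<in> cech_ideal K"
  by (rule cech_idealI[of _ _ f 0 0 0] cech_idealI[of _ _ 0 f 0 0]
      cech_idealI[of _ _ 0 0 f 0] cech_idealI[of _ _ 0 0 0 f]; simp)+

lemma cech_ideal_dvd:
  "Var iU ^ K dvd f \<or> Var iV ^ K dvd f \<or> Var iW ^ K dvd f \<or> hyp dvd f \<Longrightarrow> f \<in> cech_ideal K"
  by (auto elim!: dvdE intro: cech_ideal_gens)

lemma cech_ideal_UVW_mult:
  assumes "f \<in> cech_ideal K"
  shows "UVW * f \<in> cech_ideal (Suc K)"
proof -
  obtain a b c q where f: "f = Var iU ^ K * a + Var iV ^ K * b + Var iW ^ K * c + hyp * q"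
    by (rule cech_idealE[OF assms])
  show ?thesis unfolding f UVW_def
    by (rule cech_idealI[of _ _ "Var iV * Var iW * a" "Var iU * Var iW * b" "Var iU * Var iV * c"
          "Var iU * Var iV * Var iW * q"]) (simp add: algebra_simps)
qed

lemma cech_ideal_UVW_power_mult:
  "f \<in> cech_ideal K \<Longrightarrow> UVW ^ i * f \<in> cech_ideal (K + i)"
  by (induction i) (simp_all add: cech_ideal_UVW_mult mult.assoc)

text \<open>\<open>s / (UVW)\<^sup>k\<close> vanishes modulo the Cech coboundaries, the sums of fractions in which one of
  \<open>U, V, W\<close> is missing from the denominator.\<close>

definition null_frac :: "zpoly \<Rightarrow> nat \<Rightarrow> bool" where
  "null_frac s k \<longleftrightarrow> (\<exists>j. UVW ^ j * s \<in> cech_ideal (k + j))"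

lemma cech_ideal_shift:
  assumes "UVW ^ j * s \<in> cech_ideal (k + j)" "j \<le> j'"
  shows "UVW ^ j' * s \<in> cech_ideal (k + j')"
proof -
  have "UVW ^ (j' - j) * (UVW ^ j * s) \<in> cech_ideal (k + j + (j' - j))"
    by (rule cech_ideal_UVW_power_mult[OF assms(1)])
  then show ?thesis using assms(2) by (simp flip: mult.assoc power_add)
qed

lemma null_fracE:
  assumes "null_frac s k"
  obtains j where "j \<ge> i" "UVW ^ j * s \<in> cech_ideal (k + j)"
proof -
  obtain j where "UVW ^ j * s \<in> cech_ideal (k + j)" using assms by (auto simp: null_frac_def)
  then show ?thesis using that[of "max i j"] cech_ideal_shift[of j s k "max i j"] by simp
qed

lemma null_frac_add:
  assumes "null_frac s k" "null_frac t k"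
  shows "null_frac (s + t) k"
proof -
  obtain i where i: "UVW ^ i * s \<in> cech_ideal (k + i)" using assms(1) by (auto simp: null_frac_def)
  obtain j where j: "j \<ge> i" "UVW ^ j * t \<in> cech_ideal (k + j)" using assms(2) by (rule null_fracE)
  show ?thesis unfolding null_frac_def distrib_left
    using cech_ideal_add[OF cech_ideal_shift[OF i j(1)] j(2)] by blast
qed

lemma null_frac_mult: "null_frac s k \<Longrightarrow> null_frac (r * s) k"
  unfolding null_frac_def by (metis cech_ideal_mult mult.left_commute)

lemma null_frac_0: "null_frac 0 k"
  unfolding null_frac_def by (intro exI[of _ 0] cech_ideal_dvd) simp

lemma null_frac_uminus: "null_frac (- s) k \<longleftrightarrow> null_frac s k"
  using null_frac_mult[of s k "-1"] null_frac_mult[of "-s" k "-1"] by auto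

lemma null_frac_add_iff: "null_frac t k \<Longrightarrow> null_frac (s + t) k \<longleftrightarrow> null_frac s k"
  using null_frac_add[of "s + t" k "- t"] null_frac_add[of s k t] by (auto simp: null_frac_uminus)

lemma power_add_split:
  fixes A B :: "'a::comm_ring_1"
  shows "\<exists>c e. (A + B) ^ (k + l) = A ^ k * c + B ^ l * e"
proof (induction "k + l" arbitrary: k l)
  case 0
  then show ?case by (intro exI[of _ 0] exI[of _ 1]) simp
next
  case (Suc n)
  consider "k = 0" | "l = 0" | k' l' where "k = Suc k'" "l = Suc l'"
    by (meson not0_implies_Suc)
  then show ?case
  proof cases
    case 1
    then show ?thesis by (intro exI[of _ "(A + B) ^ (k + l)"] exI[of _ 0]) simp
  next
    case 2
    then show ?thesis by (intro exI[of _ 0] exI[of _ "(A + B) ^ (k + l)"]) simp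
  next
    case 3
    obtain c e where 1: "(A + B) ^ (k' + l) = A ^ k' * c + B ^ l * e"
      using Suc.hyps(1)[of k' l] Suc.hyps(2) 3 by auto
    obtain c' e' where 2: "(A + B) ^ (k + l') = A ^ k * c' + B ^ l' * e'"
      using Suc.hyps(1)[of k l'] Suc.hyps(2) 3 by auto
    have "(A + B) ^ (k + l) = A * (A + B) ^ (k' + l) + B * (A + B) ^ (k + l')"
      by (simp add: 3 algebra_simps)
    also have "\<dots> = A ^ k * (c + B * c') + B ^ l * (A * e + e')"
      unfolding 1 2 by (simp add: 3 algebra_simps)
    finally show ?thesis by blast
  qed
qed

lemma diff_dvd_power_diff:
  fixes A B :: "'a::comm_ring_1"
  shows "A - B dvd A ^ n - B ^ n"
proof (induction n)
  case (Suc n)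
  have "A ^ Suc n - B ^ Suc n = A * (A ^ n - B ^ n) + (A - B) * B ^ n" by (simp add: algebra_simps)
  then show ?case using Suc by (metis dvd_add dvd_mult dvd_triv_left)
qed simp

text \<open>Modulo \<open>hyp\<close> one has
  \<open>(A * u) ^ (2 * k) = (B * v + C * w) ^ (2 * k)\<close>, and each term of the expansion
  contains \<open>v^k\<close> or \<open>w^k\<close>; this is where the exponent \<open>2 * k\<close>
  comes from. The letters are generic so that X, Y and Z are covered at once.\<close>

lemma null_frac_power_aux:
  assumes h: "hyp = A * u + (B * v + C * w)" and uvw: "UVW = u * v * w"
    and J: "\<And>K f. v ^ K * f \<in> cech_ideal K" "\<And>K f. w ^ K * f \<in> cech_ideal K"
  shows "null_frac (A ^ (2 * k) * s) k"
proof -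
  let ?m = "2 * k" and ?r = "- (B * v + C * w)"
  have "hyp dvd (A * u) ^ ?m - ?r ^ ?m"
  proof -
    have "hyp = A * u - ?r" by (simp add: h)
    then show ?thesis using diff_dvd_power_diff[of "A * u" ?r ?m] by simp
  qed
  then obtain q where q: "(A * u) ^ ?m = ?r ^ ?m + hyp * q" by (auto elim!: dvdE simp: algebra_simps)
  obtain c e where ce: "(B * v + C * w) ^ (k + k) = (B * v) ^ k * c + (C * w) ^ k * e"
    using power_add_split by blast
  have "?r ^ ?m = (B * v + C * w) ^ (k + k)"
    using uminus_power_if[of "B * v + C * w" ?m] by (simp only: mult_2 even_add if_True simp_thms)
  then have r: "?r ^ ?m = v ^ k * (B ^ k * c) + w ^ k * (C ^ k * e)"
    unfolding ce power_mult_distrib by (simp add: mult_ac)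
  \<comment> \<open>Clearing denominators with \<open>UVW ^ ?m\<close> contributes the factors
    \<open>v ^ ?m * w ^ ?m\<close>, which raise \<open>v^k\<close> and \<open>w^k\<close> to the
    required exponent \<open>k + ?m\<close>.\<close>
  have "UVW ^ ?m * (A ^ ?m * s) = (A * u) ^ ?m * (v ^ ?m * w ^ ?m * s)"
    unfolding uvw power_mult_distrib by (simp add: mult_ac)
  also have "\<dots> = v ^ (k + ?m) * (B ^ k * c * w ^ ?m * s) + w ^ (k + ?m) * (C ^ k * e * v ^ ?m * s)
      + hyp * (q * v ^ ?m * w ^ ?m * s)"
    unfolding q r by (simp only: power_add distrib_left distrib_right mult_ac)
  also have "\<dots> \<in> cech_ideal (k + ?m)"
    by (rule cech_ideal_add cech_ideal_gens J)+
  finally show ?thesis unfolding null_frac_def by blast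
qed

lemma null_frac_XYZ_power:
  "null_frac (Var iX ^ (2 * k) * s) k" "null_frac (Var iY ^ (2 * k) * s) k" "null_frac (Var iZ ^ (2 * k) * s) k"
  by (rule null_frac_power_aux[of _ "Var iU" "Var iY" "Var iV" "Var iZ" "Var iW"]
      null_frac_power_aux[of _ "Var iV" "Var iX" "Var iU" "Var iZ" "Var iW"]
      null_frac_power_aux[of _ "Var iW" "Var iX" "Var iU" "Var iY" "Var iV"];
      (simp add: hyp_def UVW_def mult_ac add_ac; fail | rule cech_ideal_gens))+

section \<open>Coefficients of fractions as solutions of contraction systems\<close>

definition expo :: "nat \<Rightarrow> nat \<Rightarrow> nat \<Rightarrow> nat \<Rightarrow> nat \<Rightarrow> nat \<Rightarrow> indet \<Rightarrow>\<^sub>0 nat" where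
  "expo x y z u v w = sng iX x + sng iY y + sng iZ z + sng iU u + sng iV v + sng iW w"

lemma lookup_expo [simp]:
  "lkp (expo x y z u v w) iX = x" "lkp (expo x y z u v w) iY = y" "lkp (expo x y z u v w) iZ = z"
  "lkp (expo x y z u v w) iU = u" "lkp (expo x y z u v w) iV = v" "lkp (expo x y z u v w) iW = w"
  by (simp_all add: expo_def lookup_add lookup_single)

lemma indet_fun_eqI:
  assumes "lkp m iX = lkp m' iX" "lkp m iY = lkp m' iY" "lkp m iZ = lkp m' iZ"
    "lkp m iU = lkp m' iU" "lkp m iV = lkp m' iV" "lkp m iW = lkp m' iW"
  shows "m = m'"
proof (rule poly_mapping_eqI)
  fix v show "lkp m v = lkp m' v" by (cases v) (use assms in auto)
qed

lemma expo_lookup: "expo (lkp m iX) (lkp m iY) (lkp m iZ) (lkp m iU) (lkp m iV) (lkp m iW) = m"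
  by (rule indet_fun_eqI) simp_all

lemma expo_eq_iff: "expo x y z u v w = expo x' y' z' u' v' w' \<longleftrightarrow>
  x = x' \<and> y = y' \<and> z = z' \<and> u = u' \<and> v = v' \<and> w = w'"
  by (metis lookup_expo)

lemma lookup_Var_Var_mult:
  assumes "a \<noteq> b"
  shows "lkp (Var a * Var b * f) m = (if 1 \<le> lkp m a \<and> 1 \<le> lkp m b then lkp f (m - sng a 1 - sng b 1) else 0)"
  unfolding mult.assoc lookup_Var_mult using assms by (simp add: lookup_minus lookup_single)

lemma lookup_hyp_mult:
  "lkp (hyp * g) (expo x y z u v w) =
    (if 1 \<le> x \<and> 1 \<le> u then lkp g (expo (x - 1) y z (u - 1) v w) else 0) +
    (if 1 \<le> y \<and> 1 \<le> v then lkp g (expo x (y - 1) z u (v - 1) w) else 0) +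
    (if 1 \<le> z \<and> 1 \<le> w then lkp g (expo x y (z - 1) u v (w - 1)) else 0)"
proof -
  have "expo x y z u v w - sng iX 1 - sng iU 1 = expo (x - 1) y z (u - 1) v w"
    "expo x y z u v w - sng iY 1 - sng iV 1 = expo x (y - 1) z u (v - 1) w"
    "expo x y z u v w - sng iZ 1 - sng iW 1 = expo x y (z - 1) u v (w - 1)"
    by (rule indet_fun_eqI; simp add: lookup_minus lookup_single)+
  then show ?thesis
    by (simp add: hyp_def distrib_right lookup_add lookup_Var_Var_mult)
qed

lemma lookup_of_int_mult: "lkp (of_int c * f :: zpoly) m = c * lkp f m"
proof -
  have nat: "lkp (of_nat n * f) m = int n * lkp f m" for n and f :: zpoly
    by (induction n) (simp_all add: distrib_right lookup_add)
  show ?thesis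
    by (cases c rule: int_cases2) (simp_all add: nat)
qed

text \<open>The fraction \<open>f / (UVW)\<^sup>K\<close> has the coefficient \<open>fcoeff K g1 g2 g3 f a b c\<close> at
  \<open>X\<^bsup>g1-a\<^esup>Y\<^bsup>g2-b\<^esup>Z\<^bsup>g3-c\<^esup>U\<^bsup>-1-a\<^esup>V\<^bsup>-1-b\<^esup>W\<^bsup>-1-c\<^esup>\<close>; multiplication by \<open>XU + YV + ZW\<close>
  preserves \<open>(g1, g2, g3)\<close>.\<close>

definition fcoeff :: "nat \<Rightarrow> nat \<Rightarrow> nat \<Rightarrow> nat \<Rightarrow> zpoly \<Rightarrow> nat \<Rightarrow> nat \<Rightarrow> nat \<Rightarrow> int" where
  "fcoeff K g1 g2 g3 f a b c = (if a \<le> g1 \<and> b \<le> g2 \<and> c \<le> g3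
     then lkp f (expo (g1 - a) (g2 - b) (g3 - c) (K - 1 - a) (K - 1 - b) (K - 1 - c)) else 0)"

text \<open>Each summand of \<open>hyp\<close> lowers one pair of exponents, which raises one of the
  indices \<open>a, b, c\<close> by one. The guards exclude an exponent \<open>K - 1 - a\<close>
  that is already 0, a boundary that natural subtraction would hide.\<close>

lemma fcoeff_hyp_mult:
  "fcoeff K g1 g2 g3 (hyp * g) a b c =
    (if a < K - 1 then fcoeff K g1 g2 g3 g (Suc a) b c else 0) +
    (if b < K - 1 then fcoeff K g1 g2 g3 g a (Suc b) c else 0) +
    (if c < K - 1 then fcoeff K g1 g2 g3 g a b (Suc c) else 0)"
proof (cases "a \<le> g1 \<and> b \<le> g2 \<and> c \<le> g3")
  case True
  then have le: "a \<le> g1" "b \<le> g2" "c \<le> g3" by auto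
  let ?e = "\<lambda>a b c. expo (g1 - a) (g2 - b) (g3 - c) (K - 1 - a) (K - 1 - b) (K - 1 - c)"
  have 1: "(if i < K - 1 then if Suc i \<le> n then x else 0 else 0) = (if 1 \<le> n - i \<and> 1 \<le> K - 1 - i then x else (0::int))" for i n x
    by (auto simp: Suc_le_eq)
  have 2: "n - i - 1 = n - Suc i" for n i :: nat by simp
  show ?thesis
    unfolding fcoeff_def lookup_hyp_mult by (simp only: le simp_thms if_True 1 2)
next
  case False
  then show ?thesis by (simp only: fcoeff_def) (auto simp only: if_False if_cancel add_0 Suc_le_eq split: if_splits)
qed

lemma fcoeff_cech_ideal:
  assumes "f = Var iU ^ K * a' + Var iV ^ K * b' + Var iW ^ K * c' + hyp * q" "0 < K"
  shows "fcoeff K g1 g2 g3 f a b c = fcoeff K g1 g2 g3 (hyp * q) a b c"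
proof -
  have "\<not> K \<le> K - 1 - i" for i using assms(2) by simp
  then show ?thesis by (simp add: fcoeff_def assms(1) lookup_add lookup_Var_power_mult)
qed

text \<open>All exponents of U, V, W in play are below \<open>K\<close>, so only the multiple
  \<open>hyp * q\<close> contributes, and the coefficients of \<open>q\<close> form the solution.
  \<open>N < K\<close> makes the guards in \<open>fcoeff_hyp_mult\<close> true.\<close>

lemma contraction_eq_of_cech_ideal:
  assumes "f \<in> cech_ideal K" "N < K"
  shows "\<exists>\<psi>. contraction_eq N g1 g2 g3 (\<lambda>a b. fcoeff K g1 g2 g3 f a b (N - 1 - a - b)) \<psi>"
proof -
  obtain a' b' c' q where f: "f = Var iU ^ K * a' + Var iV ^ K * b' + Var iW ^ K * c' + hyp * q"
    by (rule cech_idealE[OF assms(1)])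
  let ?\<psi> = "\<lambda>a b. if a + b \<le> N then fcoeff K g1 g2 g3 q a b (N - a - b) else 0"
  have "contraction_eq N g1 g2 g3 (\<lambda>a b. fcoeff K g1 g2 g3 f a b (N - 1 - a - b)) ?\<psi>"
    unfolding contraction_eq_def
  proof (intro conjI allI impI)
    fix a b assume "g1 < a \<or> g2 < b \<or> N < a + b \<or> g3 < N - a - b"
    then show "?\<psi> a b = 0" by (auto simp: fcoeff_def)
  next
    fix a b assume *: "a + b < N"
    then have "Suc (N - 1 - a - b) = N - a - b" "N - 1 - a - b = N - Suc a - b" "N - 1 - a - b = N - a - Suc b"
      by auto
    moreover have "a < K - 1" "b < K - 1" "N - 1 - a - b < K - 1" using * assms(2) by auto
    ultimately show "fcoeff K g1 g2 g3 f a b (N - 1 - a - b) = ?\<psi> (Suc a) b + ?\<psi> a (Suc b) + ?\<psi> a b"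
      using * fcoeff_cech_ideal[OF f, of g1 g2 g3 a b "N - 1 - a - b"] assms(2)
      by (simp add: fcoeff_hyp_mult)
  qed
  then show ?thesis by blast
qed

text \<open>The solutions for all weights become the coefficients of one polynomial
  \<open>g\<close>, and \<open>f - hyp * g\<close> has only monomials divisible by
  \<open>U^K\<close>, \<open>V^K\<close> or \<open>W^K\<close>. The exponents
  \<open>K - 1 - a\<close> etc. add up to \<open>3 * K - 3 - (a + b + c)\<close>, so the degree of
  \<open>f\<close> selects \<open>a + b + c = N - 1\<close>.\<close>

lemma cech_ideal_of_contraction_eq:
  assumes f: "f \<in> zpoly_part (3 * int K - 2 - int N)" and N: "0 < N" "N < K"
    and ex: "\<And>g1 g2 g3. \<exists>\<psi>. contraction_eq N g1 g2 g3 (\<lambda>a b. fcoeff K g1 g2 g3 f a b (N - 1 - a - b)) \<psi>"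
  shows "f \<in> cech_ideal K"
proof -
  define \<phi> where "\<phi> = (\<lambda>(g1, g2, g3) a b. fcoeff K g1 g2 g3 f a b (N - 1 - a - b))"
  \<comment> \<open>Only finitely many weights have a nonzero right-hand side. For all others the
    solution 0 is taken, so that \<open>G\<close> below has finite support.\<close>
  define \<Gamma> where "\<Gamma> = {g. \<exists>a b. a + b < N \<and> \<phi> g a b \<noteq> 0}"
  define wt where "wt m = (lkp m iX + (K - 1 - lkp m iU), lkp m iY + (K - 1 - lkp m iV), lkp m iZ + (K - 1 - lkp m iW))" for m
  have "\<Gamma> \<subseteq> wt ` kys f"
  proof
    fix g assume "g \<in> \<Gamma>"
    then obtain a b where ab: "a + b < N" "\<phi> g a b \<noteq> 0" by (auto simp: \<Gamma>_def)
    obtain g1 g2 g3 where g: "g = (g1, g2, g3)" by (cases g)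
    let ?c = "N - 1 - a - b"
    let ?m = "expo (g1 - a) (g2 - b) (g3 - ?c) (K - 1 - a) (K - 1 - b) (K - 1 - ?c)"
    have "?m \<in> kys f" "a \<le> g1" "b \<le> g2" "?c \<le> g3"
      using ab by (auto simp: \<phi>_def g fcoeff_def in_keys_iff split: if_splits)
    moreover have "wt ?m = g" using calculation ab N by (simp add: wt_def g)
    ultimately show "g \<in> wt ` kys f" by (metis imageI)
  qed
  then have fin: "finite \<Gamma>" by (rule finite_subset) simp
  have "\<exists>\<psi>. (\<forall>a b. g \<notin> \<Gamma> \<longrightarrow> \<psi> a b = 0) \<and> (case g of (g1, g2, g3) \<Rightarrow> contraction_eq N g1 g2 g3 (\<phi> g) \<psi>)" for g
  proof (cases "g \<in> \<Gamma>")
    case True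
    then show ?thesis using ex by (auto simp: \<phi>_def split: prod.splits)
  next
    case False
    then show ?thesis by (intro exI[of _ "\<lambda>_ _. 0"]) (auto simp: \<Gamma>_def contraction_eq_def split: prod.splits)
  qed
  then obtain \<psi> where \<psi>: "\<And>g a b. g \<notin> \<Gamma> \<Longrightarrow> \<psi> g a b = 0"
    "\<And>g1 g2 g3. contraction_eq N g1 g2 g3 (\<phi> (g1, g2, g3)) (\<psi> (g1, g2, g3))"
    unfolding split_def by (metis fst_conv snd_conv)
  define G where "G m = (if lkp m iU < K \<and> lkp m iV < K \<and> lkp m iW < K \<and>
      (K - 1 - lkp m iU) + (K - 1 - lkp m iV) + (K - 1 - lkp m iW) = N
    then \<psi> (wt m) (K - 1 - lkp m iU) (K - 1 - lkp m iV) else 0)" for m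
  have "{m. G m \<noteq> 0} \<subseteq> (\<lambda>((g1, g2, g3), u, v, w). expo (g1 - (K - 1 - u)) (g2 - (K - 1 - v)) (g3 - (K - 1 - w)) u v w)
      ` (\<Gamma> \<times> {..<K} \<times> {..<K} \<times> {..<K})"
  proof
    fix m assume "m \<in> {m. G m \<noteq> 0}"
    then have "\<psi> (wt m) (K - 1 - lkp m iU) (K - 1 - lkp m iV) \<noteq> 0" "lkp m iU < K" "lkp m iV < K" "lkp m iW < K"
      by (auto simp only: G_def mem_Collect_eq split: if_splits)
    moreover from this(1) have "wt m \<in> \<Gamma>" using \<psi>(1) by blast
    ultimately have "wt m \<in> \<Gamma>" "lkp m iU < K" "lkp m iV < K" "lkp m iW < K" by blast+
    then show "m \<in> (\<lambda>((g1, g2, g3), u, v, w). expo (g1 - (K - 1 - u)) (g2 - (K - 1 - v)) (g3 - (K - 1 - w)) u v w)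
      ` (\<Gamma> \<times> {..<K} \<times> {..<K} \<times> {..<K})"
      by (intro image_eqI[of _ _ "(wt m, lkp m iU, lkp m iV, lkp m iW)"]) (simp_all add: wt_def expo_lookup)
  qed
  then have "finite {m. G m \<noteq> 0}" by (rule finite_subset) (use fin in auto)
  then have lG: "lkp (Abs_poly_mapping G) = G" by simp
  define g where "g = Abs_poly_mapping G"
  have cg: "fcoeff K g1 g2 g3 g a b c = (if a + b + c = N then \<psi> (g1, g2, g3) a b else 0)"
    if "a < K" "b < K" "c < K" for g1 g2 g3 a b c
  proof (cases "a \<le> g1 \<and> b \<le> g2 \<and> c \<le> g3")
    case True
    have "K - 1 - (K - 1 - i) = i" if "i < K" for i using that by simp
    then show ?thesis using True that
      by (simp add: fcoeff_def g_def lG G_def wt_def)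
  next
    case False
    have "\<psi> (g1, g2, g3) a b = 0" if "a + b + c = N"
      using \<psi>(2)[of g1 g2 g3] False that unfolding contraction_eq_def by auto
    then show ?thesis using False by (auto simp: fcoeff_def)
  qed
  have "\<forall>m\<in>kys (f - hyp * g). K \<le> lkp m iU \<or> K \<le> lkp m iV \<or> K \<le> lkp m iW"
  proof (rule ballI, rule ccontr)
    fix m assume m: "m \<in> kys (f - hyp * g)" and "\<not> (K \<le> lkp m iU \<or> K \<le> lkp m iV \<or> K \<le> lkp m iW)"
    then have lt: "lkp m iU < K" "lkp m iV < K" "lkp m iW < K" by auto
    define a b c where "a = K - 1 - lkp m iU" and "b = K - 1 - lkp m iV" and "c = K - 1 - lkp m iW"
    define g1 g2 g3 where "g1 = lkp m iX + a" and "g2 = lkp m iY + b" and "g3 = lkp m iZ + c"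
    note defs = a_def b_def c_def g1_def g2_def g3_def
    have meq: "expo (g1 - a) (g2 - b) (g3 - c) (K - 1 - a) (K - 1 - b) (K - 1 - c) = m"
      using lt by (intro indet_fun_eqI) (simp_all add: defs)
    have fc: "lkp f' m = fcoeff K g1 g2 g3 f' a b c" for f'
      unfolding fcoeff_def meq by (simp add: defs)
    have "lkp f m = lkp (hyp * g) m"
    proof (cases "Suc (a + b + c) = N")
      case True
      then have *: "a + b < N" "N - 1 - a - b = c" by auto
      then have "lkp f m = \<phi> (g1, g2, g3) a b" by (simp add: fc \<phi>_def)
      also have "\<dots> = \<psi> (g1, g2, g3) (Suc a) b + \<psi> (g1, g2, g3) a (Suc b) + \<psi> (g1, g2, g3) a b"
        using \<psi>(2)[of g1 g2 g3] * unfolding contraction_eq_def by blast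
      also have "\<dots> = lkp (hyp * g) m"
      proof -
        have lt: "a < K - 1" "b < K - 1" "c < K - 1" using True N by auto
        then have "a < K" "b < K" "c < K" "Suc a < K" "Suc b < K" "Suc c < K" by auto
        then show ?thesis using True lt by (simp add: fc fcoeff_hyp_mult cg)
      qed
      finally show ?thesis .
    next
      case False
      have "int (wdeg m) \<noteq> 3 * int K - 2 - int N"
        using False lt by (auto simp: wdeg_def a_def b_def c_def)
      then have "lkp f m = 0" using f by (auto simp: zpoly_part_iff in_keys_iff)
      moreover have "lkp (hyp * g) m = 0"
        using False lt by (simp add: fc fcoeff_hyp_mult cg a_def b_def c_def)
      ultimately show ?thesis by simp
    qed
    then show False using m by (simp add: in_keys_iff lookup_minus)
  qed
  then obtain a b c where "f - hyp * g = Var iU ^ K * a + Var iV ^ K * b + Var iW ^ K * c"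
    using monomial_ideal_iff by blast
  then show ?thesis by (intro cech_idealI[of _ _ a b c g]) (simp add: algebra_simps)
qed

lemma zpoly_part_UVW [simp]: "UVW \<in> zpoly_part 3"
  unfolding UVW_def by (intro zpoly_part_mult'[where n=2 and k=1] zpoly_part_mult'[where n=1 and k=1]) simp_all

lemma zpoly_part_UVW_power [simp]: "UVW ^ j \<in> zpoly_part (3 * int j)"
  using zpoly_part_power[OF zpoly_part_UVW, of j] by (simp add: mult.commute)

text \<open>Over a common denominator \<open>(UVW)^K\<close> with \<open>K > N\<close>, the
  translation between fractions and contraction systems works in both directions, and the absence of
  \<open>p\<close>-torsion is inherited.\<close>

lemma null_frac_torsion_free:
  assumes s: "s \<in> zpoly_part (3 * int k - 2 - int N)" "0 < N"
    and p: "Factorial_Ring.prime (p :: int)" "\<And>i. i \<le> N \<Longrightarrow> \<not> p dvd int (N choose i)"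
    and z: "null_frac (of_int p * s) k"
  shows "null_frac s k"
proof -
  obtain j where j: "j \<ge> Suc N" "UVW ^ j * (of_int p * s) \<in> cech_ideal (k + j)"
    using z by (rule null_fracE)
  let ?K = "k + j" and ?f = "UVW ^ j * s"
  have "UVW ^ j * (of_int p * s) = of_int p * ?f" by (rule mult.left_commute)
  then have pf: "of_int p * ?f \<in> cech_ideal ?K" using j(2) by metis
  have K: "N < ?K" using j by simp
  have "?f \<in> cech_ideal ?K"
  proof (rule cech_ideal_of_contraction_eq[OF _ \<open>0 < N\<close> K])
    show "?f \<in> zpoly_part (3 * int ?K - 2 - int N)"
      by (rule zpoly_part_mult'[OF zpoly_part_UVW_power s(1)]) simp
    fix g1 g2 g3
    have "fcoeff ?K g1 g2 g3 (of_int p * ?f) a b c = p * fcoeff ?K g1 g2 g3 ?f a b c" for a b c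
      by (simp add: fcoeff_def lookup_of_int_mult)
    then obtain \<psi> where "contraction_eq N g1 g2 g3 (\<lambda>a b. p * fcoeff ?K g1 g2 g3 ?f a b (N - 1 - a - b)) \<psi>"
      using contraction_eq_of_cech_ideal[OF pf K, of g1 g2 g3] by auto
    then show "\<exists>\<psi>. contraction_eq N g1 g2 g3 (\<lambda>a b. fcoeff ?K g1 g2 g3 ?f a b (N - 1 - a - b)) \<psi>"
      by (intro contraction_eq_torsion_free[OF p(1), where \<psi>=\<psi>] p(2))
  qed
  then show ?thesis unfolding null_frac_def by blast
qed

section \<open>Explicit fractions with known integer annihilators\<close>

lemma UVW_power_mult_eq_sng:
  "UVW ^ j * (Var iX ^ a * Var iY ^ b * Var iU ^ l * Var iV ^ l) = sng (expo a b 0 (j + l) (j + l) j) 1"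
  unfolding UVW_def power_mult_distrib Var_power mult_single
  by (intro arg_cong2[where f=sng] indet_fun_eqI) (simp_all add: lookup_add lookup_single)

text \<open>The fraction is \<open>X^i Y^(N-i) / (U V W^N)\<close> times \<open>c\<close>. Its only
  coefficient has weight \<open>(i, N - i, N - 1)\<close> and sits at \<open>a = b = 0\<close>,
  which is the system with the binomial obstruction.\<close>

lemma choose_dvd_of_null_frac:
  assumes "null_frac (of_int c * (Var iX ^ i * Var iY ^ (N - i) * Var iU ^ (N - 1) * Var iV ^ (N - 1))) N"
    and N: "0 < N" "i \<le> N"
  shows "int (N choose i) dvd c"
proof -
  let ?s = "Var iX ^ i * Var iY ^ (N - i) * Var iU ^ (N - 1) * Var iV ^ (N - 1)"
  obtain j where j: "j \<ge> 1" "UVW ^ j * (of_int c * ?s) \<in> cech_ideal (N + j)"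
    using assms(1) by (rule null_fracE)
  let ?K = "N + j"
  define F where "F = UVW ^ j * (of_int c * ?s)"
  obtain \<psi> where \<psi>: "contraction_eq N i (N - i) (N - 1) (\<lambda>a b. fcoeff ?K i (N - i) (N - 1) F a b (N - 1 - a - b)) \<psi>"
    using contraction_eq_of_cech_ideal[OF j(2)[folded F_def], of N i "N - i" "N - 1"] j(1) by auto
  have f: "lkp F m = (if m = expo i (N - i) 0 (?K - 1) (?K - 1) j then c else 0)" for m
  proof -
    have "F = of_int c * (UVW ^ j * ?s)" unfolding F_def by (simp only: mult.left_commute)
    also have "UVW ^ j * ?s = sng (expo i (N - i) 0 (?K - 1) (?K - 1) j) 1"
      unfolding UVW_power_mult_eq_sng using N by (simp add: add.commute)
    finally have "lkp F m = c * lkp (sng (expo i (N - i) 0 (?K - 1) (?K - 1) j) 1) m"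
      by (simp only: lookup_of_int_mult)
    then show ?thesis by (simp only: lookup_single when_def) auto
  qed
  have "fcoeff ?K i (N - i) (N - 1) F a b (N - 1 - a - b) = (if a = 0 \<and> b = 0 then c else 0)"
    if "a + b < N" for a b
  proof (cases "a \<le> i \<and> b \<le> N - i")
    case True
    then show ?thesis using that j(1) by (auto simp: fcoeff_def f expo_eq_iff)
  next
    case False
    then show ?thesis by (auto simp: fcoeff_def)
  qed
  then have "contraction_eq N i (N - i) (N - 1) (\<lambda>a b. if a = 0 \<and> b = 0 then c else 0) \<psi>"
    using \<psi> unfolding contraction_eq_def by simp
  then show ?thesis by (rule choose_dvd_of_contraction_eq) (use N in auto)
qed

text \<open>Modulo \<open>hyp\<close>, \<open>(XU + YV)^N\<close> equals \<open>(- ZW)^N\<close>.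
  After multiplication by the monomial \<open>M\<close>, the \<open>i\<close>-th binomial term is
  the given numerator times \<open>UVW ^ N\<close>; every other term is divisible by
  \<open>U^(2N)\<close> or \<open>V^(2N)\<close>, and \<open>(- ZW)^N\<close> contributes
  \<open>W^(2N)\<close>.\<close>

lemma null_frac_choose:
  assumes N: "0 < N" "i \<le> N"
  shows "null_frac (of_nat (N choose i) * (Var iX ^ i * Var iY ^ (N - i) * Var iU ^ (N - 1) * Var iV ^ (N - 1))) N"
proof -
  let ?A = "Var iX * Var iU" and ?B = "Var iY * Var iV"
  \<comment> \<open>With these exponents the \<open>l\<close>-th term reaches \<open>U^(2N)\<close>
    exactly when \<open>l > i\<close> and \<open>V^(2N)\<close> exactly when
    \<open>l < i\<close>.\<close>
  define M where "M = Var iU ^ (2 * N - 1 - i) * Var iV ^ (N - 1 + i) * Var iW ^ N"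
  define t where "t l = of_nat (N choose l) * ?A ^ l * ?B ^ (N - l) * M" for l
  let ?s = "Var iX ^ i * Var iY ^ (N - i) * Var iU ^ (N - 1) * Var iV ^ (N - 1)"
  have ex: "(N - 1) + N = i + (2 * N - 1 - i)" "(N - 1) + N = (N - i) + (N - 1 + i)" using N by auto
  have "UVW ^ N * (of_nat (N choose i) * ?s) = of_nat (N choose i) * Var iX ^ i * Var iY ^ (N - i)
      * Var iU ^ ((N - 1) + N) * Var iV ^ ((N - 1) + N) * Var iW ^ N"
    unfolding UVW_def power_mult_distrib power_add by (simp add: mult_ac)
  also have "\<dots> = t i"
    unfolding t_def M_def power_mult_distrib
    by (subst ex(1), subst ex(2)) (simp only: power_add mult_ac)
  finally have 1: "UVW ^ N * (of_nat (N choose i) * ?s) = t i" .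
  have "(?A + ?B) ^ N * M = (\<Sum>l\<le>N. t l)"
    unfolding binomial_ring t_def by (simp add: sum_distrib_right)
  also have "\<dots> = t i + (\<Sum>l\<in>{..N} - {i}. t l)"
    using N by (intro sum.remove) auto
  finally have 2: "t i = (?A + ?B) ^ N * M + (- 1) * (\<Sum>l\<in>{..N} - {i}. t l)" by simp
  have "?A + ?B - (- (Var iZ * Var iW)) dvd (?A + ?B) ^ N - (- (Var iZ * Var iW)) ^ N"
    by (rule diff_dvd_power_diff)
  then obtain q where q: "(?A + ?B) ^ N = (- (Var iZ * Var iW)) ^ N + hyp * q"
    by (auto elim!: dvdE simp: hyp_def algebra_simps)
  have "(- (Var iZ * Var iW)) ^ N * M = Var iW ^ (N + N) * ((- Var iZ) ^ N * Var iU ^ (2 * N - 1 - i) * Var iV ^ (N - 1 + i))"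
    unfolding M_def minus_mult_left power_mult_distrib power_add by (simp only: mult_ac)
  then have AB: "(?A + ?B) ^ N * M \<in> cech_ideal (N + N)"
    unfolding q distrib_right mult.assoc[of hyp] by (metis cech_ideal_add cech_ideal_gens(3,4))
  have tl: "t l \<in> cech_ideal (N + N)" if "l \<in> {..N} - {i}" for l
  proof -
    have "l \<le> N" "l \<noteq> i" using that by auto
    then consider "i < l" | "l < i" "l \<le> N" by linarith
    then show ?thesis
    proof cases
      case 1
      then have "Var iU ^ (N + N) dvd Var iU ^ (l + (2 * N - 1 - i))" using N by (intro le_imp_power_dvd) auto
      moreover have "t l = Var iU ^ (l + (2 * N - 1 - i)) *
          (of_nat (N choose l) * Var iX ^ l * ?B ^ (N - l) * Var iV ^ (N - 1 + i) * Var iW ^ N)"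
        unfolding t_def M_def power_mult_distrib power_add by (simp only: mult_ac)
      ultimately show ?thesis by (intro cech_ideal_dvd) simp
    next
      case 2
      then have "Var iV ^ (N + N) dvd Var iV ^ ((N - l) + (N - 1 + i))" using N by (intro le_imp_power_dvd) auto
      moreover have "t l = Var iV ^ ((N - l) + (N - 1 + i)) *
          (of_nat (N choose l) * ?A ^ l * Var iY ^ (N - l) * Var iU ^ (2 * N - 1 - i) * Var iW ^ N)"
        unfolding t_def M_def power_mult_distrib power_add by (simp only: mult_ac)
      ultimately show ?thesis by (intro cech_ideal_dvd) simp
    qed
  qed
  have "(\<Sum>l\<in>L. t l) \<in> cech_ideal (N + N)" if "finite L" "L \<subseteq> {..N} - {i}" for L
    using that by (induction L rule: finite_induct) (auto intro: cech_ideal_add cech_ideal_dvd tl)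
  from this[of "{..N} - {i}"] have "(\<Sum>l\<in>{..N} - {i}. t l) \<in> cech_ideal (N + N)" by simp
  then have "t i \<in> cech_ideal (N + N)"
    unfolding 2 by (rule cech_ideal_add[OF AB cech_ideal_mult])
  then show ?thesis unfolding null_frac_def 1[symmetric] by blast
qed

text \<open>The numerator is a monomial free of X, Y, Z, so multiples of \<open>hyp\<close> cannot
  reach it, and its exponents in U, V, W stay below \<open>N + j\<close>. This fraction of infinite
  order is the source of the prime \<open>(X,Y,Z)\<close>.\<close>

lemma not_torsion_of_null_frac:
  assumes "null_frac (of_int c * (Var iU ^ (N - 1) * Var iV ^ (N - 1))) N" and N: "0 < N"
  shows "c = 0"
proof -
  let ?s = "Var iU ^ (N - 1) * Var iV ^ (N - 1)"
  obtain j where "UVW ^ j * (of_int c * ?s) \<in> cech_ideal (N + j)"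
    using assms(1) unfolding null_frac_def by blast
  then obtain a' b' c' q where q:
    "UVW ^ j * (of_int c * ?s) = Var iU ^ (N + j) * a' + Var iV ^ (N + j) * b' + Var iW ^ (N + j) * c' + hyp * q"
    by (rule cech_idealE)
  let ?m = "expo 0 0 0 (j + (N - 1)) (j + (N - 1)) j"
  have "UVW ^ j * (of_int c * ?s) = of_int c * sng ?m 1"
    using UVW_power_mult_eq_sng[of j 0 0 "N - 1"]
    by (subst mult.left_commute) (simp only: power_0 mult_1_left)
  then have "lkp (UVW ^ j * (of_int c * ?s)) ?m = c"
    by (simp only: lookup_of_int_mult lookup_single_eq mult_1_right)
  moreover have "lkp (UVW ^ j * (of_int c * ?s)) ?m = 0"
    unfolding q using N by (simp add: lookup_add lookup_Var_power_mult lookup_hyp_mult)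
  ultimately show ?thesis by simp
qed

section \<open>Graded modules over the hypersurface ring\<close>

lemma cring_zpoly_ring: "cring zpoly_ring"
  unfolding zpoly_ring_def by (rule cring_from_type_algebra)

lemma zpoly_ring_simps [simp]:
  "carrier zpoly_ring = UNIV" "monoid.mult zpoly_ring = (*)" "one zpoly_ring = 1"
  "ring.zero zpoly_ring = 0" "add zpoly_ring = (+)"
  by (simp_all add: zpoly_ring_def ring_of_type_algebra_def fun_eq_iff)

lemma hyp_ideal_eq: "hyp_ideal = {f. hyp dvd f}"
  unfolding hyp_ideal_def cgenideal_def hyp_def[symmetric] by (auto simp: dvd_def mult.commute)

lemma ideal_hyp_ideal: "ideal hyp_ideal zpoly_ring"
  unfolding hyp_ideal_def by (rule cring.cgenideal_ideal[OF cring_zpoly_ring]) simp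

lemma cring_R': "cring R'"
  unfolding R'_def by (rule ideal.quotient_is_cring[OF ideal_hyp_ideal cring_zpoly_ring])

lemma cls_hom: "cls \<in> ring_hom zpoly_ring R'"
  unfolding R'_def cls_def[abs_def] by (rule ideal.rcos_ring_hom[OF ideal_hyp_ideal])

lemma cls_mem: "cls f = {h + f | h. hyp dvd h}"
  by (auto simp: cls_def a_r_coset_def' hyp_ideal_eq)

lemma cls_eq_iff: "cls f = cls g \<longleftrightarrow> hyp dvd f - g"
proof
  assume "cls f = cls g"
  moreover have "f \<in> cls f" unfolding cls_mem by (auto intro!: exI[of _ 0])
  ultimately obtain h where "f = h + g" "hyp dvd h" unfolding cls_mem by blast
  then show "hyp dvd f - g" by simp
next
  assume d: "hyp dvd f - g"
  show "cls f = cls g"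
    unfolding cls_mem
  proof (intro equalityI subsetI)
    fix x assume "x \<in> {h + f |h. hyp dvd h}"
    then obtain h where h: "x = h + f" "hyp dvd h" by blast
    have "x = (h + (f - g)) + g" "hyp dvd h + (f - g)" using h d by (simp_all add: dvd_add)
    then show "x \<in> {h + g |h. hyp dvd h}" by blast
  next
    fix x assume "x \<in> {h + g |h. hyp dvd h}"
    then obtain h where h: "x = h + g" "hyp dvd h" by blast
    have "x = (h - (f - g)) + f" "hyp dvd h - (f - g)" using h d by (simp_all add: dvd_diff)
    then show "x \<in> {h + f |h. hyp dvd h}" by blast
  qed
qed

lemma carrier_R': "carrier R' = range cls"
  by (auto simp: R'_def FactRing_def A_RCOSETS_def' cls_def a_r_coset_def')

lemma cls_closed [simp]: "cls f \<in> carrier R'"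
  by (simp add: carrier_R')

lemma cls_mult: "cls f \<otimes>\<^bsub>R'\<^esub> cls g = cls (f * g)"
  using ring_hom_mult[OF cls_hom, of f g] by simp

lemma cls_add: "cls f \<oplus>\<^bsub>R'\<^esub> cls g = cls (f + g)"
  using ring_hom_add[OF cls_hom, of f g] by simp

lemma cls_one: "\<one>\<^bsub>R'\<^esub> = cls 1"
  using ring_hom_one[OF cls_hom] by simp

lemma cls_zero: "\<zero>\<^bsub>R'\<^esub> = cls 0"
  by (simp add: R'_def FactRing_def cls_mem hyp_ideal_eq)

lemma cls_eq_zero_iff: "cls f = \<zero>\<^bsub>R'\<^esub> \<longleftrightarrow> hyp dvd f"
  by (simp add: cls_zero cls_eq_iff)

lemma cls_uminus: "\<ominus>\<^bsub>R'\<^esub> cls f = cls (- f)"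
proof -
  interpret R': cring R' by (rule cring_R')
  have "cls (- f) \<oplus>\<^bsub>R'\<^esub> cls f = \<zero>\<^bsub>R'\<^esub>" by (simp add: cls_add cls_zero)
  then show ?thesis using R'.minus_equality by simp
qed

text \<open>Homogeneous ideals of \<open>R'\<close> are encoded by their preimages among
  polynomials, hence the condition on multiples of \<open>hyp\<close>; components are then taken
  with \<open>hpart\<close>.\<close>

definition homogeneous_ideal :: "zpoly set \<Rightarrow> bool" where
  "homogeneous_ideal J \<longleftrightarrow> (\<forall>f. hyp dvd f \<longrightarrow> f \<in> J) \<and> (\<forall>f\<in>J. \<forall>g\<in>J. f + g \<in> J) \<and>
     (\<forall>r. \<forall>f\<in>J. r * f \<in> J) \<and> (\<forall>n. \<forall>f\<in>J. hpart n f \<in> J)"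

text \<open>Its elements have the element type of \<open>R'\<close>, as the lifting property in
  \<open>graded_injective\<close> demands.\<close>

definition ideal_module :: "zpoly set \<Rightarrow> (zpoly set, zpoly set) module" where
  "ideal_module J = (regular_module R')\<lparr>carrier := cls ` J\<rparr>"

text \<open>The grading of the shifted module \<open>J(-n)\<close>.\<close>

definition ideal_module_part :: "zpoly set \<Rightarrow> int \<Rightarrow> int \<Rightarrow> zpoly set set" where
  "ideal_module_part J n m = cls ` (J \<inter> zpoly_part (m - n))"

lemma ideal_module_simps:
  "carrier (ideal_module J) = cls ` J" "add (ideal_module J) = add R'"
  "ring.zero (ideal_module J) = cls 0" "module.smult (ideal_module J) = monoid.mult R'"
  by (simp_all add: ideal_module_def regular_module_def cls_zero)

lemma ideal_module_abelian_group:
  assumes J: "homogeneous_ideal J"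
  shows "abelian_group (ideal_module J)"
proof (rule abelian_groupI)
  have 0: "0 \<in> J" using J unfolding homogeneous_ideal_def by auto
  have uminus: "- f \<in> J" if "f \<in> J" for f
  proof -
    have "(-1) * f \<in> J" using J that unfolding homogeneous_ideal_def by blast
    then show ?thesis by simp
  qed
  show "x \<oplus>\<^bsub>ideal_module J\<^esub> y \<in> carrier (ideal_module J)"
    if "x \<in> carrier (ideal_module J)" "y \<in> carrier (ideal_module J)" for x y
    using that J unfolding homogeneous_ideal_def by (auto simp: ideal_module_simps cls_add)
  show "\<zero>\<^bsub>ideal_module J\<^esub> \<in> carrier (ideal_module J)"
    using 0 by (simp add: ideal_module_simps)
  show "\<exists>y\<in>carrier (ideal_module J). y \<oplus>\<^bsub>ideal_module J\<^esub> x = \<zero>\<^bsub>ideal_module J\<^esub>"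
    if x: "x \<in> carrier (ideal_module J)" for x
  proof -
    obtain f where "f \<in> J" "x = cls f" using x by (auto simp: ideal_module_simps)
    then show ?thesis using uminus[of f]
      by (intro bexI[of _ "cls (- f)"]) (auto simp: ideal_module_simps cls_add)
  qed
qed (auto simp: ideal_module_simps cls_add add_ac)

lemma ideal_module_module:
  assumes J: "homogeneous_ideal J"
  shows "module R' (ideal_module J)"
proof (rule moduleI[OF cring_R' ideal_module_abelian_group[OF J]])
  show "a \<odot>\<^bsub>ideal_module J\<^esub> x \<in> carrier (ideal_module J)"
    if "a \<in> carrier R'" "x \<in> carrier (ideal_module J)" for a x
    using that J unfolding homogeneous_ideal_def by (auto simp: carrier_R' ideal_module_simps cls_mult)
qed (auto simp: carrier_R' ideal_module_simps cls_mult cls_add cls_one algebra_simps)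

lemma ideal_module_finsum:
  assumes J: "homogeneous_ideal J" and "finite S" "\<And>i. i \<in> S \<Longrightarrow> f i \<in> J"
  shows "finsum (ideal_module J) (\<lambda>i. cls (f i)) S = cls (sum f S)"
  using assms(2,3)
proof (induction S rule: finite_induct)
  case empty
  interpret abelian_group "ideal_module J" by (rule ideal_module_abelian_group[OF J])
  show ?case by (simp add: ideal_module_simps)
next
  case (insert i S)
  interpret abelian_group "ideal_module J" by (rule ideal_module_abelian_group[OF J])
  show ?case using insert by (subst finsum_insert) (auto simp: ideal_module_simps cls_add)
qed

text \<open>The components are those of a polynomial representative. Uniqueness survives the
  quotient because \<open>hyp\<close> is homogeneous: if two representatives differ by a multiple of
  \<open>hyp\<close>, so do their homogeneous parts.\<close>

lemma ideal_module_grading: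
  assumes J: "homogeneous_ideal J"
  shows "is_grading (ideal_module J) (ideal_module_part J n)"
  unfolding is_grading_def
proof (intro conjI allI ballI)
  let ?L = "ideal_module J"
  interpret L: abelian_group ?L by (rule ideal_module_abelian_group[OF J])
  have J0: "0 \<in> J" and Jadd: "\<And>f g. f \<in> J \<Longrightarrow> g \<in> J \<Longrightarrow> f + g \<in> J"
    and Jh: "\<And>f n. f \<in> J \<Longrightarrow> hpart n f \<in> J" and Jm: "\<And>r f. f \<in> J \<Longrightarrow> r * f \<in> J"
    using J unfolding homogeneous_ideal_def by auto
  have Jneg: "- f \<in> J" if "f \<in> J" for f using Jm[OF that, of "-1"] by simp
  have inv: "inv\<^bsub>add_monoid ?L\<^esub> cls f = cls (- f)" if "f \<in> J" for f
    using that Jneg L.minus_equality[of "cls (- f)" "cls f"]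
    by (simp add: a_inv_def ideal_module_simps cls_add)
  fix m
  show "subgroup (ideal_module_part J n m) (add_monoid ?L)"
  proof (rule subgroup.intro)
    show "ideal_module_part J n m \<subseteq> carrier (add_monoid ?L)"
      by (auto simp: ideal_module_part_def ideal_module_simps)
    show "\<one>\<^bsub>add_monoid ?L\<^esub> \<in> ideal_module_part J n m"
      using J0 by (auto simp: ideal_module_part_def ideal_module_simps)
    show "x \<otimes>\<^bsub>add_monoid ?L\<^esub> y \<in> ideal_module_part J n m"
      if "x \<in> ideal_module_part J n m" "y \<in> ideal_module_part J n m" for x y
      using that by (auto simp: ideal_module_part_def ideal_module_simps cls_add intro!: imageI Jadd zpoly_part_add)
    show "inv\<^bsub>add_monoid ?L\<^esub> x \<in> ideal_module_part J n m"
      if "x \<in> ideal_module_part J n m" for x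
      using that by (auto simp: ideal_module_part_def inv intro!: imageI Jneg zpoly_part_uminus)
  qed
next
  let ?L = "ideal_module J"
  interpret L: abelian_group ?L by (rule ideal_module_abelian_group[OF J])
  have Jh: "\<And>f n. f \<in> J \<Longrightarrow> hpart n f \<in> J"
    using J unfolding homogeneous_ideal_def by auto
  fix x assume "x \<in> carrier ?L"
  then obtain f where f: "f \<in> J" "x = cls f" by (auto simp: ideal_module_simps)
  define c where "c m = cls (hpart (m - n) f)" for m
  let ?P = "\<lambda>c. (\<forall>m. c m \<in> ideal_module_part J n m) \<and> finite {m. c m \<noteq> \<zero>\<^bsub>?L\<^esub>} \<and>
    x = (\<Oplus>\<^bsub>?L\<^esub>m\<in>{m. c m \<noteq> \<zero>\<^bsub>?L\<^esub>}. c m)"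
  define D where "D = (\<lambda>m. int (wdeg m) + n) ` kys f"
  have finD: "finite D" by (simp add: D_def)
  have supp: "{m. c m \<noteq> \<zero>\<^bsub>?L\<^esub>} \<subseteq> D"
  proof
    fix m assume "m \<in> {m. c m \<noteq> \<zero>\<^bsub>?L\<^esub>}"
    then have "hpart (m - n) f \<noteq> 0" by (auto simp: c_def ideal_module_simps)
    then obtain t where "t \<in> kys (hpart (m - n) f)" by (metis all_not_in_conv keys_eq_empty)
    then have "t \<in> kys f" "int (wdeg t) = m - n" by (auto simp: hpart_def keys_restr)
    then show "m \<in> D" unfolding D_def by (intro image_eqI[of _ _ t]) auto
  qed
  have "(\<Oplus>\<^bsub>?L\<^esub>m\<in>{m. c m \<noteq> \<zero>\<^bsub>?L\<^esub>}. c m) = (\<Oplus>\<^bsub>?L\<^esub>m\<in>D. c m)"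
    by (rule L.add.finprod_mono_neutral_cong_left[OF finD supp])
       (auto simp: c_def ideal_module_simps f Jh)
  also have "\<dots> = cls (\<Sum>m\<in>D. hpart (m - n) f)"
    unfolding c_def by (rule ideal_module_finsum[OF J finD]) (use Jh f in auto)
  also have "(\<Sum>m\<in>D. hpart (m - n) f) = (\<Sum>m\<in>(\<lambda>m. m - n) ` D. hpart m f)"
    by (simp add: sum.reindex inj_on_def)
  also have "\<dots> = f"
    by (rule sum_hpart) (auto simp: D_def image_image finD)
  finally have "?P c"
    using Jh f finite_subset[OF supp finD] by (auto simp: c_def ideal_module_part_def)
  moreover have "c' = c" if c': "?P c'" for c'
  proof
    fix m
    have "\<forall>i. \<exists>g. c' i = cls g \<and> g \<in> J \<inter> zpoly_part (i - n)" using c' by (auto simp: ideal_module_part_def)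
    then obtain g where g: "\<And>i. c' i = cls (g i)" "\<And>i. g i \<in> J" "\<And>i. g i \<in> zpoly_part (i - n)"
      by (metis IntE)
    let ?S = "{m. c' m \<noteq> \<zero>\<^bsub>?L\<^esub>}"
    have "cls f = (\<Oplus>\<^bsub>?L\<^esub>m\<in>?S. c' m)" using c' f by simp
    also have "\<dots> = (\<Oplus>\<^bsub>?L\<^esub>m\<in>?S. cls (g m))" by (simp only: g(1))
    also have "\<dots> = cls (\<Sum>i\<in>?S. g i)"
      using c' g by (intro ideal_module_finsum[OF J]) auto
    finally obtain q where q: "f = (\<Sum>i\<in>?S. g i) + hyp * q"
      unfolding cls_eq_iff by (auto elim!: dvdE simp: algebra_simps)
    have "hpart (m - n) (\<Sum>i\<in>S. g i) = (\<Sum>i\<in>S. hpart (m - n) (g i))" for S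
      by (rule poly_mapping_eqI) (simp add: lookup_hpart lookup_sum when_def)
    also have "(\<Sum>i\<in>?S. hpart (m - n) (g i)) = (\<Sum>i\<in>?S. if i = m then g m else 0)"
      by (intro sum.cong) (auto simp: hpart_of_part[OF g(3)])
    also have "\<dots> = (if m \<in> ?S then g m else 0)" using c' by (simp add: sum.delta)
    finally have "hpart (m - n) f = (if m \<in> ?S then g m else 0) + hyp * hpart (m - n - 1) q"
      unfolding q hpart_add by (simp add: hpart_mult[where k=1])
    then have "c m = cls (if m \<in> ?S then g m else 0)" by (simp add: c_def cls_eq_iff)
    then show "c' m = c m" using g(1)[of m] by (auto simp: ideal_module_simps)
  qed
  ultimately show "\<exists>!c. ?P c" by blast
qed

lemma homogeneous_ideal_UNIV: "homogeneous_ideal UNIV"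
  by (simp add: homogeneous_ideal_def)

lemma graded_module_ideal_module:
  assumes gr: "graded_ring R' R'_part" and J: "homogeneous_ideal J"
  shows "graded_module R' R'_part (ideal_module J) (ideal_module_part J n)"
proof -
  interpret graded_ring R' R'_part by (rule gr)
  interpret module R' "ideal_module J" by (rule ideal_module_module[OF J])
  show ?thesis
  proof unfold_locales
    show "is_grading (ideal_module J) (ideal_module_part J n)" by (rule ideal_module_grading[OF J])
    have "a * b \<in> zpoly_part (m + k - n)" if "a \<in> zpoly_part m" "b \<in> zpoly_part (k - n)" for a b m k
      by (rule zpoly_part_mult'[OF that]) simp
    then show "a \<odot>\<^bsub>ideal_module J\<^esub> x \<in> ideal_module_part J n (m + k)"
      if "a \<in> R'_part m" "x \<in> ideal_module_part J n k" for a x m k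
      using that J unfolding homogeneous_ideal_def
      by (auto simp: R'_part_def ideal_module_part_def ideal_module_simps cls_mult intro!: imageI)
  qed
qed

section \<open>Graded modules and equality after localization\<close>

definition act :: "(zpoly set, 'b) module \<Rightarrow> zpoly \<Rightarrow> 'b \<Rightarrow> 'b" where
  "act M f m = cls f \<odot>\<^bsub>M\<^esub> m"

text \<open>\<open>a\<close> and \<open>b\<close> have the same image in the localization of \<open>M\<close> at \<open>x\<close>.\<close>

definition loc_eq :: "(zpoly set, 'b) module \<Rightarrow> zpoly \<Rightarrow> 'b \<Rightarrow> 'b \<Rightarrow> bool" where
  "loc_eq M x a b \<longleftrightarrow> (\<exists>k. act M (x ^ k) a = act M (x ^ k) b)"

abbreviation "loc_zero M x a \<equiv> loc_eq M x a \<zero>\<^bsub>M\<^esub>"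

locale R'_graded_module = graded_module R' R'_part M B
  for M :: "(zpoly set, 'b) module" and B
begin

lemma act_closed [simp]: "m \<in> carrier M \<Longrightarrow> act M f m \<in> carrier M"
  by (simp add: act_def)

lemma act_add: "m \<in> carrier M \<Longrightarrow> act M (f + g) m = act M f m \<oplus>\<^bsub>M\<^esub> act M g m"
  by (simp add: act_def smult_l_distr flip: cls_add)

lemma act_mult: "m \<in> carrier M \<Longrightarrow> act M (f * g) m = act M f (act M g m)"
  by (simp add: act_def smult_assoc1 flip: cls_mult)

lemma act_comm: "m \<in> carrier M \<Longrightarrow> act M f (act M g m) = act M g (act M f m)"
  by (simp add: mult.commute flip: act_mult)

lemma act_plus: "m \<in> carrier M \<Longrightarrow> m' \<in> carrier M \<Longrightarrow> act M f (m \<oplus>\<^bsub>M\<^esub> m') = act M f m \<oplus>\<^bsub>M\<^esub> act M f m'"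
  by (simp add: act_def smult_r_distr)

lemma act_one [simp]: "m \<in> carrier M \<Longrightarrow> act M 1 m = m"
  by (simp add: act_def flip: cls_one)

lemma act_null [simp]: "act M f \<zero>\<^bsub>M\<^esub> = \<zero>\<^bsub>M\<^esub>"
  by (simp add: act_def)

lemma act_hyp: "m \<in> carrier M \<Longrightarrow> hyp dvd f \<Longrightarrow> act M f m = \<zero>\<^bsub>M\<^esub>"
  using cls_eq_zero_iff[of f] by (simp add: act_def)

lemma act_0 [simp]: "m \<in> carrier M \<Longrightarrow> act M 0 m = \<zero>\<^bsub>M\<^esub>"
  by (simp add: act_hyp)

lemma act_neg: "m \<in> carrier M \<Longrightarrow> act M (- f) m = \<ominus>\<^bsub>M\<^esub> act M f m"
  by (simp add: act_def smult_l_minus flip: cls_uminus)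

lemma act_minus: "m \<in> carrier M \<Longrightarrow> act M f (\<ominus>\<^bsub>M\<^esub> m) = \<ominus>\<^bsub>M\<^esub> act M f m"
  by (simp add: act_def smult_r_minus)

lemma act_diff: "m \<in> carrier M \<Longrightarrow> act M (f - g) m = act M f m \<ominus>\<^bsub>M\<^esub> act M g m"
  using act_add[of m f "- g"] by (simp add: act_neg a_minus_def)

lemma act_subtract: "m \<in> carrier M \<Longrightarrow> m' \<in> carrier M \<Longrightarrow> act M f (m \<ominus>\<^bsub>M\<^esub> m') = act M f m \<ominus>\<^bsub>M\<^esub> act M f m'"
  by (simp add: a_minus_def act_plus act_minus)

lemma act_cong: "m \<in> carrier M \<Longrightarrow> hyp dvd f - g \<Longrightarrow> act M f m = act M g m"
  by (simp add: act_def flip: cls_eq_iff)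

lemma subgroup_part: "subgroup (B n) (add_monoid M)"
  using module_grading by (simp add: is_grading_def)

lemma part_carrier: "m \<in> B n \<Longrightarrow> m \<in> carrier M"
  using subgroup.subset[OF subgroup_part] by auto

lemma part_add: "m \<in> B n \<Longrightarrow> m' \<in> B n \<Longrightarrow> m \<oplus>\<^bsub>M\<^esub> m' \<in> B n"
  using subgroup.m_closed[OF subgroup_part] by auto

lemma part_zero [simp]: "\<zero>\<^bsub>M\<^esub> \<in> B n"
  using subgroup.one_closed[OF subgroup_part] by auto

lemma part_minus: "m \<in> B n \<Longrightarrow> \<ominus>\<^bsub>M\<^esub> m \<in> B n"
  using subgroup.m_inv_closed[OF subgroup_part] by (auto simp: a_inv_def)

lemma part_subtract: "m \<in> B n \<Longrightarrow> m' \<in> B n \<Longrightarrow> m \<ominus>\<^bsub>M\<^esub> m' \<in> B n"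
  unfolding a_minus_def by (intro part_add part_minus)

lemma part_act: "f \<in> zpoly_part k \<Longrightarrow> m \<in> B n \<Longrightarrow> n' = k + n \<Longrightarrow> act M f m \<in> B n'"
  unfolding act_def by (auto intro!: smult_graded simp: R'_part_def)

text \<open>The pattern in which the three pairs of Koszul terms cancel in
  \<open>glue\<close>.\<close>

lemma cancel_cyclic:
  assumes "p \<in> carrier M" "q \<in> carrier M" "r \<in> carrier M"
  shows "p \<oplus>\<^bsub>M\<^esub> q \<oplus>\<^bsub>M\<^esub> (r \<ominus>\<^bsub>M\<^esub> p) \<oplus>\<^bsub>M\<^esub> (\<ominus>\<^bsub>M\<^esub> q \<ominus>\<^bsub>M\<^esub> r) = \<zero>\<^bsub>M\<^esub>"
proof -
  have "p \<oplus>\<^bsub>M\<^esub> q \<oplus>\<^bsub>M\<^esub> (r \<ominus>\<^bsub>M\<^esub> p) = (p \<ominus>\<^bsub>M\<^esub> p) \<oplus>\<^bsub>M\<^esub> (q \<oplus>\<^bsub>M\<^esub> r)"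
    using assms by (simp add: a_minus_def M.a_ac)
  also have "\<dots> = q \<oplus>\<^bsub>M\<^esub> r" using assms by (simp add: a_minus_def M.r_neg)
  also have "\<dots> \<oplus>\<^bsub>M\<^esub> (\<ominus>\<^bsub>M\<^esub> q \<ominus>\<^bsub>M\<^esub> r) = \<zero>\<^bsub>M\<^esub>"
    using assms by (simp add: a_minus_def M.r_neg flip: M.minus_add)
  finally show ?thesis .
qed

lemma loc_eq_refl: "loc_eq M x a a"
  by (auto simp: loc_eq_def)

lemma loc_eq_sym: "loc_eq M x a b \<Longrightarrow> loc_eq M x b a"
  unfolding loc_eq_def by metis

lemma loc_eq_exponent_mono:
  assumes "act M (x ^ k) a = act M (x ^ k) b" "k \<le> k'" "a \<in> carrier M" "b \<in> carrier M"
  shows "act M (x ^ k') a = act M (x ^ k') b"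
proof -
  have "x ^ k' = x ^ (k' - k) * x ^ k" using assms(2) by (simp flip: power_add)
  then show ?thesis using assms by (simp add: act_mult)
qed

lemma loc_eq_trans:
  assumes "loc_eq M x a b" "loc_eq M x b c" "a \<in> carrier M" "b \<in> carrier M" "c \<in> carrier M"
  shows "loc_eq M x a c"
proof -
  obtain k l where "act M (x ^ k) a = act M (x ^ k) b" "act M (x ^ l) b = act M (x ^ l) c"
    using assms by (auto simp: loc_eq_def)
  then have "act M (x ^ (max k l)) a = act M (x ^ (max k l)) b" "act M (x ^ (max k l)) b = act M (x ^ (max k l)) c"
    using assms loc_eq_exponent_mono[of x k a b "max k l"] loc_eq_exponent_mono[of x l b c "max k l"] by auto
  then show ?thesis unfolding loc_eq_def by metis
qed

lemma loc_eq_add: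
  assumes "loc_eq M x a b" "loc_eq M x a' b'"
    "a \<in> carrier M" "b \<in> carrier M" "a' \<in> carrier M" "b' \<in> carrier M"
  shows "loc_eq M x (a \<oplus>\<^bsub>M\<^esub> a') (b \<oplus>\<^bsub>M\<^esub> b')"
proof -
  obtain k l where "act M (x ^ k) a = act M (x ^ k) b" "act M (x ^ l) a' = act M (x ^ l) b'"
    using assms by (auto simp: loc_eq_def)
  then have "act M (x ^ (max k l)) a = act M (x ^ (max k l)) b" "act M (x ^ (max k l)) a' = act M (x ^ (max k l)) b'"
    using assms loc_eq_exponent_mono[of x k a b "max k l"] loc_eq_exponent_mono[of x l a' b' "max k l"] by auto
  then show ?thesis unfolding loc_eq_def using assms by (metis act_plus)
qed

lemma loc_eq_act:
  assumes "loc_eq M x a b" "a \<in> carrier M" "b \<in> carrier M"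
  shows "loc_eq M x (act M f a) (act M f b)"
  using assms unfolding loc_eq_def by (metis act_comm)

lemma loc_eq_minus:
  assumes "loc_eq M x a b" "a \<in> carrier M" "b \<in> carrier M"
  shows "loc_eq M x (\<ominus>\<^bsub>M\<^esub> a) (\<ominus>\<^bsub>M\<^esub> b)"
  using assms unfolding loc_eq_def by (metis act_minus)

lemma loc_eq_subtract:
  assumes "loc_eq M x a b" "loc_eq M x a' b'"
    "a \<in> carrier M" "b \<in> carrier M" "a' \<in> carrier M" "b' \<in> carrier M"
  shows "loc_eq M x (a \<ominus>\<^bsub>M\<^esub> a') (b \<ominus>\<^bsub>M\<^esub> b')"
  unfolding a_minus_def using assms by (intro loc_eq_add loc_eq_minus) auto

lemma loc_eq_mult:
  assumes "loc_eq M x a b" "a \<in> carrier M" "b \<in> carrier M"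
  shows "loc_eq M (x * y) a b" "loc_eq M (y * x) a b"
proof -
  obtain k where "act M (x ^ k) a = act M (x ^ k) b" using assms(1) by (auto simp: loc_eq_def)
  then have "act M (y ^ k * x ^ k) a = act M (y ^ k * x ^ k) b" using assms by (simp add: act_mult)
  then show "loc_eq M (x * y) a b" "loc_eq M (y * x) a b"
    unfolding loc_eq_def by (auto simp: power_mult_distrib mult.commute)
qed

end

section \<open>Consequences of Baer's criterion\<close>

locale R'_graded_injective = R'_graded_module M B for M :: "(zpoly set, 'b) module" and B +
  assumes inj: "graded_injective R' R'_part M B"
begin

text \<open>The syzygy hypothesis makes the assignment of \<open>m1, m2, m3\<close> to
  \<open>x1, x2, x3\<close> a well-defined homomorphism on the ideal they generate, shifted by
  \<open>n\<close>. Its extension to the shifted ring sends 1 to the wanted \<open>e\<close>. Fewer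
  generators are handled by padding with 0.\<close>

lemma baer_three:
  assumes x: "x1 \<in> zpoly_part d1" "x2 \<in> zpoly_part d2" "x3 \<in> zpoly_part d3"
    and m: "m1 \<in> B (d1 + n)" "m2 \<in> B (d2 + n)" "m3 \<in> B (d3 + n)"
    and syz: "\<And>a1 a2 a3. hyp dvd x1 * a1 + x2 * a2 + x3 * a3 \<Longrightarrow>
      act M a1 m1 \<oplus>\<^bsub>M\<^esub> act M a2 m2 \<oplus>\<^bsub>M\<^esub> act M a3 m3 = \<zero>\<^bsub>M\<^esub>"
  shows "\<exists>e\<in>B n. act M x1 e = m1 \<and> act M x2 e = m2 \<and> act M x3 e = m3"
proof -
  note mc [simp] = m[THEN part_carrier]
  define comb where "comb a1 a2 a3 = x1 * a1 + x2 * a2 + x3 * a3" for a1 a2 a3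
  define val where "val a1 a2 a3 = act M a1 m1 \<oplus>\<^bsub>M\<^esub> act M a2 m2 \<oplus>\<^bsub>M\<^esub> act M a3 m3" for a1 a2 a3
  have valc [simp]: "val a1 a2 a3 \<in> carrier M" for a1 a2 a3 by (simp add: val_def)
  have val_add: "val (a1 + b1) (a2 + b2) (a3 + b3) = val a1 a2 a3 \<oplus>\<^bsub>M\<^esub> val b1 b2 b3" for a1 a2 a3 b1 b2 b3
    by (simp add: val_def act_add M.a_ac)
  have val_act: "val (r * a1) (r * a2) (r * a3) = act M r (val a1 a2 a3)" for r a1 a2 a3
    by (simp add: val_def act_mult act_plus)
  have val_eq: "val a1 a2 a3 = val b1 b2 b3" if "hyp dvd comb a1 a2 a3 - comb b1 b2 b3" for a1 a2 a3 b1 b2 b3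
  proof -
    have "comb a1 a2 a3 - comb b1 b2 b3 = comb (a1 - b1) (a2 - b2) (a3 - b3)"
      by (simp add: comb_def algebra_simps)
    then have "val (a1 - b1) (a2 - b2) (a3 - b3) = \<zero>\<^bsub>M\<^esub>"
      unfolding val_def using that by (intro syz) (simp add: comb_def)
    then show ?thesis using val_add[of "a1 - b1" b1 "a2 - b2" b2 "a3 - b3" b3] by simp
  qed
  define J where "J = {f. \<exists>a1 a2 a3. hyp dvd f - comb a1 a2 a3}"
  have JI: "f \<in> J" if "hyp dvd f - comb a1 a2 a3" for f a1 a2 a3 using that by (auto simp: J_def)
  \<comment> \<open>Coefficients may be replaced by their homogeneous parts. This makes
    \<open>J\<close> homogeneous and the homomorphism \<open>g\<close> compatible with
    degrees.\<close>
  have hp: "hyp dvd hpart k f - comb (hpart (k - d1) a1) (hpart (k - d2) a2) (hpart (k - d3) a3)"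
    if d: "hyp dvd f - comb a1 a2 a3" for f a1 a2 a3 k
  proof -
    obtain q where "f - comb a1 a2 a3 = hyp * q" using d by (elim dvdE)
    then have "f = comb a1 a2 a3 + hyp * q" by (simp add: algebra_simps)
    then have "hpart k f = comb (hpart (k - d1) a1) (hpart (k - d2) a2) (hpart (k - d3) a3) + hyp * hpart (k - 1) q"
      by (simp add: comb_def hpart_add hpart_mult[OF x(1)] hpart_mult[OF x(2)] hpart_mult[OF x(3)] hpart_mult[OF zpoly_part_hyp])
    then show ?thesis by simp
  qed
  have J: "homogeneous_ideal J"
    unfolding homogeneous_ideal_def
  proof (intro conjI allI impI ballI)
    fix f assume "hyp dvd f"
    then show "f \<in> J" by (intro JI[of _ 0 0 0]) (simp add: comb_def)
  next
    fix f g assume "f \<in> J" "g \<in> J"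
    then obtain a1 a2 a3 b1 b2 b3 where "hyp dvd f - comb a1 a2 a3" "hyp dvd g - comb b1 b2 b3"
      by (auto simp: J_def)
    then have "hyp dvd (f - comb a1 a2 a3) + (g - comb b1 b2 b3)" by (rule dvd_add)
    then show "f + g \<in> J"
      by (intro JI[of _ "a1 + b1" "a2 + b2" "a3 + b3"]) (simp add: comb_def algebra_simps)
  next
    fix r f assume "f \<in> J"
    then obtain a1 a2 a3 where "hyp dvd f - comb a1 a2 a3" by (auto simp: J_def)
    then have "hyp dvd r * (f - comb a1 a2 a3)" by simp
    then show "r * f \<in> J"
      by (intro JI[of _ "r * a1" "r * a2" "r * a3"]) (simp add: comb_def algebra_simps)
  next
    fix k f assume "f \<in> J"
    then show "hpart k f \<in> J" using hp JI unfolding J_def by blast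
  qed
  define g where "g y = (SOME v. \<exists>f a1 a2 a3. y = cls f \<and> hyp dvd f - comb a1 a2 a3 \<and> v = val a1 a2 a3)" for y
  have g: "g (cls f) = val a1 a2 a3" if "hyp dvd f - comb a1 a2 a3" for f a1 a2 a3
    unfolding g_def
  proof (rule some_equality)
    show "\<exists>f' b1 b2 b3. cls f = cls f' \<and> hyp dvd f' - comb b1 b2 b3 \<and> val a1 a2 a3 = val b1 b2 b3"
      using that by blast
    fix v assume "\<exists>f' b1 b2 b3. cls f = cls f' \<and> hyp dvd f' - comb b1 b2 b3 \<and> v = val b1 b2 b3"
    then obtain f' b1 b2 b3 where f': "cls f = cls f'" "hyp dvd f' - comb b1 b2 b3" "v = val b1 b2 b3" by blast
    have "hyp dvd (f - f') + (f' - comb b1 b2 b3) - (f - comb a1 a2 a3)"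
      using f'(1,2) that by (metis cls_eq_iff dvd_diff dvd_add)
    also have "(f - f') + (f' - comb b1 b2 b3) - (f - comb a1 a2 a3) = comb a1 a2 a3 - comb b1 b2 b3" by simp
    finally show "v = val a1 a2 a3" using val_eq f' by simp
  qed
  have ghom: "g \<in> graded_hom R' (ideal_module J) (ideal_module_part J n) M B"
    unfolding graded_hom_def
  proof (intro CollectI conjI ballI allI subsetI Pi_I)
    fix y assume "y \<in> carrier (ideal_module J)"
    then show "g y \<in> carrier M" by (auto simp: ideal_module_simps J_def g)
  next
    fix y z assume "y \<in> carrier (ideal_module J)" "z \<in> carrier (ideal_module J)"
    then obtain f f' a1 a2 a3 b1 b2 b3 where *: "y = cls f" "hyp dvd f - comb a1 a2 a3"
      "z = cls f'" "hyp dvd f' - comb b1 b2 b3" by (auto simp: ideal_module_simps J_def)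
    have "hyp dvd (f - comb a1 a2 a3) + (f' - comb b1 b2 b3)" by (rule dvd_add[OF *(2,4)])
    then have "hyp dvd (f + f') - comb (a1 + b1) (a2 + b2) (a3 + b3)" by (simp add: comb_def algebra_simps)
    then show "g (y \<oplus>\<^bsub>ideal_module J\<^esub> z) = g y \<oplus>\<^bsub>M\<^esub> g z"
      using * by (simp add: ideal_module_simps cls_add g val_add)
  next
    fix r y assume "r \<in> carrier R'" "y \<in> carrier (ideal_module J)"
    then obtain r' f a1 a2 a3 where *: "r = cls r'" "y = cls f" "hyp dvd f - comb a1 a2 a3"
      by (auto simp: ideal_module_simps J_def carrier_R')
    have "hyp dvd r' * (f - comb a1 a2 a3)" by (rule dvd_mult[OF *(3)])
    then have "hyp dvd r' * f - comb (r' * a1) (r' * a2) (r' * a3)" by (simp add: comb_def algebra_simps)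
    then show "g (r \<odot>\<^bsub>ideal_module J\<^esub> y) = r \<odot>\<^bsub>M\<^esub> g y"
      using * by (simp add: ideal_module_simps cls_mult g val_act act_def)
  next
    fix k v assume "v \<in> g ` ideal_module_part J n k"
    then obtain f a1 a2 a3 where f: "v = g (cls f)" "f \<in> zpoly_part (k - n)" "hyp dvd f - comb a1 a2 a3"
      by (auto simp: ideal_module_part_def J_def)
    have "v = val (hpart (k - n - d1) a1) (hpart (k - n - d2) a2) (hpart (k - n - d3) a3)"
      using hp[OF f(3), of "k - n"] f(1,2) by (simp add: g hpart_of_part)
    also have "\<dots> \<in> B k"
      unfolding val_def using m by (intro part_add part_act[OF hpart_in_part]) auto
    finally show "v \<in> B k" .
  qed
  have incl: "id \<in> graded_hom R' (ideal_module J) (ideal_module_part J n) (ideal_module UNIV) (ideal_module_part UNIV n)"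
    unfolding graded_hom_def by (auto simp: ideal_module_simps ideal_module_part_def)
  have "graded_module R' R'_part (ideal_module J) (ideal_module_part J n)"
    "graded_module R' R'_part (ideal_module UNIV) (ideal_module_part UNIV n)"
    by (intro graded_module_ideal_module graded_ring_axioms J homogeneous_ideal_UNIV)+
  then obtain h where h: "h \<in> graded_hom R' (ideal_module UNIV) (ideal_module_part UNIV n) M B"
    "\<forall>y\<in>carrier (ideal_module J). h (id y) = g y"
    using inj[unfolded graded_injective_def, THEN conjunct2, rule_format,
        of "ideal_module J" "ideal_module_part J n" "ideal_module UNIV" "ideal_module_part UNIV n" id g] incl ghom
    by auto
  define e where "e = h (cls 1)"
  have "cls 1 \<in> ideal_module_part UNIV n n" by (simp add: ideal_module_part_def)
  then have eB: "e \<in> B n" using h(1) unfolding graded_hom_def e_def by blast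
  have act_e: "act M f e = val a1 a2 a3" if "hyp dvd f - comb a1 a2 a3" for f a1 a2 a3
  proof -
    have "act M f e = h (cls f \<odot>\<^bsub>ideal_module UNIV\<^esub> cls 1)"
      using h(1) by (simp add: graded_hom_def act_def e_def ideal_module_simps)
    also have "\<dots> = h (cls f)" by (simp add: ideal_module_simps cls_mult)
    also have "\<dots> = g (cls f)" using h(2) JI[OF that] by (simp add: ideal_module_simps)
    finally show ?thesis using g[OF that] by simp
  qed
  have "act M x1 e = val 1 0 0" "act M x2 e = val 0 1 0" "act M x3 e = val 0 0 1"
    by (rule act_e; simp add: comb_def)+
  then show ?thesis using eB by (intro bexI[of _ e]) (simp_all add: val_def)
qed

lemma divisible:
  assumes x: "x \<in> zpoly_part d" "\<And>f. hyp dvd x * f \<Longrightarrow> hyp dvd f" and m: "m \<in> B n'" "n' = d + n"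
  shows "\<exists>e\<in>B n. act M x e = m"
proof -
  have "\<exists>e\<in>B n. act M x e = m \<and> act M 0 e = \<zero>\<^bsub>M\<^esub> \<and> act M 0 e = \<zero>\<^bsub>M\<^esub>"
  proof (rule baer_three[of _ d _ 0 _ 0])
    fix a1 a2 a3 assume "hyp dvd x * a1 + 0 * a2 + 0 * a3"
    then have "hyp dvd a1" using x(2)[of a1] by simp
    then show "act M a1 m \<oplus>\<^bsub>M\<^esub> act M a2 \<zero>\<^bsub>M\<^esub> \<oplus>\<^bsub>M\<^esub> act M a3 \<zero>\<^bsub>M\<^esub> = \<zero>\<^bsub>M\<^esub>"
      using part_carrier[OF m(1)] by (simp add: act_hyp)
  qed (use x(1) m in auto)
  then show ?thesis by auto
qed

text \<open>Torsion for \<open>Y * W\<close> is the sum of \<open>W\<close>-torsion and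
  \<open>Y\<close>-torsion: \<open>t = t' + (t - t')\<close>. Baer's criterion is applied to
  \<open>W^k\<close> with value 0 and \<open>Y^k\<close> with value \<open>Y^k t\<close>; in a
  syzygy the second coefficient lies in \<open>(hyp, W^k)\<close>, which annihilates
  \<open>Y^k t\<close>.\<close>

lemma split_torsion:
  assumes Y: "Y \<in> {Var iU, Var iV, Var iU * Var iV}" and t: "t \<in> B n" "loc_zero M (Y * Var iW) t"
  shows "\<exists>t'\<in>B n. loc_zero M (Var iW) t' \<and> loc_eq M Y t' t"
proof -
  obtain k where k: "act M ((Y * Var iW) ^ k) t = \<zero>\<^bsub>M\<^esub>" using t(2) by (auto simp: loc_eq_def)
  have tc [simp]: "t \<in> carrier M" using t(1) by (rule part_carrier)
  obtain d where d: "Y \<in> zpoly_part d"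
    using Y zpoly_part_Vars(1,2) zpoly_part_mult[of "Var iU" 1 "Var iV" 1] by blast
  have "\<exists>e\<in>B n. act M (Var iW ^ k) e = \<zero>\<^bsub>M\<^esub> \<and> act M (Y ^ k) e = act M (Y ^ k) t \<and> act M 0 e = \<zero>\<^bsub>M\<^esub>"
  proof (rule baer_three[of _ "int k" _ "int k * d" _ 0])
    show "Y ^ k \<in> zpoly_part (int k * d)" using d by (rule zpoly_part_power)
    then show "act M (Y ^ k) t \<in> B (int k * d + n)" by (rule part_act[OF _ t(1)]) simp
    fix a1 a2 a3 assume "hyp dvd Var iW ^ k * a1 + Y ^ k * a2 + 0 * a3"
    then have "hyp dvd Y ^ k * a2 + Var iW ^ k * a1" by (simp add: add.commute)
    then obtain b where b: "hyp dvd a2 + Var iW ^ k * b" using regular_mod_hyp_W_power[OF Y] by blast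
    have "act M a2 (act M (Y ^ k) t) = act M (- (Var iW ^ k * b)) (act M (Y ^ k) t)"
      using b by (intro act_cong) auto
    also have "\<dots> = act M (- b) (act M ((Y * Var iW) ^ k) t)"
      by (simp add: power_mult_distrib mult_ac flip: act_mult)
    also have "\<dots> = \<zero>\<^bsub>M\<^esub>" by (simp add: k)
    finally show "act M a1 \<zero>\<^bsub>M\<^esub> \<oplus>\<^bsub>M\<^esub> act M a2 (act M (Y ^ k) t) \<oplus>\<^bsub>M\<^esub> act M a3 \<zero>\<^bsub>M\<^esub> = \<zero>\<^bsub>M\<^esub>" by simp
  qed auto
  then show ?thesis unfolding loc_eq_def by fastforce
qed

text \<open>Surjectivity onto Cech cocycles of degree 0. Baer's criterion is applied to
  \<open>U^(3j), V^(3j), W^(3j)\<close>, whose syzygies reduce to Koszul relations between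
  \<open>j\<close>-th powers; these are respected because the elements agree on the
  overlaps.\<close>

lemma glue:
  assumes e: "e1 \<in> B n" "e2 \<in> B n" "e3 \<in> B n"
    and 12: "loc_eq M (Var iU * Var iV) e1 e2" and 13: "loc_eq M (Var iU * Var iW) e1 e3"
    and 23: "loc_eq M (Var iV * Var iW) e2 e3"
  shows "\<exists>e\<in>B n. loc_eq M (Var iU) e e1 \<and> loc_eq M (Var iV) e e2 \<and> loc_eq M (Var iW) e e3"
proof -
  note ec [simp] = e[THEN part_carrier]
  obtain j1 j2 j3 where "act M ((Var iU * Var iV) ^ j1) e1 = act M ((Var iU * Var iV) ^ j1) e2"
    "act M ((Var iU * Var iW) ^ j2) e1 = act M ((Var iU * Var iW) ^ j2) e3"
    "act M ((Var iV * Var iW) ^ j3) e2 = act M ((Var iV * Var iW) ^ j3) e3"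
    using 12 13 23 unfolding loc_eq_def by blast
  moreover define j where "j = max j1 (max j2 j3)"
  ultimately have j: "act M ((Var iU * Var iV) ^ j) e1 = act M ((Var iU * Var iV) ^ j) e2"
    "act M ((Var iU * Var iW) ^ j) e1 = act M ((Var iU * Var iW) ^ j) e3"
    "act M ((Var iV * Var iW) ^ j) e2 = act M ((Var iV * Var iW) ^ j) e3"
    by (auto intro: loc_eq_exponent_mono)
  let ?k = "3 * j"
  have "\<exists>e\<in>B n. act M (Var iU ^ ?k) e = act M (Var iU ^ ?k) e1 \<and>
    act M (Var iV ^ ?k) e = act M (Var iV ^ ?k) e2 \<and> act M (Var iW ^ ?k) e = act M (Var iW ^ ?k) e3"
  proof (rule baer_three[OF zpoly_part_Var_power])
    fix a1 a2 a3 assume "hyp dvd Var iU ^ ?k * a1 + Var iV ^ ?k * a2 + Var iW ^ ?k * a3"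
    then obtain q where q: "Var iU ^ ?k * a1 + Var iV ^ ?k * a2 + Var iW ^ ?k * a3 = hyp * q" ..
    then obtain q1 q2 q3 where q': "q = Var iU ^ j * q1 + Var iV ^ j * q2 + Var iW ^ j * q3"
      using hyp_multiple_in_monomial_ideal by blast
    \<comment> \<open>Expressing \<open>q\<close> through \<open>U^j, V^j, W^j\<close> moves the
      multiple of \<open>hyp\<close> into the coefficients and turns a relation modulo
      \<open>hyp\<close> into an exact one.\<close>
    define b1 b2 b3 where "b1 = Var iU ^ (2 * j) * a1 - hyp * q1" and "b2 = Var iV ^ (2 * j) * a2 - hyp * q2"
      and "b3 = Var iW ^ (2 * j) * a3 - hyp * q3"
    have kj: "x ^ ?k = x ^ j * x ^ (2 * j)" for x :: zpoly by (simp flip: power_add)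
    have "Var iU ^ j * b1 + Var iV ^ j * b2 + Var iW ^ j * b3
        = Var iU ^ ?k * a1 + Var iV ^ ?k * a2 + Var iW ^ ?k * a3 - hyp * q"
      unfolding b1_def b2_def b3_def q' kj by (simp add: algebra_simps)
    then have "Var iU ^ j * b1 + Var iV ^ j * b2 + Var iW ^ j * b3 = 0" using q by simp
    then obtain \<alpha> \<beta> \<gamma> where b: "b1 = \<beta> * Var iV ^ j + \<gamma> * Var iW ^ j" "b2 = \<alpha> * Var iW ^ j - \<beta> * Var iU ^ j"
      "b3 = - \<gamma> * Var iU ^ j - \<alpha> * Var iV ^ j"
      using koszul_relation by blast
    have 1: "act M a1 (act M (Var iU ^ ?k) e1) = act M (Var iU ^ j * b1) e1"
      "act M a2 (act M (Var iV ^ ?k) e2) = act M (Var iV ^ j * b2) e2"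
      "act M a3 (act M (Var iW ^ ?k) e3) = act M (Var iW ^ j * b3) e3"
      unfolding b1_def b2_def b3_def kj
      by (simp_all flip: act_mult, (rule act_cong; simp add: algebra_simps)+)
    have ac: "act M (f * (x ^ j * y ^ j)) e = act M f (act M ((x * y) ^ j) e)" if "e \<in> carrier M" for f x y e
      using that by (simp add: act_mult power_mult_distrib)
    have "act M (Var iU ^ j * b1) e1 = act M (\<beta> * (Var iU ^ j * Var iV ^ j)) e1 \<oplus>\<^bsub>M\<^esub> act M (\<gamma> * (Var iU ^ j * Var iW ^ j)) e1"
      by (simp add: b algebra_simps flip: act_add)
    moreover have "act M (Var iV ^ j * b2) e2 = act M (\<alpha> * (Var iV ^ j * Var iW ^ j)) e2 \<ominus>\<^bsub>M\<^esub> act M (\<beta> * (Var iU ^ j * Var iV ^ j)) e2"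
      by (simp add: b algebra_simps flip: act_diff)
    moreover have "act M (Var iW ^ j * b3) e3 = \<ominus>\<^bsub>M\<^esub> act M (\<gamma> * (Var iU ^ j * Var iW ^ j)) e3 \<ominus>\<^bsub>M\<^esub> act M (\<alpha> * (Var iV ^ j * Var iW ^ j)) e3"
      by (simp add: b algebra_simps flip: act_diff act_neg)
    ultimately show "act M a1 (act M (Var iU ^ ?k) e1) \<oplus>\<^bsub>M\<^esub> act M a2 (act M (Var iV ^ ?k) e2)
        \<oplus>\<^bsub>M\<^esub> act M a3 (act M (Var iW ^ ?k) e3) = \<zero>\<^bsub>M\<^esub>"
      unfolding 1 by (simp add: ac j cancel_cyclic)
  qed (use e in \<open>auto intro!: part_act[OF zpoly_part_Var_power(1)] part_act[OF zpoly_part_Var_power(2)]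
      part_act[OF zpoly_part_Var_power(3)]\<close>)
  then show ?thesis unfolding loc_eq_def by blast
qed

end

section \<open>From the injective resolution to fractions\<close>

definition regular_form :: "int \<Rightarrow> zpoly \<Rightarrow> bool" where
  "regular_form d x \<longleftrightarrow> x \<in> zpoly_part d \<and> (\<forall>f. hyp dvd x * f \<longrightarrow> hyp dvd f)"

lemma regular_form_mult: "regular_form c x \<Longrightarrow> regular_form d y \<Longrightarrow> regular_form (c + d) (x * y)"
  unfolding regular_form_def by (metis zpoly_part_mult mult.assoc)

lemma regular_form_power: "regular_form d x \<Longrightarrow> regular_form (int k * d) (x ^ k)"
proof (induction k)
  case 0
  show ?case by (simp add: regular_form_def)
next
  case (Suc k)
  then show ?case using regular_form_mult[of d x "int k * d" "x ^ k"] by (simp add: algebra_simps)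
qed

lemma regular_form_Var:
  "regular_form 1 (Var iU)" "regular_form 1 (Var iV)" "regular_form 1 (Var iW)"
  unfolding regular_form_def using hyp_dvd_Var_mult by auto

lemma regular_form_products:
  "regular_form 2 (Var iU * Var iV)" "regular_form 2 (Var iU * Var iW)"
  "regular_form 2 (Var iV * Var iW)" "regular_form 3 UVW"
  using regular_form_mult[OF regular_form_Var(1,2)] regular_form_mult[OF regular_form_Var(1,3)]
    regular_form_mult[OF regular_form_Var(2,3)]
    regular_form_mult[OF regular_form_mult[OF regular_form_Var(1,2)] regular_form_Var(3)]
  by (simp_all add: UVW_def)

context R'_graded_module
begin

lemma subtract_self [simp]: "x \<in> carrier M \<Longrightarrow> x \<ominus>\<^bsub>M\<^esub> x = \<zero>\<^bsub>M\<^esub>"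
  by (simp add: a_minus_def M.r_neg)

lemma subtract_zero [simp]: "x \<in> carrier M \<Longrightarrow> x \<ominus>\<^bsub>M\<^esub> \<zero>\<^bsub>M\<^esub> = x"
  by (simp add: a_minus_def)

end

context R'_graded_injective
begin

lemma regular_form_divisible:
  assumes "regular_form d x" "m \<in> B n'" "n' = int k * d + n"
  shows "\<exists>e\<in>B n. act M (x ^ k) e = m"
proof (rule divisible)
  show "x ^ k \<in> zpoly_part (int k * d)"
    using regular_form_power[OF assms(1), of k] unfolding regular_form_def by (rule conjunct1)
  show "hyp dvd f" if "hyp dvd x ^ k * f" for f
    using regular_form_power[OF assms(1), of k] that unfolding regular_form_def by metis
qed (use assms in auto)

end

locale R'_graded_hom = M: R'_graded_module M B + N: R'_graded_module N C
  for M :: "(zpoly set, 'b) module" and B and N :: "(zpoly set, 'c) module" and C +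
  fixes f :: "'b \<Rightarrow> 'c"
  assumes hom: "f \<in> graded_hom R' M B N C"
begin

lemma hom_closed [simp]: "x \<in> carrier M \<Longrightarrow> f x \<in> carrier N"
  using hom by (auto simp: graded_hom_def)

lemma hom_add: "x \<in> carrier M \<Longrightarrow> y \<in> carrier M \<Longrightarrow> f (x \<oplus>\<^bsub>M\<^esub> y) = f x \<oplus>\<^bsub>N\<^esub> f y"
  using hom by (auto simp: graded_hom_def)

lemma hom_act: "x \<in> carrier M \<Longrightarrow> f (act M r x) = act N r (f x)"
  using hom by (auto simp: graded_hom_def act_def)

lemma hom_part: "x \<in> B n \<Longrightarrow> f x \<in> C n"
  using hom unfolding graded_hom_def by blast

lemma hom_zero [simp]: "f \<zero>\<^bsub>M\<^esub> = \<zero>\<^bsub>N\<^esub>"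
  using hom_act[of "\<zero>\<^bsub>M\<^esub>" 0] by simp

lemma hom_minus: "x \<in> carrier M \<Longrightarrow> f (\<ominus>\<^bsub>M\<^esub> x) = \<ominus>\<^bsub>N\<^esub> f x"
  using hom_act[of x "-1"] by (simp add: M.act_neg N.act_neg)

lemma hom_subtract: "x \<in> carrier M \<Longrightarrow> y \<in> carrier M \<Longrightarrow> f (x \<ominus>\<^bsub>M\<^esub> y) = f x \<ominus>\<^bsub>N\<^esub> f y"
  by (simp add: a_minus_def hom_add hom_minus)

lemma hom_loc_eq: "loc_eq M v x y \<Longrightarrow> x \<in> carrier M \<Longrightarrow> y \<in> carrier M \<Longrightarrow> loc_eq N v (f x) (f y)"
  unfolding loc_eq_def by (metis hom_act)

lemma hom_finsum:
  assumes "finite S" "\<And>i. i \<in> S \<Longrightarrow> c i \<in> carrier M"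
  shows "f (finsum M c S) = finsum N (\<lambda>i. f (c i)) S"
  using assms by (induction S rule: finite_induct) (simp_all add: hom_add Pi_def)

text \<open>\<open>x'\<close> is the component of \<open>x\<close> in degree \<open>n\<close>: by
  uniqueness of the decomposition of \<open>f x\<close>, the images of the other components
  vanish.\<close>

lemma homogeneous_preimage:
  assumes x: "x \<in> carrier M" and fx: "f x \<in> C n"
  shows "\<exists>x'\<in>B n. f x' = f x"
proof -
  obtain c where c: "\<And>k. c k \<in> B k" "finite {k. c k \<noteq> \<zero>\<^bsub>M\<^esub>}" "x = (\<Oplus>\<^bsub>M\<^esub>k\<in>{k. c k \<noteq> \<zero>\<^bsub>M\<^esub>}. c k)"
    using M.module_grading x unfolding is_grading_def by blast
  let ?S = "{k. c k \<noteq> \<zero>\<^bsub>M\<^esub>}"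
  define d1 where "d1 k = f (c k)" for k
  define d2 where "d2 k = (if k = n then f x else \<zero>\<^bsub>N\<^esub>)" for k
  have sub: "{k. d1 k \<noteq> \<zero>\<^bsub>N\<^esub>} \<subseteq> ?S" by (auto simp: d1_def)
  have cc: "c k \<in> carrier M" for k using c(1) M.part_carrier by blast
  have "f x = (\<Oplus>\<^bsub>N\<^esub>k\<in>?S. d1 k)"
    unfolding d1_def by (subst c(3)) (rule hom_finsum[OF c(2)], rule cc)
  also have "\<dots> = (\<Oplus>\<^bsub>N\<^esub>k\<in>{k. d1 k \<noteq> \<zero>\<^bsub>N\<^esub>}. d1 k)"
    using cc by (intro N.M.add.finprod_mono_neutral_cong_right[OF c(2) sub]) (auto simp: d1_def)
  finally have 1: "f x = (\<Oplus>\<^bsub>N\<^esub>k\<in>{k. d1 k \<noteq> \<zero>\<^bsub>N\<^esub>}. d1 k)" .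
  have "{k. d2 k \<noteq> \<zero>\<^bsub>N\<^esub>} = (if f x = \<zero>\<^bsub>N\<^esub> then {} else {n})" by (auto simp: d2_def)
  then have 2: "f x = (\<Oplus>\<^bsub>N\<^esub>k\<in>{k. d2 k \<noteq> \<zero>\<^bsub>N\<^esub>}. d2 k)" "finite {k. d2 k \<noteq> \<zero>\<^bsub>N\<^esub>}"
    using x by (auto simp: d2_def)
  have "\<exists>!d. (\<forall>k. d k \<in> C k) \<and> finite {k. d k \<noteq> \<zero>\<^bsub>N\<^esub>} \<and> f x = (\<Oplus>\<^bsub>N\<^esub>k\<in>{k. d k \<noteq> \<zero>\<^bsub>N\<^esub>}. d k)"
    using N.module_grading x unfolding is_grading_def by simp
  moreover have "\<forall>k. d1 k \<in> C k" "\<forall>k. d2 k \<in> C k"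
    using c(1) hom_part fx by (auto simp: d1_def d2_def)
  ultimately have "d1 = d2" using 1 2 finite_subset[OF sub c(2)] by blast
  then have "f (c n) = f x" by (auto simp: d1_def d2_def fun_eq_iff split: if_splits)
  then show ?thesis using c(1) by blast
qed

end

locale exact_pair = f: R'_graded_hom M B N C f + g: R'_graded_hom N C P D g + Minj: R'_graded_injective M B
  for M :: "(zpoly set, 'b) module" and B and f and N :: "(zpoly set, 'b) module" and C
    and g and P :: "(zpoly set, 'b) module" and D +
  assumes complex: "\<And>y. y \<in> carrier M \<Longrightarrow> g (f y) = \<zero>\<^bsub>P\<^esub>"
    and exact: "\<And>x. x \<in> carrier N \<Longrightarrow> g x = \<zero>\<^bsub>P\<^esub> \<Longrightarrow> \<exists>y\<in>carrier M. f y = x"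
begin

lemma exact_homogeneous:
  assumes "x \<in> C n" "g x = \<zero>\<^bsub>P\<^esub>"
  shows "\<exists>y\<in>B n. f y = x"
proof -
  obtain y where "y \<in> carrier M" "f y = x" using exact assms f.N.part_carrier by blast
  then show ?thesis using f.homogeneous_preimage[of y n] assms by auto
qed

text \<open>A multiple \<open>v^k x\<close> is a genuine cocycle and has a preimage; dividing that
  preimage by \<open>v^k\<close> inside the injective module \<open>M\<close> brings it back to
  degree \<open>n\<close>.\<close>

lemma exact_localized:
  assumes v: "regular_form d v" and x: "x \<in> C n" "loc_zero P v (g x)"
  shows "\<exists>y\<in>B n. loc_eq N v x (f y)"
proof -
  have xc [simp]: "x \<in> carrier N" using x(1) f.N.part_carrier by blast
  obtain k where "act P (v ^ k) (g x) = \<zero>\<^bsub>P\<^esub>" using x(2) by (auto simp: loc_eq_def)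
  then have "g (act N (v ^ k) x) = \<zero>\<^bsub>P\<^esub>" by (simp add: g.hom_act)
  moreover have "act N (v ^ k) x \<in> C (int k * d + n)"
    using regular_form_power[OF v, of k] x(1) by (auto simp: regular_form_def intro: f.N.part_act)
  ultimately obtain y where y: "y \<in> B (int k * d + n)" "f y = act N (v ^ k) x"
    using exact_homogeneous by blast
  obtain y' where y': "y' \<in> B n" "act M (v ^ k) y' = y"
    using Minj.regular_form_divisible[OF v y(1)] by blast
  then have "act N (v ^ k) (f y') = act N (v ^ k) x"
    using y(2) f.M.part_carrier by (simp flip: f.hom_act)
  then show ?thesis using y'(1) unfolding loc_eq_def by metis
qed

text \<open>All large exponents are allowed, so that several local primitives can be brought to a
  common denominator.\<close>

lemma exact_large_power:
  assumes x [simp]: "x \<in> carrier N" and "loc_zero P v (g x)"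
  shows "\<exists>k0. \<forall>k\<ge>k0. \<exists>y\<in>carrier M. act N (v ^ k) x = f y"
proof -
  obtain k0 where "act P (v ^ k0) (g x) = act P (v ^ k0) \<zero>\<^bsub>P\<^esub>" using assms(2) by (auto simp: loc_eq_def)
  then have "act P (v ^ k) (g x) = act P (v ^ k) \<zero>\<^bsub>P\<^esub>" if "k \<ge> k0" for k
    using that by (rule g.N.loc_eq_exponent_mono) auto
  then have "g (act N (v ^ k) x) = \<zero>\<^bsub>P\<^esub>" if "k \<ge> k0" for k
    using that by (simp add: g.hom_act)
  then show ?thesis using exact by (metis x f.N.act_closed)
qed

end

text \<open>\<open>\<epsilon>\<close> is the augmentation precomposed with the class map, so that
  numerators remain polynomials; its fibres are cosets of the multiples of \<open>hyp\<close> and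
  its image is the kernel of \<open>d0\<close>.\<close>

locale chase =
  E0: R'_graded_injective E0 C0 + E1: R'_graded_injective E1 C1 + E2: R'_graded_injective E2 C2 +
  E3: R'_graded_module E3 C3 + D0: R'_graded_hom E0 C0 E1 C1 d0 + D1: R'_graded_hom E1 C1 E2 C2 d1 +
  D2: R'_graded_hom E2 C2 E3 C3 d2 +
  p0: exact_pair E0 C0 d0 E1 C1 d1 E2 C2 + p1: exact_pair E1 C1 d1 E2 C2 d2 E3 C3
  for E0 E1 E2 E3 :: "(zpoly set, 'b) module" and C0 C1 C2 C3 and d0 d1 d2 :: "'b \<Rightarrow> 'b" +
  fixes \<epsilon> :: "zpoly \<Rightarrow> 'b"
  assumes \<epsilon>_closed [simp]: "\<And>s. \<epsilon> s \<in> carrier E0"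
    and \<epsilon>_add: "\<And>s t. \<epsilon> (s + t) = \<epsilon> s \<oplus>\<^bsub>E0\<^esub> \<epsilon> t"
    and \<epsilon>_mult: "\<And>r s. \<epsilon> (r * s) = act E0 r (\<epsilon> s)"
    and \<epsilon>_part: "\<And>s n. s \<in> zpoly_part n \<Longrightarrow> \<epsilon> s \<in> C0 n"
    and \<epsilon>_inj: "\<And>s t. \<epsilon> s = \<epsilon> t \<Longrightarrow> hyp dvd s - t"
    and d0_\<epsilon>: "\<And>s. d0 (\<epsilon> s) = \<zero>\<^bsub>E1\<^esub>"
    and \<epsilon>_exact: "\<And>x. x \<in> carrier E0 \<Longrightarrow> d0 x = \<zero>\<^bsub>E1\<^esub> \<Longrightarrow> \<exists>s. \<epsilon> s = x"
    and \<epsilon>_exact_homogeneous: "\<And>x n. x \<in> C0 n \<Longrightarrow> d0 x = \<zero>\<^bsub>E1\<^esub> \<Longrightarrow> \<exists>s\<in>zpoly_part n. \<epsilon> s = x"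
begin

abbreviation "u \<equiv> Var iU"
abbreviation "v \<equiv> Var iV"
abbreviation "w \<equiv> Var iW"

text \<open>\<open>m\<close> is obtained from \<open>s / (UVW)\<^sup>k\<close> by three connecting homomorphisms, with the lifts \<open>c\<close>, \<open>b\<close>, \<open>a\<close>
  normalized so that the remaining components of the Cech cochains vanish.\<close>

definition represents :: "int \<Rightarrow> 'b \<Rightarrow> zpoly \<Rightarrow> nat \<Rightarrow> bool" where
  "represents n m s k \<longleftrightarrow> s \<in> zpoly_part (3 * int k + n) \<and> (\<exists>a\<in>C2 n. \<exists>b\<in>C1 n. \<exists>c\<in>C0 n.
     m = d2 a \<and> loc_zero E2 v a \<and> loc_zero E2 w a \<and> loc_eq E2 u a (d1 b) \<and>
     loc_zero E1 w b \<and> loc_eq E1 (u * v) b (d0 c) \<and> act E0 (UVW ^ k) c = \<epsilon> s)"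

lemma represents_act:
  assumes "represents n m s k" "r \<in> zpoly_part 0"
  shows "represents n (act E3 r m) (r * s) k"
proof -
  obtain a b c where *: "a \<in> C2 n" "b \<in> C1 n" "c \<in> C0 n" "m = d2 a" "loc_zero E2 v a"
    "loc_zero E2 w a" "loc_eq E2 u a (d1 b)" "loc_zero E1 w b"
    "loc_eq E1 (u * v) b (d0 c)" "act E0 (UVW ^ k) c = \<epsilon> s" "s \<in> zpoly_part (3 * int k + n)"
    using assms(1) unfolding represents_def by blast
  note cc [simp] = *(1)[THEN E2.part_carrier] *(2)[THEN E1.part_carrier] *(3)[THEN E0.part_carrier]
  show ?thesis
    unfolding represents_def
  proof (intro conjI bexI)
    show "act E2 r a \<in> C2 n" "act E1 r b \<in> C1 n" "act E0 r c \<in> C0 n"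
      using * assms(2) by (auto intro: E2.part_act E1.part_act E0.part_act)
    show "act E3 r m = d2 (act E2 r a)" using * by (simp add: D2.hom_act)
    show "loc_zero E2 v (act E2 r a)" "loc_zero E2 w (act E2 r a)"
      using E2.loc_eq_act[OF *(5), of r] E2.loc_eq_act[OF *(6), of r] by simp_all
    show "loc_eq E2 u (act E2 r a) (d1 (act E1 r b))"
      using E2.loc_eq_act[OF *(7), of r] by (simp add: D1.hom_act)
    show "loc_zero E1 w (act E1 r b)"
      using E1.loc_eq_act[OF *(8), of r] by simp
    show "loc_eq E1 (u * v) (act E1 r b) (d0 (act E0 r c))"
      using E1.loc_eq_act[OF *(9), of r] by (simp add: D0.hom_act)
    show "act E0 (UVW ^ k) (act E0 r c) = \<epsilon> (r * s)"
      using *(10) E0.act_comm[of c "UVW ^ k" r] by (simp add: \<epsilon>_mult)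
    show "r * s \<in> zpoly_part (3 * int k + n)" using zpoly_part_mult[OF assms(2) *(11)] by simp
  qed
qed


text \<open>Local primitives of \<open>m\<close>, then of their discrepancies, are chosen along the
  resolution. At each stage \<open>split_torsion\<close> supplies a correction that kills one
  component without disturbing those already zero.\<close>

lemma represents_exists:
  assumes m: "m \<in> C3 n" "loc_zero E3 u m" "loc_zero E3 v m" "loc_zero E3 w m"
    and dm: "\<exists>a\<in>carrier E2. d2 a = m"
  shows "\<exists>s k. represents n m s k"
proof -
  obtain a0 where a0: "a0 \<in> C2 n" "d2 a0 = m"
    using dm D2.homogeneous_preimage m(1) by blast
  note [simp] = a0(1)[THEN E2.part_carrier] m(1)[THEN E3.part_carrier]
  obtain fW where fW: "fW \<in> C1 n" "loc_eq E2 w a0 (d1 fW)"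
    using p1.exact_localized[OF regular_form_Var(3) a0(1)] m(4) a0(2) by auto
  note [simp] = fW(1)[THEN E1.part_carrier]
  \<comment> \<open>Subtracting the image of a local primitive over \<open>W\<close> makes the lift
    vanish there.\<close>
  define a1 where "a1 = a0 \<ominus>\<^bsub>E2\<^esub> d1 fW"
  have a1: "a1 \<in> C2 n" "d2 a1 = m" "loc_zero E2 w a1"
    using E2.part_subtract[OF a0(1) D1.hom_part[OF fW(1)]] E2.loc_eq_subtract[OF fW(2) E2.loc_eq_refl[of w "d1 fW"]]
    by (simp_all add: a1_def D2.hom_subtract p1.complex a0(2))
  note [simp] = a1(1)[THEN E2.part_carrier]
  obtain fV where fV: "fV \<in> C1 n" "loc_eq E2 v a1 (d1 fV)"
    using p1.exact_localized[OF regular_form_Var(2) a1(1)] m(3) a1(2) by auto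
  note [simp] = fV(1)[THEN E1.part_carrier]
  have "loc_zero E2 (v * w) (d1 fV)"
    by (rule E2.loc_eq_trans[OF E2.loc_eq_mult(1)[OF E2.loc_eq_sym[OF fV(2)]] E2.loc_eq_mult(2)[OF a1(3)]]) simp_all
  then obtain g where g: "g \<in> C0 n" "loc_eq E1 (v * w) fV (d0 g)"
    using p0.exact_localized[OF regular_form_products(3) fV(1)] by auto
  note [simp] = g(1)[THEN E0.part_carrier]
  \<comment> \<open>\<open>fV\<close> is a cocycle over \<open>VW\<close>, and removing
    \<open>d0 g\<close> makes it torsion there without changing \<open>d1\<close>. Its part
    \<open>t'\<close> vanishes over \<open>W\<close>, so subtracting \<open>d1 t'\<close> corrects
    the lift over \<open>V\<close> and keeps it zero over \<open>W\<close>.\<close>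
  let ?t = "fV \<ominus>\<^bsub>E1\<^esub> d0 g"
  have "loc_zero E1 (v * w) ?t"
    using E1.loc_eq_subtract[OF g(2) E1.loc_eq_refl[of _ "d0 g"]] by simp
  moreover have "?t \<in> C1 n" using fV(1) D0.hom_part[OF g(1)] by (rule E1.part_subtract)
  ultimately obtain t' where t': "t' \<in> C1 n" "loc_zero E1 w t'" "loc_eq E1 v t' ?t"
    using E1.split_torsion[of v] by blast
  note [simp] = t'(1)[THEN E1.part_carrier]
  have dt: "d1 ?t = d1 fV" by (simp add: D1.hom_subtract p0.complex)
  define a2 where "a2 = a1 \<ominus>\<^bsub>E2\<^esub> d1 t'"
  have a2: "a2 \<in> C2 n" "d2 a2 = m" "loc_zero E2 w a2"
    using E2.part_subtract[OF a1(1) D1.hom_part[OF t'(1)]] E2.loc_eq_subtract[OF a1(3) D1.hom_loc_eq[OF t'(2)]]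
    by (simp_all add: a2_def D2.hom_subtract p1.complex a1(2))
  note [simp] = a2(1)[THEN E2.part_carrier]
  have a2v: "loc_zero E2 v a2"
    using E2.loc_eq_subtract[OF fV(2) D1.hom_loc_eq[OF t'(3)]] by (simp add: a2_def dt)
  obtain f where f: "f \<in> C1 n" "loc_eq E2 u a2 (d1 f)"
    using p1.exact_localized[OF regular_form_Var(1) a2(1)] m(2) a2(2) by auto
  note [simp] = f(1)[THEN E1.part_carrier]
  have "loc_zero E2 (u * w) (d1 f)"
    by (rule E2.loc_eq_trans[OF E2.loc_eq_mult(1)[OF E2.loc_eq_sym[OF f(2)]] E2.loc_eq_mult(2)[OF a2(3)]]) simp_all
  then obtain g' where g': "g' \<in> C0 n" "loc_eq E1 (u * w) f (d0 g')"
    using p0.exact_localized[OF regular_form_products(2) f(1)] by auto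
  note [simp] = g'(1)[THEN E0.part_carrier]
  \<comment> \<open>The same correction over \<open>UW\<close> replaces the primitive over
    \<open>U\<close> by one that vanishes over \<open>W\<close>.\<close>
  let ?t = "f \<ominus>\<^bsub>E1\<^esub> d0 g'"
  have "loc_zero E1 (u * w) ?t"
    using E1.loc_eq_subtract[OF g'(2) E1.loc_eq_refl[of _ "d0 g'"]] by simp
  moreover have "?t \<in> C1 n" using f(1) D0.hom_part[OF g'(1)] by (rule E1.part_subtract)
  ultimately obtain b where b: "b \<in> C1 n" "loc_zero E1 w b" "loc_eq E1 u b ?t"
    using E1.split_torsion[of u] by blast
  note [simp] = b(1)[THEN E1.part_carrier]
  have "d1 ?t = d1 f" by (simp add: D1.hom_subtract p0.complex)
  then have "loc_eq E2 u (d1 b) (d1 f)" using D1.hom_loc_eq[OF b(3)] by simp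
  then have a2u: "loc_eq E2 u a2 (d1 b)"
    by (intro E2.loc_eq_trans[OF f(2) E2.loc_eq_sym]) simp_all
  have "loc_zero E2 (u * v) (d1 b)"
    by (rule E2.loc_eq_trans[OF E2.loc_eq_mult(1)[OF E2.loc_eq_sym[OF a2u]] E2.loc_eq_mult(2)[OF a2v]]) simp_all
  then obtain c where c: "c \<in> C0 n" "loc_eq E1 (u * v) b (d0 c)"
    using p0.exact_localized[OF regular_form_products(1) b(1)] by auto
  note [simp] = c(1)[THEN E0.part_carrier]
  \<comment> \<open>So \<open>c\<close> becomes a cocycle after inverting \<open>UVW\<close>;
    clearing denominators, exactness at \<open>E0\<close> supplies the numerator
    \<open>s\<close>.\<close>
  have "loc_zero E1 (u * v * w) (d0 c)"
    by (rule E1.loc_eq_trans[OF E1.loc_eq_mult(1)[OF E1.loc_eq_sym[OF c(2)]] E1.loc_eq_mult(2)[OF b(2)]]) simp_all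
  then obtain k where "act E1 (UVW ^ k) (d0 c) = \<zero>\<^bsub>E1\<^esub>" by (auto simp: loc_eq_def UVW_def)
  then have "d0 (act E0 (UVW ^ k) c) = \<zero>\<^bsub>E1\<^esub>" by (simp add: D0.hom_act)
  moreover have "act E0 (UVW ^ k) c \<in> C0 (3 * int k + n)"
    using c(1) by (intro E0.part_act[OF zpoly_part_UVW_power]) simp_all
  ultimately obtain s where "s \<in> zpoly_part (3 * int k + n)" "\<epsilon> s = act E0 (UVW ^ k) c"
    using \<epsilon>_exact_homogeneous by blast
  then show ?thesis
    unfolding represents_def using a2 a2v a2u b c by metis
qed

text \<open>The chase run backwards: \<open>\<epsilon> s\<close> is divided by
  \<open>(UVW)^k\<close>, \<open>d0 c\<close> is split over \<open>UV\<close> and \<open>W\<close>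
  to give \<open>b\<close>, and the local elements \<open>d1 b, 0, 0\<close> are glued to
  \<open>a\<close>.\<close>

lemma represents_surjective:
  assumes s: "s \<in> zpoly_part (3 * int k + n)"
  shows "\<exists>m\<in>C3 n. represents n m s k \<and> loc_zero E3 u m \<and> loc_zero E3 v m \<and> loc_zero E3 w m"
proof -
  obtain c where c: "c \<in> C0 n" "act E0 (UVW ^ k) c = \<epsilon> s"
    using E0.regular_form_divisible[OF regular_form_products(4) \<epsilon>_part[OF s], of k n] by auto
  note [simp] = c(1)[THEN E0.part_carrier]
  have "act E1 (UVW ^ k) (d0 c) = \<zero>\<^bsub>E1\<^esub>" using c(2) by (simp add: d0_\<epsilon> flip: D0.hom_act)
  then have "loc_zero E1 (u * v * w) (d0 c)" by (auto simp: loc_eq_def UVW_def)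
  then obtain b where b: "b \<in> C1 n" "loc_zero E1 w b" "loc_eq E1 (u * v) b (d0 c)"
    using E1.split_torsion[of "u * v" "d0 c" n] D0.hom_part[OF c(1)] by blast
  note [simp] = b(1)[THEN E1.part_carrier]
  have "loc_zero E2 (u * v) (d1 b)" using D1.hom_loc_eq[OF b(3)] by (simp add: p0.complex)
  moreover have "loc_zero E2 w (d1 b)" using D1.hom_loc_eq[OF b(2)] by simp
  ultimately obtain a where a: "a \<in> C2 n" "loc_eq E2 u a (d1 b)" "loc_zero E2 v a" "loc_zero E2 w a"
    using E2.glue[OF D1.hom_part[OF b(1)] E2.part_zero E2.part_zero] E2.loc_eq_mult(2)[of w "d1 b" "\<zero>\<^bsub>E2\<^esub>" u]
      E2.loc_eq_refl by auto
  note [simp] = a(1)[THEN E2.part_carrier]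
  show ?thesis
  proof (intro bexI conjI)
    show "represents n (d2 a) s k" unfolding represents_def using a b c s by blast
    show "loc_zero E3 u (d2 a)" using D2.hom_loc_eq[OF a(2)] by (simp add: p1.complex)
    show "loc_zero E3 v (d2 a)" "loc_zero E3 w (d2 a)"
      using D2.hom_loc_eq[OF a(3)] D2.hom_loc_eq[OF a(4)] by simp_all
  qed (rule D2.hom_part[OF a(1)])
qed

text \<open>The two lifts of \<open>m\<close> differ by some \<open>d1 b0\<close>. Then
  \<open>b - b0\<close> has a local primitive over \<open>U\<close>, and \<open>b0\<close> has one
  over \<open>V\<close> and one over \<open>W\<close>. The mismatches of these on the double
  overlaps come from \<open>R'\<close> and display the fraction as a sum in which one variable
  cancels.\<close>

lemma null_frac_of_represents:
  assumes rep: "represents n m s k" and m: "m = d2 a'" "a' \<in> carrier E2"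
    and tors: "loc_zero E2 u a'" "loc_zero E2 v a'" "loc_zero E2 w a'"
  shows "null_frac s k"
proof -
  obtain a b c where *: "a \<in> C2 n" "b \<in> C1 n" "c \<in> C0 n" "m = d2 a" "loc_zero E2 v a"
    "loc_zero E2 w a" "loc_eq E2 u a (d1 b)" "loc_zero E1 w b"
    "loc_eq E1 (u * v) b (d0 c)" "act E0 (UVW ^ k) c = \<epsilon> s"
    using rep unfolding represents_def by blast
  note [simp] = *(1)[THEN E2.part_carrier] *(2)[THEN E1.part_carrier] *(3)[THEN E0.part_carrier] m(2)
  have "d2 (a \<ominus>\<^bsub>E2\<^esub> a') = \<zero>\<^bsub>E3\<^esub>" using * m by (simp add: D2.hom_subtract)
  then obtain b0 where b0 [simp]: "b0 \<in> carrier E1" and db0: "d1 b0 = a \<ominus>\<^bsub>E2\<^esub> a'"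
    using p1.exact[of "a \<ominus>\<^bsub>E2\<^esub> a'"] by auto
  have "loc_zero E2 v (d1 b0)" "loc_zero E2 w (d1 b0)"
    using E2.loc_eq_subtract[OF *(5) tors(2)] E2.loc_eq_subtract[OF *(6) tors(3)] by (simp_all add: db0)
  note dv = this(1) and dw = this(2)
  have du: "loc_zero E2 u (d1 (b \<ominus>\<^bsub>E1\<^esub> b0))"
  proof -
    have "loc_eq E2 u (d1 b \<ominus>\<^bsub>E2\<^esub> (a \<ominus>\<^bsub>E2\<^esub> a')) (a \<ominus>\<^bsub>E2\<^esub> (a \<ominus>\<^bsub>E2\<^esub> \<zero>\<^bsub>E2\<^esub>))"
      by (intro E2.loc_eq_subtract E2.loc_eq_sym[OF *(7)] E2.loc_eq_refl tors) simp_all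
    then show ?thesis by (simp add: D1.hom_subtract db0)
  qed
  obtain k1 where k1: "\<And>K. k1 \<le> K \<Longrightarrow> \<exists>y\<in>carrier E0. act E1 (u ^ K) (b \<ominus>\<^bsub>E1\<^esub> b0) = d0 y"
    using p0.exact_large_power[OF _ du] by auto
  obtain k2 where k2: "\<And>K. k2 \<le> K \<Longrightarrow> \<exists>y\<in>carrier E0. act E1 (v ^ K) b0 = d0 y"
    using p0.exact_large_power[OF b0 dv] by auto
  obtain k3 where k3: "\<And>K. k3 \<le> K \<Longrightarrow> \<exists>y\<in>carrier E0. act E1 (w ^ K) b0 = d0 y"
    using p0.exact_large_power[OF b0 dw] by auto
  obtain k4 where k4: "act E1 (w ^ k4) b = act E1 (w ^ k4) \<zero>\<^bsub>E1\<^esub>" using *(8) by (auto simp: loc_eq_def)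
  obtain k5 where k5: "act E1 ((u * v) ^ k5) b = act E1 ((u * v) ^ k5) (d0 c)" using *(9) by (auto simp: loc_eq_def)
  \<comment> \<open>One exponent serves all local primitives; including \<open>k\<close> allows the
    comparison with the denominator \<open>(UVW)^k\<close>.\<close>
  define K where "K = Max {k, k1, k2, k3, k4, k5}"
  have K: "k \<le> K" "k1 \<le> K" "k2 \<le> K" "k3 \<le> K" "k4 \<le> K" "k5 \<le> K" by (simp_all add: K_def)
  obtain gu gv gw where [simp]: "gu \<in> carrier E0" "gv \<in> carrier E0" "gw \<in> carrier E0"
    and gu: "act E1 (u ^ K) (b \<ominus>\<^bsub>E1\<^esub> b0) = d0 gu" and gv: "act E1 (v ^ K) b0 = d0 gv"
    and gw: "act E1 (w ^ K) b0 = d0 gw"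
    using k1[OF K(2)] k2[OF K(3)] k3[OF K(4)] by metis
  have wb: "act E1 (w ^ K) b = \<zero>\<^bsub>E1\<^esub>" using E1.loc_eq_exponent_mono[OF k4 K(5)] by simp
  have uvb: "act E1 ((u * v) ^ K) b = d0 (act E0 ((u * v) ^ K) c)"
    using E1.loc_eq_exponent_mono[OF k5 K(6)] by (simp add: D0.hom_act)
  let ?A = "act E0"
  have b_split: "(b \<ominus>\<^bsub>E1\<^esub> b0) \<oplus>\<^bsub>E1\<^esub> b0 = b" by (simp add: a_minus_def E1.M.a_assoc E1.M.l_neg)
  have "d0 (?A (v ^ K) gu \<oplus>\<^bsub>E0\<^esub> ?A (u ^ K) gv)
      = act E1 ((u * v) ^ K) (b \<ominus>\<^bsub>E1\<^esub> b0) \<oplus>\<^bsub>E1\<^esub> act E1 ((u * v) ^ K) b0"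
    by (simp add: D0.hom_add D0.hom_act flip: gu gv E1.act_mult)
       (simp add: power_mult_distrib mult.commute)
  also have "\<dots> = d0 (?A ((u * v) ^ K) c)" by (simp add: b_split uvb flip: E1.act_plus)
  finally have "d0 (?A ((u * v) ^ K) c \<ominus>\<^bsub>E0\<^esub> (?A (v ^ K) gu \<oplus>\<^bsub>E0\<^esub> ?A (u ^ K) gv)) = \<zero>\<^bsub>E1\<^esub>"
    by (simp add: D0.hom_subtract)
  then obtain s3 where s3: "\<epsilon> s3 = ?A ((u * v) ^ K) c \<ominus>\<^bsub>E0\<^esub> (?A (v ^ K) gu \<oplus>\<^bsub>E0\<^esub> ?A (u ^ K) gv)"
    using \<epsilon>_exact[of "?A ((u * v) ^ K) c \<ominus>\<^bsub>E0\<^esub> (?A (v ^ K) gu \<oplus>\<^bsub>E0\<^esub> ?A (u ^ K) gv)"] by auto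
  have "d0 (?A (w ^ K) gu \<oplus>\<^bsub>E0\<^esub> ?A (u ^ K) gw)
      = act E1 ((u * w) ^ K) (b \<ominus>\<^bsub>E1\<^esub> b0) \<oplus>\<^bsub>E1\<^esub> act E1 ((u * w) ^ K) b0"
    by (simp add: D0.hom_add D0.hom_act flip: gu gw E1.act_mult)
       (simp add: power_mult_distrib mult.commute)
  also have "\<dots> = act E1 (u ^ K) (act E1 (w ^ K) b)"
    by (simp add: b_split power_mult_distrib flip: E1.act_plus E1.act_mult)
  finally have "d0 (?A (w ^ K) gu \<oplus>\<^bsub>E0\<^esub> ?A (u ^ K) gw) = \<zero>\<^bsub>E1\<^esub>" by (simp add: wb)
  then obtain s2 where s2: "\<epsilon> s2 = ?A (w ^ K) gu \<oplus>\<^bsub>E0\<^esub> ?A (u ^ K) gw"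
    using \<epsilon>_exact[of "?A (w ^ K) gu \<oplus>\<^bsub>E0\<^esub> ?A (u ^ K) gw"] by auto
  have "d0 (?A (w ^ K) gv) = d0 (?A (v ^ K) gw)"
    by (simp add: D0.hom_act flip: gv gw) (simp add: E1.act_comm)
  then have "d0 (?A (w ^ K) gv \<ominus>\<^bsub>E0\<^esub> ?A (v ^ K) gw) = \<zero>\<^bsub>E1\<^esub>" by (simp add: D0.hom_subtract)
  then obtain s1 where s1: "\<epsilon> s1 = ?A (w ^ K) gv \<ominus>\<^bsub>E0\<^esub> ?A (v ^ K) gw"
    using \<epsilon>_exact[of "?A (w ^ K) gv \<ominus>\<^bsub>E0\<^esub> ?A (v ^ K) gw"] by auto
  \<comment> \<open>In the sum of the three overlap terms each of \<open>p\<close>,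
    \<open>q\<close>, \<open>r\<close> occurs twice with opposite signs, so only
    \<open>(UVW)^K c\<close> remains.\<close>
  define p q r where "p = ?A (w ^ K * v ^ K) gu" and "q = ?A (w ^ K * u ^ K) gv" and "r = ?A (v ^ K * u ^ K) gw"
  have [simp]: "p \<in> carrier E0" "q \<in> carrier E0" "r \<in> carrier E0" by (simp_all add: p_def q_def r_def)
  have e3: "\<epsilon> (w ^ K * s3) = ?A (UVW ^ K) c \<ominus>\<^bsub>E0\<^esub> (p \<oplus>\<^bsub>E0\<^esub> q)"
  proof -
    have "\<epsilon> (w ^ K * s3) = ?A (w ^ K * (u * v) ^ K) c \<ominus>\<^bsub>E0\<^esub> (p \<oplus>\<^bsub>E0\<^esub> q)"
      by (simp add: \<epsilon>_mult s3 p_def q_def E0.act_mult E0.act_subtract E0.act_plus)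
    also have "w ^ K * (u * v) ^ K = UVW ^ K" by (simp add: UVW_def power_mult_distrib)
    finally show ?thesis .
  qed
  have e2: "\<epsilon> (v ^ K * s2) = p \<oplus>\<^bsub>E0\<^esub> r"
    by (simp add: \<epsilon>_mult s2 p_def r_def E0.act_plus E0.act_mult) (simp add: E0.act_comm[of gu])
  have e1: "\<epsilon> (u ^ K * s1) = q \<ominus>\<^bsub>E0\<^esub> r"
    by (simp add: \<epsilon>_mult s1 q_def r_def E0.act_subtract E0.act_mult) (simp add: E0.act_comm[of gv] E0.act_comm[of gw])
  have "\<epsilon> (u ^ K * s1 + v ^ K * s2 + w ^ K * s3)
      = (q \<ominus>\<^bsub>E0\<^esub> r) \<oplus>\<^bsub>E0\<^esub> (p \<oplus>\<^bsub>E0\<^esub> r) \<oplus>\<^bsub>E0\<^esub> (?A (UVW ^ K) c \<ominus>\<^bsub>E0\<^esub> (p \<oplus>\<^bsub>E0\<^esub> q))"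
    by (simp add: \<epsilon>_add e1 e2 e3)
  also have "(q \<ominus>\<^bsub>E0\<^esub> r) \<oplus>\<^bsub>E0\<^esub> (p \<oplus>\<^bsub>E0\<^esub> r) = (p \<oplus>\<^bsub>E0\<^esub> q) \<oplus>\<^bsub>E0\<^esub> (r \<ominus>\<^bsub>E0\<^esub> r)"
    by (simp only: a_minus_def) (simp add: E0.M.a_ac)
  also have "\<dots> \<oplus>\<^bsub>E0\<^esub> (?A (UVW ^ K) c \<ominus>\<^bsub>E0\<^esub> (p \<oplus>\<^bsub>E0\<^esub> q)) = ?A (UVW ^ K) c \<oplus>\<^bsub>E0\<^esub> ((p \<oplus>\<^bsub>E0\<^esub> q) \<ominus>\<^bsub>E0\<^esub> (p \<oplus>\<^bsub>E0\<^esub> q))"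
    by (simp only: E0.subtract_self \<open>r \<in> carrier E0\<close>) (simp add: a_minus_def E0.M.a_ac)
  also have "\<dots> = ?A (UVW ^ K) c" by simp
  also have "\<dots> = \<epsilon> (UVW ^ (K - k) * s)"
    using K(1) by (simp add: \<epsilon>_mult flip: *(10) E0.act_mult power_add)
  finally have "hyp dvd (UVW ^ (K - k) * s) - (u ^ K * s1 + v ^ K * s2 + w ^ K * s3)"
    using \<epsilon>_inj by metis
  then obtain t where "(UVW ^ (K - k) * s) - (u ^ K * s1 + v ^ K * s2 + w ^ K * s3) = hyp * t" by (elim dvdE)
  then have "UVW ^ (K - k) * s = u ^ K * s1 + v ^ K * s2 + w ^ K * s3 + hyp * t" by (simp add: algebra_simps)
  then have "UVW ^ (K - k) * s \<in> cech_ideal (k + (K - k))" using K(1) by (simp add: cech_idealI)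
  then show ?thesis unfolding null_frac_def by blast
qed

text \<open>The three kinds of coboundary fractions are realized in \<open>E0\<close> as
  \<open>t1, t2, t3\<close>. Removing them makes \<open>c\<close> torsion for \<open>UVW\<close>;
  the resulting change of \<open>b\<close> yields local elements that glue to \<open>f0\<close>, and
  \<open>a - d1 f0\<close> is a torsion lift of \<open>m\<close>.\<close>

lemma represents_of_null_frac:
  assumes rep: "represents n m s k" and null: "null_frac s k"
  shows "\<exists>a'\<in>carrier E2. m = d2 a' \<and> loc_zero E2 u a' \<and> loc_zero E2 v a' \<and> loc_zero E2 w a'"
proof -
  obtain a b c where *: "a \<in> C2 n" "b \<in> C1 n" "c \<in> C0 n" "m = d2 a" "loc_zero E2 v a"
    "loc_zero E2 w a" "loc_eq E2 u a (d1 b)" "loc_zero E1 w b"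
    "loc_eq E1 (u * v) b (d0 c)" "act E0 (UVW ^ k) c = \<epsilon> s" and s: "s \<in> zpoly_part (3 * int k + n)"
    using rep unfolding represents_def by blast
  note [simp] = *(1)[THEN E2.part_carrier] *(2)[THEN E1.part_carrier] *(3)[THEN E0.part_carrier]
  obtain j where "UVW ^ j * s \<in> cech_ideal (k + j)" using null unfolding null_frac_def by blast
  moreover define K where "K = k + j"
  ultimately obtain a1 a2 a3 q where eq: "UVW ^ j * s = u ^ K * a1 + v ^ K * a2 + w ^ K * a3 + hyp * q"
    by (auto elim: cech_idealE)
  let ?d = "3 * int K + n"
  \<comment> \<open>Homogeneous parts are taken so that the quotients \<open>t1, t2, t3\<close> can
    be chosen in degree \<open>n\<close>.\<close>
  define b1 b2 b3 where "b1 = hpart (?d - int K) a1" and "b2 = hpart (?d - int K) a2" and "b3 = hpart (?d - int K) a3"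
  have bp: "b1 \<in> zpoly_part (?d - int K)" "b2 \<in> zpoly_part (?d - int K)" "b3 \<in> zpoly_part (?d - int K)"
    by (simp_all add: b1_def b2_def b3_def)
  have "UVW ^ j * s \<in> zpoly_part ?d"
    by (rule zpoly_part_mult'[OF zpoly_part_UVW_power s]) (simp add: K_def)
  then have "UVW ^ j * s = hpart ?d (UVW ^ j * s)" by (simp add: hpart_of_part)
  also have "\<dots> = u ^ K * b1 + v ^ K * b2 + w ^ K * b3 + hyp * hpart (?d - 1) q"
    unfolding eq hpart_add b1_def b2_def b3_def
    by (simp only: hpart_mult[OF zpoly_part_Var_power(1)] hpart_mult[OF zpoly_part_Var_power(2)]
        hpart_mult[OF zpoly_part_Var_power(3)] hpart_mult[OF zpoly_part_hyp])
  finally have eq': "UVW ^ j * s = u ^ K * b1 + v ^ K * b2 + w ^ K * b3 + hyp * hpart (?d - 1) q" .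
  have \<epsilon>_hyp: "\<epsilon> (hyp * q') = \<zero>\<^bsub>E0\<^esub>" for q' by (simp add: \<epsilon>_mult E0.act_hyp)
  obtain t1 where t1: "t1 \<in> C0 n" "act E0 ((v * w) ^ K) t1 = \<epsilon> b1"
    using E0.regular_form_divisible[OF regular_form_products(3) \<epsilon>_part[OF bp(1)], of K n] by auto
  obtain t2 where t2: "t2 \<in> C0 n" "act E0 ((u * w) ^ K) t2 = \<epsilon> b2"
    using E0.regular_form_divisible[OF regular_form_products(2) \<epsilon>_part[OF bp(2)], of K n] by auto
  obtain t3 where t3: "t3 \<in> C0 n" "act E0 ((u * v) ^ K) t3 = \<epsilon> b3"
    using E0.regular_form_divisible[OF regular_form_products(1) \<epsilon>_part[OF bp(3)], of K n] by auto
  note [simp] = t1(1)[THEN E0.part_carrier] t2(1)[THEN E0.part_carrier] t3(1)[THEN E0.part_carrier]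
  have dt: "loc_zero E1 (v * w) (d0 t1)" "loc_zero E1 (u * w) (d0 t2)" "loc_zero E1 (u * v) (d0 t3)"
    unfolding loc_eq_def using t1(2) t2(2) t3(2)
    by (auto intro!: exI[of _ K] simp: d0_\<epsilon> simp flip: D0.hom_act)
  let ?T = "t1 \<oplus>\<^bsub>E0\<^esub> t2 \<oplus>\<^bsub>E0\<^esub> t3" and ?A = "act E0"
  have "UVW ^ K = u ^ K * (v * w) ^ K" by (simp add: UVW_def power_mult_distrib)
  then have T1: "?A (UVW ^ K) t1 = \<epsilon> (u ^ K * b1)" by (simp add: \<epsilon>_mult E0.act_mult t1(2))
  have "UVW ^ K = v ^ K * (u * w) ^ K" by (simp add: UVW_def power_mult_distrib mult_ac)
  then have T2: "?A (UVW ^ K) t2 = \<epsilon> (v ^ K * b2)" by (simp add: \<epsilon>_mult E0.act_mult t2(2))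
  have "UVW ^ K = w ^ K * (u * v) ^ K" by (simp add: UVW_def power_mult_distrib mult_ac)
  then have T3: "?A (UVW ^ K) t3 = \<epsilon> (w ^ K * b3)" by (simp add: \<epsilon>_mult E0.act_mult t3(2))
  have "?A (UVW ^ K) ?T = \<epsilon> (UVW ^ j * s)"
    unfolding eq' by (simp add: E0.act_plus \<epsilon>_add \<epsilon>_hyp T1 T2 T3)
  also have "\<dots> = ?A (UVW ^ K) c"
    by (simp add: \<epsilon>_mult K_def add.commute flip: *(10) E0.act_mult power_add)
  finally have "?A (UVW ^ K) (c \<ominus>\<^bsub>E0\<^esub> ?T) = \<zero>\<^bsub>E0\<^esub>" by (simp add: E0.act_subtract)
  then have "loc_zero E0 (u * v * w) (c \<ominus>\<^bsub>E0\<^esub> ?T)" by (auto simp: loc_eq_def UVW_def)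
  moreover have "c \<ominus>\<^bsub>E0\<^esub> ?T \<in> C0 n" using * t1 t2 t3 by (intro E0.part_subtract E0.part_add)
  ultimately obtain z where z: "z \<in> C0 n" "loc_zero E0 w z" "loc_eq E0 (u * v) z (c \<ominus>\<^bsub>E0\<^esub> ?T)"
    using E0.split_torsion[of "u * v"] by blast
  note [simp] = z(1)[THEN E0.part_carrier]
  \<comment> \<open>\<open>d0 t2\<close> and \<open>d0 z\<close> vanish over \<open>UW\<close>, so
    the vanishing of \<open>b\<close> there is kept, while over \<open>UV\<close> the element
    becomes equal to \<open>d0 t1\<close>.\<close>
  define fu where "fu = b \<ominus>\<^bsub>E1\<^esub> (d0 t2 \<oplus>\<^bsub>E1\<^esub> d0 z)"
  have fu: "fu \<in> C1 n"
    unfolding fu_def using * t2 z by (intro E1.part_subtract E1.part_add D0.hom_part)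
  note [simp] = fu[THEN E1.part_carrier]
  have uv: "loc_eq E1 (u * v) fu (d0 t1)"
  proof -
    have "loc_eq E1 (u * v) fu (d0 c \<ominus>\<^bsub>E1\<^esub> (d0 t2 \<oplus>\<^bsub>E1\<^esub> d0 (c \<ominus>\<^bsub>E0\<^esub> ?T)))"
      unfolding fu_def
      by (intro E1.loc_eq_subtract E1.loc_eq_add *(9) E1.loc_eq_refl D0.hom_loc_eq[OF z(3)]) simp_all
    also have "d0 c \<ominus>\<^bsub>E1\<^esub> (d0 t2 \<oplus>\<^bsub>E1\<^esub> d0 (c \<ominus>\<^bsub>E0\<^esub> ?T)) = d0 t1 \<oplus>\<^bsub>E1\<^esub> d0 t3"
    proof -
      have "c \<ominus>\<^bsub>E0\<^esub> (t2 \<oplus>\<^bsub>E0\<^esub> (c \<ominus>\<^bsub>E0\<^esub> ?T)) = t1 \<oplus>\<^bsub>E0\<^esub> t3"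
      proof -
        have "c \<ominus>\<^bsub>E0\<^esub> (t2 \<oplus>\<^bsub>E0\<^esub> (c \<ominus>\<^bsub>E0\<^esub> ?T)) = (c \<ominus>\<^bsub>E0\<^esub> c) \<oplus>\<^bsub>E0\<^esub> ((t2 \<ominus>\<^bsub>E0\<^esub> t2) \<oplus>\<^bsub>E0\<^esub> (t1 \<oplus>\<^bsub>E0\<^esub> t3))"
          by (simp only: a_minus_def) (simp add: E0.M.minus_add E0.M.a_ac)
        then show ?thesis by simp
      qed
      then have "d0 (c \<ominus>\<^bsub>E0\<^esub> (t2 \<oplus>\<^bsub>E0\<^esub> (c \<ominus>\<^bsub>E0\<^esub> ?T))) = d0 (t1 \<oplus>\<^bsub>E0\<^esub> t3)" by simp
      then show ?thesis by (simp add: D0.hom_subtract[of c] D0.hom_add)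
    qed
    finally have 1: "loc_eq E1 (u * v) fu (d0 t1 \<oplus>\<^bsub>E1\<^esub> d0 t3)" .
    have "loc_eq E1 (u * v) (d0 t1 \<oplus>\<^bsub>E1\<^esub> d0 t3) (d0 t1)"
      using E1.loc_eq_add[OF E1.loc_eq_refl[of "u * v" "d0 t1"] dt(3)] by simp
    with 1 show ?thesis by (rule E1.loc_eq_trans) simp_all
  qed
  have uw: "loc_zero E1 (u * w) fu"
    using E1.loc_eq_subtract[OF E1.loc_eq_mult(2)[OF *(8)] E1.loc_eq_add[OF dt(2) E1.loc_eq_mult(2)[OF D0.hom_loc_eq[OF z(2)]]]]
    by (simp add: fu_def)
  obtain f0 where f0: "f0 \<in> C1 n" "loc_eq E1 u f0 fu" "loc_eq E1 v f0 (d0 t1)" "loc_zero E1 w f0"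
    using E1.glue[OF fu D0.hom_part[OF t1(1)] E1.part_zero uv uw dt(1)] by blast
  note [simp] = f0(1)[THEN E1.part_carrier]
  have dfu: "d1 fu = d1 b"
    by (simp add: fu_def D1.hom_subtract D1.hom_add p0.complex)
  show ?thesis
  proof (intro bexI conjI)
    show "m = d2 (a \<ominus>\<^bsub>E2\<^esub> d1 f0)" using * by (simp add: D2.hom_subtract p1.complex)
    show "loc_zero E2 u (a \<ominus>\<^bsub>E2\<^esub> d1 f0)"
      using E2.loc_eq_subtract[OF *(7) D1.hom_loc_eq[OF f0(2)]] by (simp add: dfu)
    show "loc_zero E2 v (a \<ominus>\<^bsub>E2\<^esub> d1 f0)"
      using E2.loc_eq_subtract[OF *(5) D1.hom_loc_eq[OF f0(3)]] by (simp add: p0.complex)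
    show "loc_zero E2 w (a \<ominus>\<^bsub>E2\<^esub> d1 f0)"
      using E2.loc_eq_subtract[OF *(6) D1.hom_loc_eq[OF f0(4)]] by simp
  qed simp
qed

end

section \<open>The third local cohomology\<close>

definition high_degree :: "nat \<Rightarrow> zpoly set" where
  "high_degree n = {f. \<forall>m\<in>kys f. n \<le> wdeg m}"

lemma ideal_cls_image:
  assumes 0: "0 \<in> J" and add: "\<And>f g. f \<in> J \<Longrightarrow> g \<in> J \<Longrightarrow> f + g \<in> J"
    and mult: "\<And>r f. f \<in> J \<Longrightarrow> r * f \<in> J"
  shows "ideal (cls ` J) R'"
proof -
  interpret R': cring R' by (rule cring_R')
  have neg: "- f \<in> J" if "f \<in> J" for f using mult[OF that, of "-1"] by simp
  show ?thesis
  proof (rule idealI[OF R'.ring_axioms])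
    show "subgroup (cls ` J) (add_monoid R')"
    proof (rule R'.add.subgroupI)
      show "cls ` J \<noteq> {}" using 0 by blast
      show "\<ominus>\<^bsub>R'\<^esub> a \<in> cls ` J" if "a \<in> cls ` J" for a
        using that neg by (auto simp: cls_uminus)
      show "a \<oplus>\<^bsub>R'\<^esub> b \<in> cls ` J" if "a \<in> cls ` J" "b \<in> cls ` J" for a b
        using that add by (auto simp: cls_add)
    qed auto
    fix a x assume "a \<in> cls ` J" "x \<in> carrier R'"
    then obtain f g where "f \<in> J" "a = cls f" "x = cls g" by (auto simp: carrier_R')
    then show "x \<otimes>\<^bsub>R'\<^esub> a \<in> cls ` J" "a \<otimes>\<^bsub>R'\<^esub> x \<in> cls ` J"
      using mult[of f g] by (auto simp: cls_mult mult.commute)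
  qed
qed

lemma high_degree_closed:
  "0 \<in> high_degree n" "f \<in> high_degree n \<Longrightarrow> g \<in> high_degree n \<Longrightarrow> f + g \<in> high_degree n"
  "f \<in> high_degree k \<Longrightarrow> g \<in> high_degree n \<Longrightarrow> f * g \<in> high_degree (k + n)"
  "g \<in> high_degree n \<Longrightarrow> f * g \<in> high_degree n"
proof -
  show "0 \<in> high_degree n" by (simp add: high_degree_def)
  show "f \<in> high_degree n \<Longrightarrow> g \<in> high_degree n \<Longrightarrow> f + g \<in> high_degree n"
    using keys_add[of f g] by (auto simp: high_degree_def)
  show 1: "f \<in> high_degree k \<Longrightarrow> g \<in> high_degree n \<Longrightarrow> f * g \<in> high_degree (k + n)" for f g k n
    using keys_mult[of f g] by (fastforce simp: high_degree_def wdeg_add intro: add_mono)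
  show "g \<in> high_degree n \<Longrightarrow> f * g \<in> high_degree n"
    using 1[of f 0 g n] by (simp add: high_degree_def)
qed

abbreviation "irr \<equiv> irrelevant_ideal R' R'_part"

lemma R'_part_subset: "R'_part n \<subseteq> carrier R'"
  by (auto simp: R'_part_def)

lemma irr_subset: "irr \<subseteq> cls ` high_degree 1"
proof -
  interpret R': cring R' by (rule cring_R')
  have "ideal (cls ` high_degree 1) R'"
    by (rule ideal_cls_image) (auto intro: high_degree_closed)
  moreover have "(\<Union>n\<in>{0<..}. R'_part n) \<subseteq> cls ` high_degree 1"
    by (fastforce simp: R'_part_def high_degree_def zpoly_part_iff)
  ultimately show ?thesis unfolding irrelevant_ideal_def by (rule R'.genideal_minimal)
qed

lemma Var_in_irr:
  assumes "x \<in> {iU, iV, iW}"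
  shows "cls (Var x) \<in> irr"
proof -
  interpret R': cring R' by (rule cring_R')
  have "(\<Union>n\<in>{0<..}. R'_part n) \<subseteq> irr"
    unfolding irrelevant_ideal_def using R'_part_subset by (intro R'.genideal_self) blast
  moreover have "R'_part 1 \<subseteq> (\<Union>n\<in>{0<..}. R'_part n)" by (rule UN_upper) simp
  moreover have "cls (Var x) \<in> R'_part 1" using assms by (auto simp: R'_part_def)
  ultimately show ?thesis by (meson subsetD)
qed

lemma irr_power_subset: "irr [^]\<^bsub>ideals_set R'\<^esub> n \<subseteq> cls ` high_degree n"
proof (induction n)
  case 0
  show ?case by (auto simp: ideals_set_def nat_pow_def carrier_R' high_degree_def)
next
  case (Suc n)
  show ?case
  proof
    fix x assume "x \<in> irr [^]\<^bsub>ideals_set R'\<^esub> Suc n"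
    then have "x \<in> ideal_prod R' (irr [^]\<^bsub>ideals_set R'\<^esub> n) irr"
      by (simp add: ideals_set_def nat_pow_def)
    then show "x \<in> cls ` high_degree (Suc n)"
    proof (induction x rule: ideal_prod.induct)
      case (prod i j)
      then obtain f g where "f \<in> high_degree n" "i = cls f" "g \<in> high_degree 1" "j = cls g"
        using Suc.IH irr_subset by blast
      then show ?case using high_degree_closed(3)[of f n g 1] by (auto simp: cls_mult)
    next
      case (sum s1 s2)
      then show ?case using high_degree_closed(2) by (auto simp: cls_add)
    qed
  qed
qed

lemma Var_power_in_irr_power:
  assumes "x \<in> {iU, iV, iW}"
  shows "cls (Var x ^ n) \<in> irr [^]\<^bsub>ideals_set R'\<^esub> n"
proof (induction n)
  case 0
  show ?case by (simp add: ideals_set_def nat_pow_def)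
next
  case (Suc n)
  have "cls (Var x ^ n) \<otimes>\<^bsub>R'\<^esub> cls (Var x) \<in> ideal_prod R' (irr [^]\<^bsub>ideals_set R'\<^esub> n) irr"
    by (rule ideal_prod.prod[OF Suc Var_in_irr[OF assms]])
  then show ?case by (simp add: ideals_set_def nat_pow_def cls_mult mult.commute)
qed

context R'_graded_module
begin

definition torsion :: "'b set" where
  "torsion = {m \<in> carrier M. loc_zero M (Var iU) m \<and> loc_zero M (Var iV) m \<and> loc_zero M (Var iW) m}"

text \<open>A monomial of degree at least \<open>3 * k\<close> in U, V, W contains one of them to
  the power \<open>k\<close>, so the ideal power with exponent \<open>3 * k\<close> acts through
  \<open>U^k, V^k, W^k\<close>. Conversely, the \<open>n\<close>-th powers of the variables lie in
  the \<open>n\<close>-th power of the ideal.\<close>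

lemma torsion_part_eq: "torsion_part R' irr M = torsion"
proof (intro equalityI subsetI)
  fix m assume "m \<in> torsion_part R' irr M"
  then obtain n :: nat where m: "m \<in> carrier M" "\<forall>r\<in>irr [^]\<^bsub>ideals_set R'\<^esub> n. r \<odot>\<^bsub>M\<^esub> m = \<zero>\<^bsub>M\<^esub>"
    by (auto simp: torsion_part_def)
  have "act M (Var x ^ n) m = \<zero>\<^bsub>M\<^esub>" if "x \<in> {iU, iV, iW}" for x
    using Var_power_in_irr_power[OF that, of n] m(2) by (simp add: act_def)
  then show "m \<in> torsion" using m(1) unfolding torsion_def loc_eq_def by auto
next
  fix m assume "m \<in> torsion"
  then obtain k1 k2 k3 where mc [simp]: "m \<in> carrier M" and
    "act M (Var iU ^ k1) m = act M (Var iU ^ k1) \<zero>\<^bsub>M\<^esub>" "act M (Var iV ^ k2) m = act M (Var iV ^ k2) \<zero>\<^bsub>M\<^esub>"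
    "act M (Var iW ^ k3) m = act M (Var iW ^ k3) \<zero>\<^bsub>M\<^esub>"
    unfolding torsion_def loc_eq_def by auto
  moreover define k where "k = max k1 (max k2 k3)"
  ultimately have k: "act M (Var iU ^ k) m = act M (Var iU ^ k) \<zero>\<^bsub>M\<^esub>" "act M (Var iV ^ k) m = act M (Var iV ^ k) \<zero>\<^bsub>M\<^esub>"
    "act M (Var iW ^ k) m = act M (Var iW ^ k) \<zero>\<^bsub>M\<^esub>"
    by (auto intro: loc_eq_exponent_mono simp del: act_null)
  have "r \<odot>\<^bsub>M\<^esub> m = \<zero>\<^bsub>M\<^esub>" if r: "r \<in> irr [^]\<^bsub>ideals_set R'\<^esub> (3 * k)" for r
  proof -
    obtain f where f: "r = cls f" "f \<in> high_degree (3 * k)" using r irr_power_subset by blast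
    have "\<forall>m\<in>kys f. k \<le> lkp m iU \<or> k \<le> lkp m iV \<or> k \<le> lkp m iW"
    proof
      fix m assume "m \<in> kys f"
      then have "3 * k \<le> wdeg m" using f(2) by (auto simp: high_degree_def)
      then show "k \<le> lkp m iU \<or> k \<le> lkp m iV \<or> k \<le> lkp m iW" unfolding wdeg_def by linarith
    qed
    then obtain a b c where "f = Var iU ^ k * a + Var iV ^ k * b + Var iW ^ k * c"
      unfolding monomial_ideal_iff[symmetric] by blast
    then have "f = a * Var iU ^ k + b * Var iV ^ k + c * Var iW ^ k" by (simp add: mult.commute)
    then show ?thesis using k by (simp add: f(1) act_add act_mult flip: act_def)
  qed
  then show "m \<in> torsion_part R' irr M" unfolding torsion_part_def by auto
qed

lemma torsion_carrier: "m \<in> torsion \<Longrightarrow> m \<in> carrier M"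
  by (simp add: torsion_def)

lemma torsion_zero: "\<zero>\<^bsub>M\<^esub> \<in> torsion"
  by (simp add: torsion_def loc_eq_refl)

lemma torsion_plus: "m \<in> torsion \<Longrightarrow> m' \<in> torsion \<Longrightarrow> m \<oplus>\<^bsub>M\<^esub> m' \<in> torsion"
  unfolding torsion_def using loc_eq_add[of _ m "\<zero>\<^bsub>M\<^esub>" m' "\<zero>\<^bsub>M\<^esub>"] by auto

lemma torsion_act: "m \<in> torsion \<Longrightarrow> act M f m \<in> torsion"
  unfolding torsion_def using loc_eq_act[of _ m "\<zero>\<^bsub>M\<^esub>" f] by auto

end

section \<open>The cohomology computed from an arbitrary graded injective resolution\<close>

locale R'_resolution =
  fixes e :: "zpoly set \<Rightarrow> 'm" and E :: "nat \<Rightarrow> (zpoly set, 'm) module"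
    and C :: "nat \<Rightarrow> int \<Rightarrow> 'm set" and \<delta> :: "nat \<Rightarrow> 'm \<Rightarrow> 'm"
  assumes resolution: "graded_injective_resolution R' R'_part (regular_module R') R'_part e E C \<delta>"
begin

sublocale E: R'_graded_injective "E i" "C i" for i
proof -
  have inj: "graded_injective R' R'_part (E i) (C i)"
    using resolution unfolding graded_injective_resolution_def by blast
  then interpret graded_module R' R'_part "E i" "C i" unfolding graded_injective_def by blast
  show "R'_graded_injective (E i) (C i)" by unfold_locales (rule inj)
qed

sublocale D: R'_graded_hom "E i" "C i" "E (Suc i)" "C (Suc i)" "\<delta> i" for i
  using resolution unfolding graded_injective_resolution_def by unfold_locales blast

lemma image_\<delta>: "\<delta> i ` carrier (E i) = {x \<in> carrier (E (Suc i)). \<delta> (Suc i) x = \<zero>\<^bsub>E (Suc (Suc i))\<^esub>}"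
  using resolution unfolding graded_injective_resolution_def a_kernel_def' by blast

sublocale P: exact_pair "E i" "C i" "\<delta> i" "E (Suc i)" "C (Suc i)" "\<delta> (Suc i)" "E (Suc (Suc i))" "C (Suc (Suc i))" for i
proof unfold_locales
  show "\<delta> (Suc i) (\<delta> i y) = \<zero>\<^bsub>E (Suc (Suc i))\<^esub>" if "y \<in> carrier (E i)" for y
    using image_\<delta>[of i] that by blast
  show "\<exists>y\<in>carrier (E i). \<delta> i y = x" if "x \<in> carrier (E (Suc i))" "\<delta> (Suc i) x = \<zero>\<^bsub>E (Suc (Suc i))\<^esub>" for x
  proof -
    have "x \<in> \<delta> i ` carrier (E i)" using that by (simp add: image_\<delta>)
    then show ?thesis by blast
  qed
qed

abbreviation "H \<equiv> H3 E C \<delta>"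

definition aug :: "zpoly \<Rightarrow> 'm" where "aug s = e (cls s)"

lemma regular_module_simps:
  "carrier (regular_module R') = carrier R'" "add (regular_module R') = add R'"
  "module.smult (regular_module R') = monoid.mult R'" "ring.zero (regular_module R') = \<zero>\<^bsub>R'\<^esub>"
  by (simp_all add: regular_module_def)

lemma augmentation: "R'_graded_hom (regular_module R') R'_part (E 0) (C 0) e"
proof -
  interpret graded_module R' R'_part "regular_module R'" R'_part
    using resolution unfolding graded_injective_resolution_def by blast
  show ?thesis
    using resolution unfolding graded_injective_resolution_def by unfold_locales blast
qed

lemma image_e: "e ` carrier R' = {x \<in> carrier (E 0). \<delta> 0 x = \<zero>\<^bsub>E 1\<^esub>}"
  using resolution unfolding graded_injective_resolution_def a_kernel_def' regular_module_simps by blast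

lemma inj_e: "inj_on e (carrier R')"
  using resolution unfolding graded_injective_resolution_def regular_module_simps by blast

sublocale chase "E 0" "E (Suc 0)" "E (Suc (Suc 0))" "E (Suc (Suc (Suc 0)))"
  "C 0" "C (Suc 0)" "C (Suc (Suc 0))" "C (Suc (Suc (Suc 0)))" "\<delta> 0" "\<delta> (Suc 0)" "\<delta> (Suc (Suc 0))" aug
proof unfold_locales
  interpret e: R'_graded_hom "regular_module R'" R'_part "E 0" "C 0" e by (rule augmentation)
  show "aug s \<in> carrier (E 0)" for s
    unfolding aug_def by (rule e.hom_closed) (simp add: regular_module_simps)
  show "aug (s + t) = aug s \<oplus>\<^bsub>E 0\<^esub> aug t" for s t
    using e.hom_add[of "cls s" "cls t"] by (simp add: aug_def regular_module_simps cls_add)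
  show "aug (r * s) = act (E 0) r (aug s)" for r s
    using e.hom_act[of "cls s" r] by (simp add: aug_def act_def regular_module_simps cls_mult)
  show "aug s \<in> C 0 n" if "s \<in> zpoly_part n" for s n
    unfolding aug_def using that by (intro e.hom_part) (auto simp: R'_part_def)
  show "hyp dvd s - t" if "aug s = aug t" for s t
    using inj_onD[OF inj_e, of "cls s" "cls t"] that by (simp add: aug_def cls_eq_iff)
  show "\<delta> 0 (aug s) = \<zero>\<^bsub>E (Suc 0)\<^esub>" for s
    using image_e by (auto simp: aug_def)
  show "\<exists>s. aug s = x" if "x \<in> carrier (E 0)" "\<delta> 0 x = \<zero>\<^bsub>E (Suc 0)\<^esub>" for x
  proof -
    have "x \<in> e ` carrier R'" using that by (simp add: image_e)
    then show ?thesis by (auto simp: aug_def carrier_R')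
  qed
  show "\<exists>s\<in>zpoly_part n. aug s = x" if x: "x \<in> C 0 n" "\<delta> 0 x = \<zero>\<^bsub>E (Suc 0)\<^esub>" for x n
  proof -
    have "x \<in> e ` carrier R'" using image_e x E.part_carrier by auto
    then obtain y where "y \<in> carrier R'" "e y = x" by blast
    then obtain y' where "y' \<in> R'_part n" "e y' = x"
      using e.homogeneous_preimage[of y n] x by (auto simp: regular_module_simps)
    then show ?thesis by (auto simp: R'_part_def aug_def)
  qed
qed

abbreviation "E3 \<equiv> E (Suc (Suc (Suc 0)))"
abbreviation "C3 \<equiv> C (Suc (Suc (Suc 0)))"

definition cocycles :: "'m set" where "cocycles = torsion_cocycles R' irr E \<delta> 3"
definition coboundaries :: "'m set" where "coboundaries = torsion_coboundaries R' irr E \<delta> 3"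

text \<open>Exactness of the resolution turns the cocycle condition into the existence of a
  preimage, which is the form the chase starts from.\<close>

lemma cocycles_iff:
  "m \<in> cocycles \<longleftrightarrow> m \<in> E.torsion (Suc (Suc (Suc 0))) \<and> (\<exists>a\<in>carrier (E (Suc (Suc 0))). \<delta> (Suc (Suc 0)) a = m)"
proof -
  have "m \<in> cocycles \<longleftrightarrow> m \<in> E.torsion (Suc (Suc (Suc 0))) \<and> \<delta> (Suc (Suc (Suc 0))) m = \<zero>\<^bsub>E (Suc (Suc (Suc (Suc 0))))\<^esub>"
    by (simp add: cocycles_def torsion_cocycles_def E.torsion_part_eq eval_nat_numeral)
  then show ?thesis
    using P.exact[of m "Suc (Suc 0)"] P.complex[of _ "Suc (Suc 0)"] E.torsion_carrier by blast
qed

lemma coboundaries_eq: "coboundaries = \<delta> (Suc (Suc 0)) ` E.torsion (Suc (Suc 0))"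
  by (simp add: coboundaries_def E.torsion_part_eq eval_nat_numeral)

lemma coboundaries_carrier: "b \<in> coboundaries \<Longrightarrow> b \<in> carrier E3"
  by (auto simp: coboundaries_eq E.torsion_carrier)

lemma coboundaries_zero: "\<zero>\<^bsub>E3\<^esub> \<in> coboundaries"
  unfolding coboundaries_eq by (rule image_eqI[OF _ E.torsion_zero]) simp

lemma coboundaries_plus: "b \<in> coboundaries \<Longrightarrow> b' \<in> coboundaries \<Longrightarrow> b \<oplus>\<^bsub>E3\<^esub> b' \<in> coboundaries"
  unfolding coboundaries_eq using E.torsion_plus
  by (auto simp: E.torsion_carrier simp flip: D.hom_add)

lemma coboundaries_act: "b \<in> coboundaries \<Longrightarrow> act E3 f b \<in> coboundaries"
  unfolding coboundaries_eq using E.torsion_act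
  by (auto simp: E.torsion_carrier simp flip: D.hom_act)

lemma coboundaries_minus: "b \<in> coboundaries \<Longrightarrow> \<ominus>\<^bsub>E3\<^esub> b \<in> coboundaries"
  using coboundaries_act[of b "-1"] coboundaries_carrier[of b] by (simp add: E.act_neg)

lemma cocycles_carrier: "m \<in> cocycles \<Longrightarrow> m \<in> carrier E3"
  by (simp add: cocycles_iff E.torsion_carrier)

lemma cocycles_zero: "\<zero>\<^bsub>E3\<^esub> \<in> cocycles"
  unfolding cocycles_iff using E.torsion_zero
  by (auto intro!: bexI[of _ "\<zero>\<^bsub>E (Suc (Suc 0))\<^esub>"])

lemma cocycles_plus: "m \<in> cocycles \<Longrightarrow> m' \<in> cocycles \<Longrightarrow> m \<oplus>\<^bsub>E3\<^esub> m' \<in> cocycles"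
  unfolding cocycles_iff using E.torsion_plus D.hom_add E.M.add.m_closed by metis

lemma cocycles_act: "m \<in> cocycles \<Longrightarrow> act E3 f m \<in> cocycles"
  unfolding cocycles_iff using E.torsion_act D.hom_act E.act_closed by metis

definition coset :: "'m \<Rightarrow> 'm set" where "coset m = (\<lambda>b. b \<oplus>\<^bsub>E3\<^esub> m) ` coboundaries"

lemma a_r_coset_eq: "coboundaries +>\<^bsub>E3\<^esub> m = coset m"
  by (auto simp: a_r_coset_def' coset_def)

lemma coset_shift:
  assumes b: "b \<in> coboundaries" and m: "m \<in> carrier E3"
  shows "coset (b \<oplus>\<^bsub>E3\<^esub> m) = coset m"
proof (intro equalityI subsetI)
  fix x assume "x \<in> coset (b \<oplus>\<^bsub>E3\<^esub> m)"
  then obtain b' where b': "b' \<in> coboundaries" "x = b' \<oplus>\<^bsub>E3\<^esub> (b \<oplus>\<^bsub>E3\<^esub> m)" by (auto simp: coset_def)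
  then have "x = (b' \<oplus>\<^bsub>E3\<^esub> b) \<oplus>\<^bsub>E3\<^esub> m" using b m coboundaries_carrier by (simp add: E.M.a_assoc)
  then show "x \<in> coset m" using coboundaries_plus[OF b'(1) b] by (auto simp: coset_def)
next
  fix x assume "x \<in> coset m"
  then obtain b' where b': "b' \<in> coboundaries" "x = b' \<oplus>\<^bsub>E3\<^esub> m" by (auto simp: coset_def)
  then have "x = (b' \<oplus>\<^bsub>E3\<^esub> \<ominus>\<^bsub>E3\<^esub> b) \<oplus>\<^bsub>E3\<^esub> (b \<oplus>\<^bsub>E3\<^esub> m)"
    using b m coboundaries_carrier by (simp add: E.M.a_assoc E.M.r_neg1)
  then show "x \<in> coset (b \<oplus>\<^bsub>E3\<^esub> m)"
    using coboundaries_plus[OF b'(1) coboundaries_minus[OF b]] by (auto simp: coset_def)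
qed

lemma coset_zero: "coset \<zero>\<^bsub>E3\<^esub> = coboundaries"
  using coboundaries_carrier by (auto simp: coset_def image_iff)

lemma coset_eq_coboundaries_iff:
  assumes "m \<in> carrier E3"
  shows "coset m = coboundaries \<longleftrightarrow> m \<in> coboundaries"
proof
  assume "coset m = coboundaries"
  moreover have "m \<in> coset m"
    unfolding coset_def using assms by (intro image_eqI[OF _ coboundaries_zero]) simp
  ultimately show "m \<in> coboundaries" by simp
next
  assume "m \<in> coboundaries"
  then show "coset m = coboundaries"
    using coset_shift[of m "\<zero>\<^bsub>E3\<^esub>"] assms by (simp add: coset_zero)
qed

lemma coset_plus:
  assumes m: "m \<in> carrier E3" "m' \<in> carrier E3"
  shows "coset m <+>\<^bsub>E3\<^esub> coset m' = coset (m \<oplus>\<^bsub>E3\<^esub> m')"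
proof (intro equalityI subsetI)
  fix x assume "x \<in> coset m <+>\<^bsub>E3\<^esub> coset m'"
  then obtain b b' where b: "b \<in> coboundaries" "b' \<in> coboundaries" "x = (b \<oplus>\<^bsub>E3\<^esub> m) \<oplus>\<^bsub>E3\<^esub> (b' \<oplus>\<^bsub>E3\<^esub> m')"
    by (auto simp: set_add_def' coset_def)
  then have "x = (b \<oplus>\<^bsub>E3\<^esub> b') \<oplus>\<^bsub>E3\<^esub> (m \<oplus>\<^bsub>E3\<^esub> m')"
    using m coboundaries_carrier by (simp add: E.M.a_ac)
  then show "x \<in> coset (m \<oplus>\<^bsub>E3\<^esub> m')" using b coboundaries_plus by (auto simp: coset_def)
next
  fix x assume "x \<in> coset (m \<oplus>\<^bsub>E3\<^esub> m')"
  then obtain b where b: "b \<in> coboundaries" "x = b \<oplus>\<^bsub>E3\<^esub> (m \<oplus>\<^bsub>E3\<^esub> m')" by (auto simp: coset_def)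
  then have "x = (b \<oplus>\<^bsub>E3\<^esub> m) \<oplus>\<^bsub>E3\<^esub> (\<zero>\<^bsub>E3\<^esub> \<oplus>\<^bsub>E3\<^esub> m')"
    using m coboundaries_carrier by (simp add: E.M.a_ac)
  then show "x \<in> coset m <+>\<^bsub>E3\<^esub> coset m'"
    unfolding set_add_def' coset_def using b coboundaries_zero by blast
qed

lemma H3_simps:
  "carrier (H n) = coset ` (cocycles \<inter> C3 n)"
  "ring.zero (H n) = coboundaries"
  "add (H n) = set_add E3"
  "module.smult (H n) = (\<lambda>r x. \<Union>m\<in>x. coset (r \<odot>\<^bsub>E3\<^esub> m))"
proof -
  have 3: "(3::nat) = Suc (Suc (Suc 0))" by simp
  have "a_r_coset (E3\<lparr>carrier := c\<rparr>) = a_r_coset E3" "set_add (E3\<lparr>carrier := c\<rparr>) = set_add E3" for c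
    by (simp_all add: a_r_coset_def' set_add_def' fun_eq_iff)
  then show "carrier (H n) = coset ` (cocycles \<inter> C3 n)"
  "ring.zero (H n) = coboundaries"
  "add (H n) = set_add E3"
  "module.smult (H n) = (\<lambda>r x. \<Union>m\<in>x. coset (r \<odot>\<^bsub>E3\<^esub> m))"
    unfolding H3_def local_cohomology_component_def local_cohomology_def quotient_module_def
      cocycles_def[symmetric] coboundaries_def[symmetric]
    by (auto simp: 3 a_r_coset_eq simp del: torsion_coboundaries.simps)
qed

lemma H3_smult:
  assumes "m \<in> carrier E3"
  shows "cls f \<odot>\<^bsub>H n\<^esub> coset m = coset (act E3 f m)"
proof -
  have "coset (cls f \<odot>\<^bsub>E3\<^esub> x) = coset (act E3 f m)" if x: "x \<in> coset m" for x
  proof -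
    obtain b where b: "b \<in> coboundaries" "x = b \<oplus>\<^bsub>E3\<^esub> m" using x by (auto simp: coset_def)
    have "cls f \<odot>\<^bsub>E3\<^esub> x = act E3 f b \<oplus>\<^bsub>E3\<^esub> act E3 f m"
      using b assms coboundaries_carrier by (simp add: E.act_plus flip: act_def)
    then show ?thesis using coset_shift[OF coboundaries_act[OF b(1)]] assms by simp
  qed
  moreover have "coset m \<noteq> {}" using coboundaries_zero by (auto simp: coset_def)
  ultimately show ?thesis unfolding H3_simps by simp
qed

lemma H3_abelian_group: "abelian_group (H n)"
proof -
  have mem: "x \<in> carrier (H n) \<longleftrightarrow> (\<exists>m. m \<in> cocycles \<and> m \<in> C3 n \<and> m \<in> carrier E3 \<and> x = coset m)" for x
    using cocycles_carrier by (auto simp: H3_simps)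
  show ?thesis
  proof (rule abelian_groupI)
    show "x \<oplus>\<^bsub>H n\<^esub> y \<in> carrier (H n)"
      if "x \<in> carrier (H n)" "y \<in> carrier (H n)" for x y
      using that unfolding mem H3_simps(3)
      by (metis coset_plus cocycles_plus E.part_add E.M.add.m_closed)
    show "\<zero>\<^bsub>H n\<^esub> \<in> carrier (H n)"
      unfolding mem H3_simps(2) using cocycles_zero coset_zero E.part_zero E.M.zero_closed by metis
    show "\<exists>y\<in>carrier (H n). y \<oplus>\<^bsub>H n\<^esub> x = \<zero>\<^bsub>H n\<^esub>"
      if x: "x \<in> carrier (H n)" for x
    proof -
      obtain m where m: "m \<in> cocycles" "m \<in> C3 n" "m \<in> carrier E3" "x = coset m" using x mem by blast
      have "\<ominus>\<^bsub>E3\<^esub> m \<in> cocycles" using cocycles_act[OF m(1), of "-1"] m(3) by (simp add: E.act_neg)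
      then have "coset (\<ominus>\<^bsub>E3\<^esub> m) \<in> carrier (H n)"
        unfolding mem using m(2,3) E.part_minus E.M.a_inv_closed by blast
      moreover have "coset (\<ominus>\<^bsub>E3\<^esub> m) \<oplus>\<^bsub>H n\<^esub> x = \<zero>\<^bsub>H n\<^esub>"
        using m by (simp add: H3_simps coset_plus E.M.l_neg coset_zero)
      ultimately show ?thesis by blast
    qed
    fix x y z assume "x \<in> carrier (H n)" "y \<in> carrier (H n)" "z \<in> carrier (H n)"
    then obtain m m' m'' where "m \<in> carrier E3" "m' \<in> carrier E3" "m'' \<in> carrier E3"
      "x = coset m" "y = coset m'" "z = coset m''" unfolding mem by blast
    then show "x \<oplus>\<^bsub>H n\<^esub> y \<oplus>\<^bsub>H n\<^esub> z = x \<oplus>\<^bsub>H n\<^esub> (y \<oplus>\<^bsub>H n\<^esub> z)"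
      "x \<oplus>\<^bsub>H n\<^esub> y = y \<oplus>\<^bsub>H n\<^esub> x" "\<zero>\<^bsub>H n\<^esub> \<oplus>\<^bsub>H n\<^esub> x = x"
      by (simp_all add: H3_simps coset_plus E.M.a_ac flip: coset_zero)
  qed
qed

text \<open>Lets the associated primes over the integers be read off from the same annihilators as
  those over \<open>R'0\<close>.\<close>

lemma H3_int_pow:
  fixes c :: int
  assumes x: "x \<in> carrier (H n)"
  shows "[c] \<cdot>\<^bsub>H n\<^esub> x = cls (of_int c) \<odot>\<^bsub>H n\<^esub> x"
proof -
  interpret H: abelian_group "H n" by (rule H3_abelian_group)
  obtain m where m: "x = coset m" "m \<in> carrier E3" and m': "m \<in> cocycles" "m \<in> C3 n"
    using x cocycles_carrier by (auto simp: H3_simps)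
  have nat: "[k] \<cdot>\<^bsub>H n\<^esub> x = coset (act E3 (of_nat k) m)" for k :: nat
  proof (induction k)
    case 0
    show ?case using m by (simp add: H3_simps coset_zero)
  next
    case (Suc k)
    have "[Suc k] \<cdot>\<^bsub>H n\<^esub> x = [k] \<cdot>\<^bsub>H n\<^esub> x \<oplus>\<^bsub>H n\<^esub> x" using x by simp
    also have "\<dots> = coset (act E3 (of_nat k) m \<oplus>\<^bsub>E3\<^esub> act E3 1 m)"
      unfolding Suc using m by (simp add: H3_simps coset_plus)
    also have "\<dots> = coset (act E3 (of_nat (Suc k)) m)"
      using m by (subst E.act_add[symmetric]) (simp_all add: add.commute)
    finally show ?case .
  qed
  show ?thesis
  proof (cases "c \<ge> 0")
    case True
    then show ?thesis using m by (simp add: add_pow_int_ge nat[unfolded m(1)] H3_smult of_nat_nat)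
  next
    case False
    have "coset (act E3 (of_int c) m) \<oplus>\<^bsub>H n\<^esub> coset (act E3 (of_nat (nat (- c))) m) = \<zero>\<^bsub>H n\<^esub>"
      using m False by (simp add: H3_simps coset_plus of_nat_nat coset_zero flip: E.act_add)
    moreover have "coset (act E3 (of_nat (nat (- c))) m) \<in> carrier (H n)"
      using H.add.nat_pow_closed[OF x] nat by metis
    moreover have "coset (act E3 (of_int c) m) \<in> carrier (H n)"
      unfolding H3_simps using m' by (intro imageI IntI cocycles_act E.part_act[OF zpoly_part_of_int]) auto
    ultimately show ?thesis
      using m False H.minus_equality by (simp add: add_pow_int_lt nat[unfolded m(1)] H3_smult)
  qed
qed

text \<open>Each class is represented by a fraction, compatibly with scalars of degree 0. A class
  vanishes if and only if its representative has a torsion lift, which the chase identifies with the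
  vanishing of the fraction.\<close>

lemma H3_annihilators:
  "x \<in> carrier (H n) \<Longrightarrow> \<exists>s k. s \<in> zpoly_part (3 * int k + n) \<and>
     (\<forall>r\<in>zpoly_part 0. cls r \<odot>\<^bsub>H n\<^esub> x = \<zero>\<^bsub>H n\<^esub> \<longleftrightarrow> null_frac (r * s) k)"
  "s \<in> zpoly_part (3 * int k + n) \<Longrightarrow> \<exists>x\<in>carrier (H n).
     (\<forall>r\<in>zpoly_part 0. cls r \<odot>\<^bsub>H n\<^esub> x = \<zero>\<^bsub>H n\<^esub> \<longleftrightarrow> null_frac (r * s) k)"
proof -
  have key: "cls r \<odot>\<^bsub>H n\<^esub> coset m = \<zero>\<^bsub>H n\<^esub> \<longleftrightarrow> null_frac (r * s) k"
    if rep: "represents n m s k" and m: "m \<in> cocycles" and r: "r \<in> zpoly_part 0" for m s k r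
  proof -
    have mc: "m \<in> carrier E3" using m by (rule cocycles_carrier)
    have "cls r \<odot>\<^bsub>H n\<^esub> coset m = \<zero>\<^bsub>H n\<^esub> \<longleftrightarrow> act E3 r m \<in> coboundaries"
      using mc by (simp add: H3_smult H3_simps(2) coset_eq_coboundaries_iff)
    also have "\<dots> \<longleftrightarrow> null_frac (r * s) k"
      using represents_of_null_frac[OF represents_act[OF rep r]] null_frac_of_represents[OF represents_act[OF rep r]]
      unfolding coboundaries_eq E.torsion_def by blast
    finally show ?thesis .
  qed
  show "\<exists>s k. s \<in> zpoly_part (3 * int k + n) \<and>
     (\<forall>r\<in>zpoly_part 0. cls r \<odot>\<^bsub>H n\<^esub> x = \<zero>\<^bsub>H n\<^esub> \<longleftrightarrow> null_frac (r * s) k)"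
    if x: "x \<in> carrier (H n)"
  proof -
    obtain m where m: "m \<in> cocycles" "m \<in> C3 n" "x = coset m" using x by (auto simp: H3_simps)
    then obtain s k where sk: "represents n m s k"
      using represents_exists[OF m(2)] unfolding cocycles_iff E.torsion_def by auto
    then show ?thesis using key[OF sk m(1)] m(3) unfolding represents_def by blast
  qed
  show "\<exists>x\<in>carrier (H n).
     (\<forall>r\<in>zpoly_part 0. cls r \<odot>\<^bsub>H n\<^esub> x = \<zero>\<^bsub>H n\<^esub> \<longleftrightarrow> null_frac (r * s) k)"
    if s: "s \<in> zpoly_part (3 * int k + n)"
  proof -
    obtain m where m: "m \<in> C3 n" "represents n m s k" "m \<in> E.torsion (Suc (Suc (Suc 0)))"
      using represents_surjective[OF s] E.part_carrier unfolding E.torsion_def by blast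
    moreover have "\<exists>a\<in>carrier (E (Suc (Suc 0))). \<delta> (Suc (Suc 0)) a = m"
      using m(2) E.part_carrier unfolding represents_def by metis
    ultimately have "m \<in> cocycles" unfolding cocycles_iff by blast
    then show ?thesis using key[OF m(2)] m(1) by (auto simp: H3_simps)
  qed
qed

lemma Ass_R'0_H3:
  "Ass R'0 (H n) = {P. primeideal P R'0 \<and>
     (\<exists>s k. s \<in> zpoly_part (3 * int k + n) \<and> P = cls ` {r \<in> zpoly_part 0. null_frac (r * s) k})}"
proof -
  have *: "{r \<in> carrier R'0. r \<odot>\<^bsub>H n\<^esub> x = \<zero>\<^bsub>H n\<^esub>} = cls ` {r \<in> zpoly_part 0. null_frac (r * s) k}"
    if "\<forall>r\<in>zpoly_part 0. cls r \<odot>\<^bsub>H n\<^esub> x = \<zero>\<^bsub>H n\<^esub> \<longleftrightarrow> null_frac (r * s) k" for x s k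
    using that by (auto simp: R'0_def degree_zero_ring_def R'_part_def)
  have "(\<exists>x\<in>carrier (H n). P = {r \<in> carrier R'0. r \<odot>\<^bsub>H n\<^esub> x = \<zero>\<^bsub>H n\<^esub>}) \<longleftrightarrow>
      (\<exists>s k. s \<in> zpoly_part (3 * int k + n) \<and> P = cls ` {r \<in> zpoly_part 0. null_frac (r * s) k})" (is "?L \<longleftrightarrow> ?R") for P
  proof
    assume ?L
    then obtain x where x: "x \<in> carrier (H n)" "P = {r \<in> carrier R'0. r \<odot>\<^bsub>H n\<^esub> x = \<zero>\<^bsub>H n\<^esub>}" by blast
    obtain s k where s: "s \<in> zpoly_part (3 * int k + n)"
      "\<forall>r\<in>zpoly_part 0. cls r \<odot>\<^bsub>H n\<^esub> x = \<zero>\<^bsub>H n\<^esub> \<longleftrightarrow> null_frac (r * s) k"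
      using H3_annihilators(1)[OF x(1)] by blast
    show ?R unfolding x(2) *[OF s(2)] using s(1) by (iprover intro: exI conjI refl)
  next
    assume ?R
    then obtain s k where s: "s \<in> zpoly_part (3 * int k + n)" "P = cls ` {r \<in> zpoly_part 0. null_frac (r * s) k}" by blast
    obtain x where x: "x \<in> carrier (H n)"
      "\<forall>r\<in>zpoly_part 0. cls r \<odot>\<^bsub>H n\<^esub> x = \<zero>\<^bsub>H n\<^esub> \<longleftrightarrow> null_frac (r * s) k"
      using H3_annihilators(2)[OF s(1)] by blast
    show ?L unfolding s(2) *[OF x(2), symmetric] by (rule bexI[OF refl x(1)])
  qed
  then show ?thesis unfolding Ass_def by (simp only:)
qed

lemma Ass_int_H3:
  "Ass \<Z> (int_module (H n)) = {P. primeideal P \<Z> \<and>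
     (\<exists>s k. s \<in> zpoly_part (3 * int k + n) \<and> P = {c. null_frac (of_int c * s) k})}"
proof -
  let ?I = "int_module (H n)"
  have c: "carrier ?I = carrier (H n)" by (simp add: int_module_def)
  have *: "{r \<in> carrier \<Z>. r \<odot>\<^bsub>?I\<^esub> x = \<zero>\<^bsub>?I\<^esub>} = {c. null_frac (of_int c * s) k}"
    if "\<forall>r\<in>zpoly_part 0. cls r \<odot>\<^bsub>H n\<^esub> x = \<zero>\<^bsub>H n\<^esub> \<longleftrightarrow> null_frac (r * s) k"
      "x \<in> carrier (H n)" for x s k
    using that by (auto simp: int_module_def H3_int_pow)
  have "(\<exists>x\<in>carrier ?I. P = {r \<in> carrier \<Z>. r \<odot>\<^bsub>?I\<^esub> x = \<zero>\<^bsub>?I\<^esub>}) \<longleftrightarrow>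
      (\<exists>s k. s \<in> zpoly_part (3 * int k + n) \<and> P = {c. null_frac (of_int c * s) k})" (is "?L \<longleftrightarrow> ?R") for P
  proof
    assume ?L
    then obtain x where x: "x \<in> carrier (H n)" "P = {r \<in> carrier \<Z>. r \<odot>\<^bsub>?I\<^esub> x = \<zero>\<^bsub>?I\<^esub>}" unfolding c by blast
    obtain s k where s: "s \<in> zpoly_part (3 * int k + n)"
      "\<forall>r\<in>zpoly_part 0. cls r \<odot>\<^bsub>H n\<^esub> x = \<zero>\<^bsub>H n\<^esub> \<longleftrightarrow> null_frac (r * s) k"
      using H3_annihilators(1)[OF x(1)] by blast
    show ?R unfolding x(2) *[OF s(2) x(1)] using s(1) by (iprover intro: exI conjI refl)
  next
    assume ?R
    then obtain s k where s: "s \<in> zpoly_part (3 * int k + n)" "P = {c. null_frac (of_int c * s) k}" by blast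
    obtain x where x: "x \<in> carrier (H n)"
      "\<forall>r\<in>zpoly_part 0. cls r \<odot>\<^bsub>H n\<^esub> x = \<zero>\<^bsub>H n\<^esub> \<longleftrightarrow> null_frac (r * s) k"
      using H3_annihilators(2)[OF s(1)] by blast
    show ?L unfolding s(2) c *[OF x(2,1), symmetric] by (rule bexI[OF refl x(1)])
  qed
  then show ?thesis unfolding Ass_def by (simp only:)
qed

end

section \<open>Associated primes\<close>

text \<open>\<open>hyp\<close> has degree 1 and there are no negative degrees. Hence
  \<open>R'0\<close> is a copy of the polynomial ring in X, Y, Z.\<close>

lemma hyp_dvd_part_0:
  assumes "f \<in> zpoly_part 0" "hyp dvd f"
  shows "f = 0"
proof -
  obtain q where q: "f = hyp * q" using assms(2) ..
  have "f = hpart 0 f" using assms(1) by (simp add: hpart_of_part)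
  also have "\<dots> = 0" unfolding q by (simp add: hpart_mult[OF zpoly_part_hyp] hpart_neg)
  finally show ?thesis .
qed

lemma cls_inj_part_0: "f \<in> zpoly_part 0 \<Longrightarrow> g \<in> zpoly_part 0 \<Longrightarrow> cls f = cls g \<longleftrightarrow> f = g"
  using hyp_dvd_part_0[of "f - g"] by (auto simp: cls_eq_iff zpoly_part_diff)

lemma cls_mem_image_iff: "A \<subseteq> zpoly_part 0 \<Longrightarrow> f \<in> zpoly_part 0 \<Longrightarrow> cls f \<in> cls ` A \<longleftrightarrow> f \<in> A"
  using cls_inj_part_0 by blast

lemma part_0_decompose:
  assumes r: "r \<in> zpoly_part 0"
  obtains r1 r2 r3 where "r = of_int (lkp r 0) + (Var iX * r1 + Var iY * r2 + Var iZ * r3)"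
    "r1 \<in> zpoly_part 0" "r2 \<in> zpoly_part 0" "r3 \<in> zpoly_part 0"
proof -
  define f where "f = r - of_int (lkp r 0)"
  have f: "f \<in> zpoly_part 0" unfolding f_def by (intro zpoly_part_diff r zpoly_part_of_int)
  have l0: "lkp f 0 = 0" by (simp add: f_def lookup_minus lookup_of_int)
  have keys: "1 \<le> lkp m iX \<or> 1 \<le> lkp m iY \<or> 1 \<le> lkp m iZ" if "m \<in> kys f" for m
  proof (rule ccontr)
    assume "\<not> ?thesis"
    moreover have "wdeg m = 0" using that f by (auto simp: zpoly_part_iff)
    ultimately have "m = 0" by (intro indet_fun_eqI) (auto simp: wdeg_def)
    then show False using that l0 by (simp add: in_keys_iff)
  qed
  let ?P = "\<lambda>m. 1 \<le> lkp m iX" and ?Q = "\<lambda>m. 1 \<le> lkp m iY"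
  let ?f1 = "restr (\<lambda>m. \<not> ?P m) f"
  have 1: "f = restr ?P f + ?f1" by (rule restr_split)
  have 2: "?f1 = restr ?Q ?f1 + restr (\<lambda>m. \<not> ?Q m) ?f1" by (rule restr_split)
  have "Var iX ^ 1 dvd restr ?P f" "Var iY ^ 1 dvd restr ?Q ?f1" "Var iZ ^ 1 dvd restr (\<lambda>m. \<not> ?Q m) ?f1"
    unfolding Var_power_dvd_iff using keys by (auto simp: keys_restr)
  then obtain a b c where "restr ?P f = Var iX * a" "restr ?Q ?f1 = Var iY * b"
    "restr (\<lambda>m. \<not> ?Q m) ?f1 = Var iZ * c" unfolding power_one_right by (elim dvdE)
  then have abc: "f = Var iX * a + Var iY * b + Var iZ * c" using 1 2 by (metis add.assoc)
  have "f = hpart 0 f" using f by (simp add: hpart_of_part)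
  also have "\<dots> = Var iX * hpart 0 a + Var iY * hpart 0 b + Var iZ * hpart 0 c"
    unfolding abc hpart_add
    by (simp add: hpart_mult[OF zpoly_part_Vars(4)] hpart_mult[OF zpoly_part_Vars(5)] hpart_mult[OF zpoly_part_Vars(6)])
  finally have "r = of_int (lkp r 0) + (Var iX * hpart 0 a + Var iY * hpart 0 b + Var iZ * hpart 0 c)"
    unfolding f_def by (simp add: algebra_simps)
  then show ?thesis by (rule that) simp_all
qed

lemma lookup_0_mult:
  assumes "f \<in> zpoly_part 0"
  shows "lkp (f * g) 0 = lkp f 0 * lkp g 0"
proof -
  obtain a b c where f: "f = of_int (lkp f 0) + (Var iX * a + Var iY * b + Var iZ * c)"
    using part_0_decompose[OF assms] .
  have "f * g = of_int (lkp f 0) * g + (Var iX * (a * g) + Var iY * (b * g) + Var iZ * (c * g))"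
    by (subst f) (simp add: distrib_right mult.assoc)
  then show ?thesis by (simp add: lookup_add lookup_of_int_mult lookup_Var_mult)
qed

lemma carrier_R'0: "carrier R'0 = cls ` zpoly_part 0"
  by (simp add: R'0_def degree_zero_ring_def R'_part_def)

lemma R'0_simps:
  "monoid.mult R'0 = monoid.mult R'" "add R'0 = add R'" "\<one>\<^bsub>R'0\<^esub> = cls 1" "\<zero>\<^bsub>R'0\<^esub> = cls 0"
  by (simp_all add: R'0_def degree_zero_ring_def cls_one cls_zero)

lemma cring_R'0: "cring R'0"
proof -
  interpret R': cring R' by (rule cring_R')
  have "subring (cls ` zpoly_part 0) R'"
  proof (rule R'.subringI)
    show "\<one>\<^bsub>R'\<^esub> \<in> cls ` zpoly_part 0" by (auto simp: cls_one)
  qed (auto simp: cls_uminus cls_mult cls_add intro!: imageI zpoly_part_uminus zpoly_part_add zpoly_part_mult'[of _ 0 _ 0])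
  then have "subcring (cls ` zpoly_part 0) R'" by (rule R'.subcringI')
  then have "cring (R'\<lparr>carrier := cls ` zpoly_part 0\<rparr>)" by (subst (asm) R'.subcring_iff) auto
  then show ?thesis by (simp add: R'0_def degree_zero_ring_def R'_part_def)
qed

text \<open>The ideal \<open>(q, X, Y, Z)\<close>, as the preimage of the multiples of
  \<open>q\<close> under evaluation at \<open>X = Y = Z = 0\<close>. The value \<open>q = 0\<close>
  gives \<open>(X, Y, Z)\<close>, so both kinds of primes are treated together.\<close>

definition residue_ideal :: "int \<Rightarrow> zpoly set set" where
  "residue_ideal q = cls ` {r \<in> zpoly_part 0. q dvd lkp r 0}"

lemma cls_in_residue_ideal_iff: "f \<in> zpoly_part 0 \<Longrightarrow> cls f \<in> residue_ideal q \<longleftrightarrow> q dvd lkp f 0"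
  unfolding residue_ideal_def by (subst cls_mem_image_iff) auto

lemma ideal_residue_ideal: "ideal (residue_ideal q) R'0"
proof -
  interpret R0: cring R'0 by (rule cring_R'0)
  show ?thesis
  proof (rule idealI[OF R0.ring_axioms])
    show "subgroup (residue_ideal q) (add_monoid R'0)"
    proof (rule R0.add.subgroupI)
      show "residue_ideal q \<subseteq> carrier R'0" by (auto simp: residue_ideal_def carrier_R'0)
      show "residue_ideal q \<noteq> {}" using cls_in_residue_ideal_iff[of 0 q] by auto
      fix a assume "a \<in> residue_ideal q"
      then obtain f where f: "f \<in> zpoly_part 0" "q dvd lkp f 0" "a = cls f" by (auto simp: residue_ideal_def)
      have "cls (- f) \<oplus>\<^bsub>R'0\<^esub> cls f = \<zero>\<^bsub>R'0\<^esub>" by (simp add: R'0_simps cls_add)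
      then have "\<ominus>\<^bsub>R'0\<^esub> a = cls (- f)"
        using f by (intro R0.minus_equality) (auto simp: carrier_R'0 zpoly_part_uminus)
      then show "\<ominus>\<^bsub>R'0\<^esub> a \<in> residue_ideal q" using f by (simp add: cls_in_residue_ideal_iff zpoly_part_uminus)
      fix b assume "b \<in> residue_ideal q"
      then obtain g where "g \<in> zpoly_part 0" "q dvd lkp g 0" "b = cls g" by (auto simp: residue_ideal_def)
      then show "a \<oplus>\<^bsub>R'0\<^esub> b \<in> residue_ideal q"
        using f by (simp add: R'0_simps cls_add cls_in_residue_ideal_iff zpoly_part_add lookup_add)
    qed
    fix a x assume "a \<in> residue_ideal q" "x \<in> carrier R'0"
    then obtain f g where fg: "f \<in> zpoly_part 0" "q dvd lkp f 0" "a = cls f" "g \<in> zpoly_part 0" "x = cls g"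
      by (auto simp: residue_ideal_def carrier_R'0)
    have "f * g \<in> zpoly_part 0" using zpoly_part_mult[OF fg(1,4)] by simp
    then show "x \<otimes>\<^bsub>R'0\<^esub> a \<in> residue_ideal q" "a \<otimes>\<^bsub>R'0\<^esub> x \<in> residue_ideal q"
      using fg by (simp_all add: R'0_simps cls_mult mult.commute[of g] cls_in_residue_ideal_iff lookup_0_mult)
  qed
qed

lemma primeideal_residue_ideal:
  assumes "q = 0 \<or> Factorial_Ring.prime (q :: int)"
  shows "primeideal (residue_ideal q) R'0"
proof (rule primeidealI[OF ideal_residue_ideal cring_R'0])
  have "\<not> q dvd 1" using assms by (auto simp: not_prime_unit)
  then have "cls 1 \<notin> residue_ideal q" by (simp add: cls_in_residue_ideal_iff)
  moreover have "cls 1 \<in> carrier R'0" by (auto simp: carrier_R'0)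
  ultimately show "carrier R'0 \<noteq> residue_ideal q" by blast
next
  fix a b assume "a \<in> carrier R'0" "b \<in> carrier R'0" and ab: "a \<otimes>\<^bsub>R'0\<^esub> b \<in> residue_ideal q"
  then obtain f g where fg: "f \<in> zpoly_part 0" "a = cls f" "g \<in> zpoly_part 0" "b = cls g"
    by (auto simp: carrier_R'0)
  have "f * g \<in> zpoly_part 0" using zpoly_part_mult[OF fg(1,3)] by simp
  then have "q dvd lkp f 0 * lkp g 0"
    using ab fg by (simp add: R'0_simps cls_mult cls_in_residue_ideal_iff lookup_0_mult)
  then have "q dvd lkp f 0 \<or> q dvd lkp g 0"
    using assms by (auto simp: prime_dvd_mult_iff)
  then show "a \<in> residue_ideal q \<or> b \<in> residue_ideal q" using fg by (simp add: cls_in_residue_ideal_iff)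
qed

lemma genideal_eq_residue_ideal:
  assumes S: "S \<subseteq> {cls (of_int q), cls (Var iX), cls (Var iY), cls (Var iZ)}"
    "{cls (Var iX), cls (Var iY), cls (Var iZ)} \<subseteq> S" "q \<noteq> 0 \<Longrightarrow> cls (of_int q) \<in> S"
  shows "Idl\<^bsub>R'0\<^esub> S = residue_ideal q"
proof (rule equalityI)
  interpret R0: cring R'0 by (rule cring_R'0)
  have XYZ: "cls (Var v) \<in> residue_ideal q" if "v \<in> {iX, iY, iZ}" for v
  proof -
    have "sng v (1::nat) \<noteq> 0" by (metis lookup_single_eq lookup_zero zero_neq_one)
    then have "lkp (Var v) 0 = 0" by (simp add: Var_def lookup_single when_def)
    moreover have "Var v \<in> zpoly_part 0" using that by auto
    ultimately show ?thesis by (simp add: cls_in_residue_ideal_iff)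
  qed
  have "cls (of_int q) \<in> residue_ideal q"
    by (subst cls_in_residue_ideal_iff) (simp_all add: lookup_of_int)
  then have sub: "S \<subseteq> residue_ideal q" using S(1) XYZ by blast
  then show "Idl\<^bsub>R'0\<^esub> S \<subseteq> residue_ideal q"
    by (rule R0.genideal_minimal[OF ideal_residue_ideal])
  have "S \<subseteq> carrier R'0" using sub by (auto simp: residue_ideal_def carrier_R'0)
  then have "ideal (Idl\<^bsub>R'0\<^esub> S) R'0" and S': "S \<subseteq> Idl\<^bsub>R'0\<^esub> S"
    using R0.genideal_ideal R0.genideal_self by blast+
  interpret I: ideal "Idl\<^bsub>R'0\<^esub> S" R'0 by fact
  show "residue_ideal q \<subseteq> Idl\<^bsub>R'0\<^esub> S"
  proof
    fix x assume "x \<in> residue_ideal q"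
    then obtain r where r: "r \<in> zpoly_part 0" "q dvd lkp r 0" "x = cls r" by (auto simp: residue_ideal_def)
    obtain r1 r2 r3 where d: "r = of_int (lkp r 0) + (Var iX * r1 + Var iY * r2 + Var iZ * r3)"
      "r1 \<in> zpoly_part 0" "r2 \<in> zpoly_part 0" "r3 \<in> zpoly_part 0" by (rule part_0_decompose[OF r(1)])
    have m: "cls (f * g) \<in> Idl\<^bsub>R'0\<^esub> S" if "cls f \<in> Idl\<^bsub>R'0\<^esub> S" "g \<in> zpoly_part 0" for f g
      using I.I_r_closed[OF that(1), of "cls g"] that(2) by (auto simp: carrier_R'0 R'0_simps cls_mult)
    have a: "cls (f + g) \<in> Idl\<^bsub>R'0\<^esub> S" if "cls f \<in> Idl\<^bsub>R'0\<^esub> S" "cls g \<in> Idl\<^bsub>R'0\<^esub> S" for f g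
      using I.a_closed[OF that] by (simp add: R'0_simps cls_add)
    obtain t where t: "lkp r 0 = q * t" using r(2) ..
    have "cls (of_int (lkp r 0)) \<in> Idl\<^bsub>R'0\<^esub> S"
    proof (cases "q = 0")
      case True
      then show ?thesis using I.zero_closed t by (simp add: R'0_simps)
    next
      case False
      then show ?thesis using S(3) S' m[of "of_int q" "of_int t"] by (auto simp: t)
    qed
    moreover have "cls (Var iX * r1) \<in> Idl\<^bsub>R'0\<^esub> S" "cls (Var iY * r2) \<in> Idl\<^bsub>R'0\<^esub> S" "cls (Var iZ * r3) \<in> Idl\<^bsub>R'0\<^esub> S"
      using S(2) S' d by (auto intro!: m)
    ultimately show "x \<in> Idl\<^bsub>R'0\<^esub> S" unfolding r(3) by (subst d(1)) (intro a)
  qed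
qed

lemma ideal_XYZ_eq: "ideal_XYZ = residue_ideal 0"
  unfolding ideal_XYZ_def by (rule genideal_eq_residue_ideal) auto

lemma ideal_qXYZ_eq: "ideal_qXYZ q = residue_ideal (int q)"
  unfolding ideal_qXYZ_def by (rule genideal_eq_residue_ideal) auto

lemma residue_ideal_inj: "residue_ideal (int p) = residue_ideal (int q) \<longleftrightarrow> p = q"
proof
  assume eq: "residue_ideal (int p) = residue_ideal (int q)"
  have "cls (of_int c) \<in> residue_ideal q \<longleftrightarrow> q dvd c" for c q
    using cls_in_residue_ideal_iff[OF zpoly_part_of_int] by (simp add: lookup_of_int)
  then have *: "int a dvd int b" if "residue_ideal (int a) = residue_ideal (int b)" for a b
    using that by (metis dvd_refl)
  show "p = q" using *[OF eq] *[OF eq[symmetric]] by (simp add: dvd_antisym)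
qed simp

definition int_annihilator :: "zpoly \<Rightarrow> nat \<Rightarrow> int set" where
  "int_annihilator s k = {c. null_frac (of_int c * s) k}"

lemma null_frac_iff_constant:
  assumes XYZ: "null_frac (Var iX * s) k" "null_frac (Var iY * s) k" "null_frac (Var iZ * s) k"
    and r: "r \<in> zpoly_part 0"
  shows "null_frac (r * s) k \<longleftrightarrow> lkp r 0 \<in> int_annihilator s k"
proof -
  obtain r1 r2 r3 where d: "r = of_int (lkp r 0) + (Var iX * r1 + Var iY * r2 + Var iZ * r3)"
    by (rule part_0_decompose[OF r])
  have "null_frac (r1 * (Var iX * s) + r2 * (Var iY * s) + r3 * (Var iZ * s)) k"
    by (intro null_frac_add null_frac_mult XYZ)
  then have "null_frac (of_int (lkp r 0) * s + (r1 * (Var iX * s) + r2 * (Var iY * s) + r3 * (Var iZ * s))) k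
      \<longleftrightarrow> null_frac (of_int (lkp r 0) * s) k"
    by (rule null_frac_add_iff)
  also have "of_int (lkp r 0) * s + (r1 * (Var iX * s) + r2 * (Var iY * s) + r3 * (Var iZ * s)) = r * s"
    by (subst (2) d) (simp add: algebra_simps)
  finally show ?thesis by (simp add: int_annihilator_def)
qed

text \<open>The witness is \<open>c v\<^sup>i\<close>, where \<open>i + 1\<close> is the least exponent for which \<open>v\<^bsup>i+1\<^esup> s\<close> has a larger
  annihilator and \<open>c\<close> is an integer in that annihilator outside the ideal of \<open>q\<close>.\<close>

lemma kill_nilpotent:
  assumes ann: "int_annihilator s k = {c. q dvd c}" and q: "q = 0 \<or> Factorial_Ring.prime (q :: int)"
    and v: "v \<in> zpoly_part 0" "null_frac (v ^ m * s) k"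
  shows "\<exists>t\<in>zpoly_part 0. int_annihilator (t * s) k = {c. q dvd c} \<and> null_frac (v * (t * s)) k"
proof -
  let ?P = "\<lambda>m. int_annihilator (v ^ m * s) k \<noteq> {c. q dvd c}"
  have nq: "\<not> q dvd 1" using q by (auto simp: not_prime_unit)
  moreover have "1 \<in> int_annihilator (v ^ m * s) k" using v(2) by (simp add: int_annihilator_def)
  ultimately have "?P m" by blast
  then have P: "?P (LEAST m. ?P m)" by (rule LeastI)
  have "(LEAST m. ?P m) \<noteq> 0" using P ann by (metis mult_1 power_0)
  then obtain i where i: "(LEAST m. ?P m) = Suc i" by (meson not0_implies_Suc)
  have annI: "int_annihilator (v ^ i * s) k = {c. q dvd c}"
    using not_less_Least[of i ?P] i by auto
  have "{c. q dvd c} \<subseteq> int_annihilator (v ^ Suc i * s) k"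
  proof
    fix c assume "c \<in> {c. q dvd c}"
    then have "c \<in> int_annihilator (v ^ i * s) k" unfolding annI .
    then have "null_frac (v * (of_int c * (v ^ i * s))) k"
      unfolding int_annihilator_def mem_Collect_eq by (rule null_frac_mult)
    then show "c \<in> int_annihilator (v ^ Suc i * s) k" by (simp add: int_annihilator_def mult_ac)
  qed
  with P have "{c. q dvd c} \<subset> int_annihilator (v ^ Suc i * s) k" unfolding i by (simp only: psubsetI not_sym)
  then obtain c where "c \<in> int_annihilator (v ^ Suc i * s) k" "c \<notin> {c. q dvd c}"
    using psubset_imp_ex_mem by (metis DiffD1 DiffD2)
  then have c: "null_frac (of_int c * (v ^ Suc i * s)) k" "\<not> q dvd c"
    unfolding int_annihilator_def mem_Collect_eq by this
  let ?t = "of_int c * v ^ i"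
  have "v ^ i \<in> zpoly_part 0" using zpoly_part_power[OF v(1), of i] by simp
  then have "?t \<in> zpoly_part 0" using zpoly_part_mult[OF zpoly_part_of_int, of "v ^ i" 0] by simp
  moreover have "int_annihilator (?t * s) k = {c. q dvd c}"
  proof -
    have "c' \<in> int_annihilator (?t * s) k \<longleftrightarrow> c' * c \<in> int_annihilator (v ^ i * s) k" for c'
      by (simp add: int_annihilator_def mult.assoc)
    moreover have "q dvd c' * c \<longleftrightarrow> q dvd c'" for c'
      using q c(2) by (auto simp: prime_dvd_mult_iff)
    ultimately show ?thesis unfolding annI by auto
  qed
  moreover have "null_frac (v * (?t * s)) k" using c(1) by (simp add: mult_ac)
  ultimately show ?thesis by blast
qed

text \<open>\<open>kill_nilpotent\<close> is applied for X, Y and Z in turn. It keeps the integer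
  annihilator, and vanishing already achieved survives further multiplication; in the end only the
  constant term of a scalar decides.\<close>

lemma residue_ideal_is_annihilator:
  assumes s: "s \<in> zpoly_part n" and ann: "int_annihilator s k = {c. q dvd c}"
    and q: "q = 0 \<or> Factorial_Ring.prime (q :: int)"
  shows "\<exists>t\<in>zpoly_part n. residue_ideal q = cls ` {r \<in> zpoly_part 0. null_frac (r * t) k}"
proof -
  have null: "null_frac (v * (t * f)) k" if "null_frac (v * f) k" for v t f
    using null_frac_mult[OF that, of t] by (simp add: mult.left_commute)
  obtain t1 where t1: "t1 \<in> zpoly_part 0" "int_annihilator (t1 * s) k = {c. q dvd c}" "null_frac (Var iX * (t1 * s)) k"
    using kill_nilpotent[OF ann q zpoly_part_Vars(4) null_frac_XYZ_power(1)] by blast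
  obtain t2 where t2: "t2 \<in> zpoly_part 0" "int_annihilator (t2 * (t1 * s)) k = {c. q dvd c}"
    "null_frac (Var iY * (t2 * (t1 * s))) k"
    using kill_nilpotent[OF t1(2) q zpoly_part_Vars(5) null_frac_XYZ_power(2)] by blast
  obtain t3 where t3: "t3 \<in> zpoly_part 0" "int_annihilator (t3 * (t2 * (t1 * s))) k = {c. q dvd c}"
    "null_frac (Var iZ * (t3 * (t2 * (t1 * s)))) k"
    using kill_nilpotent[OF t2(2) q zpoly_part_Vars(6) null_frac_XYZ_power(3)] by blast
  let ?t = "t3 * (t2 * (t1 * s))"
  have "?t \<in> zpoly_part n"
    by (rule zpoly_part_mult'[OF t3(1) zpoly_part_mult'[OF t2(1) zpoly_part_mult'[OF t1(1) s]]]) simp_all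
  moreover have "{r \<in> zpoly_part 0. null_frac (r * ?t) k} = {r \<in> zpoly_part 0. q dvd lkp r 0}"
    using null_frac_iff_constant[OF null[OF null[OF t1(3)]] null[OF t2(3)] t3(3)] t3(2) by auto
  ultimately show ?thesis unfolding residue_ideal_def by (intro bexI[of _ ?t]) simp_all
qed

lemma int_annihilator_0:
  assumes "0 < N"
  shows "\<exists>s\<in>zpoly_part (3 * int N - 2 - int N). int_annihilator s N = {c. 0 dvd c}"
proof -
  let ?s = "Var iU ^ (N - 1) * Var iV ^ (N - 1)"
  have "int_annihilator ?s N = {c. 0 dvd c}"
    using not_torsion_of_null_frac[OF _ assms] null_frac_0[of N] by (auto simp: int_annihilator_def)
  moreover have "?s \<in> zpoly_part (3 * int N - 2 - int N)"
    by (rule zpoly_part_mult'[OF zpoly_part_Var_power(1,2)]) (use assms in auto)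
  ultimately show ?thesis by blast
qed

text \<open>If \<open>N choose i = p * t\<close>, then \<open>t\<close> times a fraction of order
  \<open>N choose i\<close> has order \<open>p\<close>.\<close>

lemma int_annihilator_prime:
  assumes N: "0 < N" and p: "p \<in> binom_primes N"
  shows "\<exists>s\<in>zpoly_part (3 * int N - 2 - int N). int_annihilator s N = {c. int p dvd c}"
proof -
  obtain i where i: "i \<le> N" "p dvd (N choose i)" using p by (auto simp: binom_primes_def)
  then obtain t where t: "N choose i = p * t" by (elim dvdE)
  have t0: "t \<noteq> 0" using t i by (metis mult_0_right zero_less_binomial_iff less_irrefl)
  let ?s = "Var iX ^ i * Var iY ^ (N - i) * Var iU ^ (N - 1) * Var iV ^ (N - 1)"
  let ?t = "of_int (int t) * ?s"
  have "c \<in> int_annihilator ?t N \<longleftrightarrow> int p dvd c" for c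
  proof
    assume "c \<in> int_annihilator ?t N"
    then have "null_frac (of_int (c * int t) * ?s) N" by (simp add: int_annihilator_def mult.assoc)
    then have "int (N choose i) dvd c * int t" by (rule choose_dvd_of_null_frac[OF _ N i(1)])
    then show "int p dvd c" using t0 unfolding t by simp
  next
    assume "int p dvd c"
    then obtain d where d: "c = int p * d" ..
    have "null_frac (of_int d * (of_nat (N choose i) * ?s)) N"
      by (intro null_frac_mult null_frac_choose N i)
    also have "of_int d * (of_nat (N choose i) * ?s) = of_int c * ?t"
      unfolding d t by (simp add: mult_ac)
    finally show "c \<in> int_annihilator ?t N" by (simp add: int_annihilator_def)
  qed
  moreover have "?s \<in> zpoly_part (3 * int N - 2 - int N)"
  proof -
    have "Var iX ^ i \<in> zpoly_part 0" "Var iY ^ (N - i) \<in> zpoly_part 0"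
      using zpoly_part_power[OF zpoly_part_Vars(4), of i] zpoly_part_power[OF zpoly_part_Vars(5), of "N - i"] by simp_all
    then show ?thesis
      by (intro zpoly_part_mult'[OF zpoly_part_mult'[OF zpoly_part_mult' zpoly_part_Var_power(1)] zpoly_part_Var_power(2)])
        (use N in auto)
  qed
  then have "?t \<in> zpoly_part (3 * int N - 2 - int N)"
    by (rule zpoly_part_mult'[OF zpoly_part_of_int]) simp
  ultimately show ?thesis by blast
qed

lemma int_annihilator_torsion:
  assumes s: "s \<in> zpoly_part (3 * int k - 2 - int N)" and N: "0 < N"
    and p: "Factorial_Ring.prime p" "int p \<in> int_annihilator s k" "1 \<notin> int_annihilator s k"
  shows "p \<in> binom_primes N"
proof (rule ccontr)
  assume "p \<notin> binom_primes N"
  then have "\<not> int p dvd int (N choose i)" if "i \<le> N" for i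
    using that p(1) by (auto simp: binom_primes_def)
  moreover have "Factorial_Ring.prime (int p)" using p(1) by simp
  moreover have "null_frac (of_int (int p) * s) k" using p(2) unfolding int_annihilator_def by simp
  ultimately have "null_frac s k" using null_frac_torsion_free[OF s N, of "int p"] by metis
  then show False using p(3) by (simp add: int_annihilator_def)
qed

text \<open>A prime annihilator contains X, Y and Z because they act nilpotently, so it is
  determined by the integers \<open>G\<close> in it, a proper prime ideal. If \<open>G\<close> is
  nonzero, its generator is a prime occurring as torsion and therefore divides some
  \<open>N choose i\<close>.\<close>

lemma prime_annihilator_cases:
  assumes s: "s \<in> zpoly_part (3 * int k - 2 - int N)" and N: "0 < N"
    and P: "primeideal P R'0" "P = cls ` {r \<in> zpoly_part 0. null_frac (r * s) k}"
  shows "P = residue_ideal 0 \<or> (\<exists>p\<in>binom_primes N. P = residue_ideal (int p))"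
proof -
  interpret P: primeideal P R'0 by (rule P(1))
  have mem: "cls r \<in> P \<longleftrightarrow> null_frac (r * s) k" if "r \<in> zpoly_part 0" for r
    unfolding P(2) using that by (subst cls_mem_image_iff) auto
  have "cls v \<in> P" if "v \<in> zpoly_part 0" "cls (v ^ j) \<in> P" for v j
    using that(2)
  proof (induction j)
    case 0
    then show ?case using P.I_l_closed[of "cls 1" "cls v"] that(1) by (auto simp: carrier_R'0 R'0_simps cls_mult)
  next
    case (Suc j)
    have "v ^ j \<in> zpoly_part 0" using zpoly_part_power[OF that(1), of j] by simp
    then have "cls v \<in> P \<or> cls (v ^ j) \<in> P"
      using P.I_prime[of "cls v" "cls (v ^ j)"] that(1) Suc.prems by (auto simp: carrier_R'0 R'0_simps cls_mult)
    then show ?case using Suc.IH by blast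
  qed
  then have nil: "null_frac (v * s) k" if "v \<in> zpoly_part 0" "null_frac (v ^ j * s) k" for v j
    using that mem[of v] mem[of "v ^ j"] zpoly_part_power[OF that(1), of j] by simp
  define G where "G = int_annihilator s k"
  have XYZ: "null_frac (r * s) k \<longleftrightarrow> lkp r 0 \<in> G" if "r \<in> zpoly_part 0" for r
    unfolding G_def
    by (rule null_frac_iff_constant[OF nil[OF _ null_frac_XYZ_power(1)] nil[OF _ null_frac_XYZ_power(2)]
          nil[OF _ null_frac_XYZ_power(3)] that]) simp_all
  have G: "c \<in> G \<longleftrightarrow> cls (of_int c) \<in> P" for c
    by (simp add: mem G_def int_annihilator_def)
  have G1: "1 \<notin> G"
  proof
    assume "1 \<in> G"
    then have "\<one>\<^bsub>R'0\<^esub> \<in> P" using G[of 1] by (simp add: R'0_simps)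
    then show False using P.one_imp_carrier P.I_notcarr by simp
  qed
  have Gmult: "c * c' \<in> G" if "c \<in> G" for c c'
    using null_frac_mult[of "of_int c * s" k "of_int c'"] that by (simp add: G_def int_annihilator_def mult_ac)
  have Gadd: "c + c' \<in> G" if "c \<in> G" "c' \<in> G" for c c'
    using null_frac_add[of "of_int c * s" k "of_int c' * s"] that by (simp add: G_def int_annihilator_def distrib_right)
  have Gprime: "c \<in> G \<or> c' \<in> G" if "c * c' \<in> G" for c c'
    using P.I_prime[of "cls (of_int c)" "cls (of_int c')"] that
    by (auto simp: G carrier_R'0 R'0_simps cls_mult)
  have "P = residue_ideal q" if "G = {c. q dvd c}" for q
    unfolding P(2) residue_ideal_def using XYZ that by (intro arg_cong[where f="image cls"]) auto
  moreover have "G = {c. 0 dvd c} \<or> (\<exists>p\<in>binom_primes N. G = {c. int p dvd c})"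
  proof (cases "\<exists>m. 0 < m \<and> int m \<in> G")
    case False
    have "c = 0" if "c \<in> G" for c
    proof (rule ccontr)
      assume "c \<noteq> 0"
      moreover have "\<bar>c\<bar> \<in> G" using Gmult[OF that, of "sgn c"] by (simp only: abs_sgn)
      then have "int (nat \<bar>c\<bar>) \<in> G" by simp
      ultimately show False using False by (metis zero_less_abs_iff zero_less_nat_eq)
    qed
    moreover have "0 \<in> G" using null_frac_0 by (simp add: G_def int_annihilator_def)
    ultimately show ?thesis by auto
  next
    case True
    define p where "p = (LEAST m. 0 < m \<and> int m \<in> G)"
    have p: "0 < p" "int p \<in> G" using LeastI_ex[OF True] by (auto simp: p_def)
    have least: "\<not> (0 < m \<and> int m \<in> G)" if "m < p" for m using that not_less_Least unfolding p_def by blast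
    have "p dvd c" if "int c \<in> G" for c
    proof -
      have "int c + int p * - int (c div p) \<in> G" by (intro Gadd Gmult that p)
      also have "int c + int p * - int (c div p) = int (c mod p)"
        by (simp add: minus_mult_div_eq_mod zmod_int zdiv_int)
      finally have "c mod p = 0" using least[of "c mod p"] p(1) by (metis gr_zeroI mod_less_divisor)
      then show ?thesis by auto
    qed
    then have "int p dvd c" if "c \<in> G" for c
      using Gmult[OF that, of "sgn c"] by (metis abs_sgn dvd_abs_iff int_dvd_int_iff zero_le_imp_eq_int abs_ge_zero)
    then have Geq: "G = {c. int p dvd c}" using Gmult[OF p(2)] by (auto elim!: dvdE)
    have "p \<noteq> 1" using p G1 by auto
    moreover have "p dvd a \<or> p dvd b" if "p dvd a * b" for a b
      using Gprime[of "int a" "int b"] that unfolding Geq by (auto simp flip: of_nat_mult)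
    ultimately have "prime_elem p" using p(1) by (intro prime_elemI) simp_all
    then have "Factorial_Ring.prime p" by (simp add: primeI)
    then have "p \<in> binom_primes N"
      using p G1 unfolding G_def by (intro int_annihilator_torsion[OF s N]) auto
    then show ?thesis using Geq by blast
  qed
  ultimately show ?thesis by blast
qed

section \<open>Binomial coefficients divisible by a given prime\<close>

lemma self_dvd_prime_power_choose:
  assumes p: "Factorial_Ring.prime (p :: nat)" and k: "0 < k" "k < p ^ t"
  shows "p dvd (p ^ t choose k)"
proof (rule ccontr)
  assume "\<not> p dvd (p ^ t choose k)"
  then have "coprime (p ^ t) (p ^ t choose k)" using p by (simp add: prime_imp_coprime)
  \<comment> \<open>The absorption identity
    \<open>k * (p^t choose k) = p^t * (p^t - 1 choose k - 1)\<close>.\<close>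
  moreover have "p ^ t dvd k * (p ^ t choose k)" unfolding times_binomial_minus1_eq[OF k(1)] by simp
  ultimately have "p ^ t dvd k" by (simp add: coprime_dvd_mult_left_iff)
  then show False using k by (auto dest: dvd_imp_le)
qed

text \<open>The inner entries of row \<open>p^t\<close> vanish modulo \<open>p\<close>, so by
  Pascal's rule neighbours in row \<open>p^t - 1\<close> are negatives of each other modulo
  \<open>p\<close>, beginning with 1.\<close>

lemma not_dvd_choose_prime_power_minus_1:
  assumes p: "Factorial_Ring.prime (p :: nat)" and "i \<le> p ^ t - 1"
  shows "\<not> p dvd (p ^ t - 1 choose i)"
  using assms(2)
proof (induction i)
  case 0
  show ?case using p by (auto simp: prime_nat_iff)
next
  case (Suc i)
  have eq: "p ^ t = Suc (p ^ t - 1)" using p by (simp add: prime_gt_0_nat)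
  have "p dvd (p ^ t choose Suc i)" by (rule self_dvd_prime_power_choose[OF p]) (use Suc.prems eq in auto)
  moreover have "(p ^ t choose Suc i) = (p ^ t - 1 choose i) + (p ^ t - 1 choose Suc i)"
    by (subst eq) simp
  ultimately show ?case using Suc by (metis Suc_leD dvd_add_left_iff)
qed

lemma finite_binom_primes: "finite (binom_primes N)"
proof -
  have "binom_primes N \<subseteq> (\<Union>i\<in>{0..N}. {p. p dvd (N choose i)})" by (auto simp: binom_primes_def)
  moreover have "finite {p. p dvd (N choose i)}" if "i \<in> {0..N}" for i
    using that by (intro finite_divisors_nat) (simp add: zero_less_binomial_iff)
  ultimately show ?thesis by (meson finite_UN_I finite_atLeastAtMost finite_subset)
qed

lemma prime_dvd_in_binom_primes: "Factorial_Ring.prime p \<Longrightarrow> p dvd N \<Longrightarrow> 0 < N \<Longrightarrow> p \<in> binom_primes N"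
  unfolding binom_primes_def by (auto intro!: bexI[of _ 1])

lemma prime_power_notin_binom_primes: "Factorial_Ring.prime p \<Longrightarrow> p \<notin> binom_primes (p ^ t - 1)"
  using not_dvd_choose_prime_power_minus_1 by (auto simp: binom_primes_def)

section \<open>The associated primes in each degree and their asymptotics\<close>

context R'_resolution
begin

lemma Ass_R'0_eq:
  assumes N: "0 < N"
  shows "Ass R'0 (H (- int (N + 2))) = {ideal_XYZ} \<union> {ideal_qXYZ q | q. q \<in> binom_primes N}"
proof -
  have deg: "3 * int k + - int (N + 2) = 3 * int k - 2 - int N" for k by simp
  show ?thesis
    unfolding Ass_R'0_H3 deg ideal_XYZ_eq ideal_qXYZ_eq
  proof (intro equalityI subsetI)
    fix P assume "P \<in> {P. primeideal P R'0 \<and> (\<exists>s k. s \<in> zpoly_part (3 * int k - 2 - int N) \<and>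
      P = cls ` {r \<in> zpoly_part 0. null_frac (r * s) k})}"
    then show "P \<in> {residue_ideal 0} \<union> {residue_ideal (int q) |q. q \<in> binom_primes N}"
      using prime_annihilator_cases[OF _ N] by blast
  next
    fix P assume "P \<in> {residue_ideal 0} \<union> {residue_ideal (int q) |q. q \<in> binom_primes N}"
    then consider "P = residue_ideal 0" | p where "P = residue_ideal (int p)" "p \<in> binom_primes N" by blast
    then obtain q s where q: "P = residue_ideal q" "q = 0 \<or> Factorial_Ring.prime q"
      "s \<in> zpoly_part (3 * int N - 2 - int N)" "int_annihilator s N = {c. q dvd c}"
    proof cases
      case 1
      then show ?thesis using that[of 0] int_annihilator_0[OF N] by auto
    next
      case 2
      then have "Factorial_Ring.prime (int p)" by (simp add: binom_primes_def)
      then show ?thesis using that[of "int p"] int_annihilator_prime[OF N 2(2)] 2(1) by auto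
    qed
    obtain t where "t \<in> zpoly_part (3 * int N - 2 - int N)"
      "residue_ideal q = cls ` {r \<in> zpoly_part 0. null_frac (r * t) N}"
      using residue_ideal_is_annihilator[OF q(3,4,2)] by blast
    then show "P \<in> {P. primeideal P R'0 \<and> (\<exists>s k. s \<in> zpoly_part (3 * int k - 2 - int N) \<and>
      P = cls ` {r \<in> zpoly_part 0. null_frac (r * s) k})}"
      unfolding q(1) mem_Collect_eq using primeideal_residue_ideal[OF q(2)] by iprover
  qed
qed

lemma prime_in_Ass_int_iff:
  assumes N: "0 < N" and p: "Factorial_Ring.prime p"
  shows "PIdl\<^bsub>\<Z>\<^esub> (int p) \<in> Ass \<Z> (int_module (H (- int (N + 2)))) \<longleftrightarrow> p \<in> binom_primes N"
proof -
  have deg: "3 * int k + - int (N + 2) = 3 * int k - 2 - int N" for k by simp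
  have I: "PIdl\<^bsub>\<Z>\<^esub> (int p) = {c. int p dvd c}" by (auto simp: cgenideal_def dvd_def mult.commute)
  have pI: "primeideal (PIdl\<^bsub>\<Z>\<^esub> (int p)) \<Z>"
    using prime_primeideal[of "int p"] p by (simp add: int.cgenideal_eq_genideal)
  show ?thesis
  proof
    assume "PIdl\<^bsub>\<Z>\<^esub> (int p) \<in> Ass \<Z> (int_module (H (- int (N + 2))))"
    then obtain s k where s: "s \<in> zpoly_part (3 * int k - 2 - int N)" "{c. int p dvd c} = int_annihilator s k"
      unfolding Ass_int_H3 deg I int_annihilator_def by blast
    have "\<not> int p dvd 1" using p by (auto simp: prime_nat_iff)
    then show "p \<in> binom_primes N"
      by (intro int_annihilator_torsion[OF s(1) N p]) (simp_all flip: s(2))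
  next
    assume "p \<in> binom_primes N"
    then obtain s where s: "s \<in> zpoly_part (3 * int N - 2 - int N)" "int_annihilator s N = {c. int p dvd c}"
      using int_annihilator_prime[OF N] by blast
    show "PIdl\<^bsub>\<Z>\<^esub> (int p) \<in> Ass \<Z> (int_module (H (- int (N + 2))))"
      unfolding Ass_int_H3 deg mem_Collect_eq I
      using pI[unfolded I] s(1) s(2)[symmetric] unfolding int_annihilator_def by iprover
  qed
qed

lemma ideal_qXYZ_in_Ass_iff:
  assumes "0 < N" "Factorial_Ring.prime p"
  shows "ideal_qXYZ p \<in> Ass R'0 (H (- int (N + 2))) \<longleftrightarrow> p \<in> binom_primes N"
  unfolding Ass_R'0_eq[OF assms(1)] ideal_XYZ_eq ideal_qXYZ_eq
  using residue_ideal_inj[of p] residue_ideal_inj[of p 0] assms(2) by auto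

lemma card_Ass:
  assumes "0 < N"
  shows "finite (Ass R'0 (H (- int (N + 2))))"
    "card (binom_primes N) \<le> card (Ass R'0 (H (- int (N + 2))))"
proof -
  have eq: "{ideal_qXYZ q | q. q \<in> binom_primes N} = ideal_qXYZ ` binom_primes N" by blast
  show fin: "finite (Ass R'0 (H (- int (N + 2))))"
    unfolding Ass_R'0_eq[OF assms] eq by (simp add: finite_binom_primes)
  have "card (binom_primes N) = card (ideal_qXYZ ` binom_primes N)"
    by (rule card_image[symmetric]) (auto simp: inj_on_def ideal_qXYZ_eq residue_ideal_inj)
  also have "\<dots> \<le> card (Ass R'0 (H (- int (N + 2))))"
    using fin unfolding Ass_R'0_eq[OF assms] eq by (intro card_mono) auto
  finally show "card (binom_primes N) \<le> card (Ass R'0 (H (- int (N + 2))))" .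
qed

text \<open>\<open>card\<close> is 0 on infinite sets, so finiteness is what makes the cardinalities
  genuine.\<close>

lemma finite_Ass: "3 \<le> j \<Longrightarrow> finite (Ass R'0 (H (- j)))"
  using card_Ass(1)[of "nat (j - 2)"] by simp

text \<open>For \<open>N\<close> the product of \<open>M + 1\<close> distinct primes, each of them
  divides \<open>N choose 1\<close>.\<close>

lemma card_Ass_unbounded: "\<not> bdd_above {card (Ass R'0 (H (- j))) | j::int. j \<ge> 3}"
proof
  assume "bdd_above {card (Ass R'0 (H (- j))) | j::int. j \<ge> 3}"
  then obtain M where M: "\<And>j::int. j \<ge> 3 \<Longrightarrow> card (Ass R'0 (H (- j))) \<le> M"
    unfolding bdd_above_def by blast
  obtain T where T: "finite T" "card T = Suc M" "T \<subseteq> {p::nat. Factorial_Ring.prime p}"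
    using infinite_arbitrarily_large[OF primes_infinite] by blast
  have N: "0 < \<Prod>T" using T by (auto intro!: prod_pos prime_gt_0_nat)
  have "T \<subseteq> binom_primes (\<Prod>T)"
    using T N by (auto intro!: prime_dvd_in_binom_primes dvd_prodI)
  then have "Suc M \<le> card (binom_primes (\<Prod>T))" using card_mono[OF finite_binom_primes] T(2) by metis
  also have "\<dots> \<le> card (Ass R'0 (H (- int (\<Prod>T + 2))))" by (rule card_Ass(2)[OF N])
  also have "\<dots> \<le> M" by (rule M) (use N in linarith)
  finally show False by simp
qed

text \<open>The prime occurs for every positive multiple \<open>N\<close> of \<open>p\<close>,
  through \<open>N choose 1\<close>, and fails to occur for every \<open>N = p^t - 1\<close> with
  \<open>t > 0\<close>.\<close>

lemma infinite_in_Ass: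
  assumes p: "Factorial_Ring.prime p"
  shows "infinite {j::int. j \<ge> 3 \<and> ideal_qXYZ p \<in> Ass R'0 (H (- j))}"
    and "infinite {j::int. j \<ge> 3 \<and> ideal_qXYZ p \<notin> Ass R'0 (H (- j))}"
proof -
  have p2: "2 \<le> p" using p by (rule prime_ge_2_nat)
  have "inj (\<lambda>t. int (p * Suc t + 2))" using p2 by (auto simp: inj_def)
  then have "infinite (range (\<lambda>t. int (p * Suc t + 2)))" by (rule range_inj_infinite)
  moreover have "range (\<lambda>t. int (p * Suc t + 2)) \<subseteq> {j::int. j \<ge> 3 \<and> ideal_qXYZ p \<in> Ass R'0 (H (- j))}"
  proof (intro subsetI)
    fix j assume "j \<in> range (\<lambda>t. int (p * Suc t + 2))"
    then obtain t where j: "j = int (p * Suc t + 2)" by blast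
    have N: "0 < p * Suc t" using p2 by simp
    have "p \<in> binom_primes (p * Suc t)" by (rule prime_dvd_in_binom_primes[OF p _ N]) simp
    then show "j \<in> {j::int. j \<ge> 3 \<and> ideal_qXYZ p \<in> Ass R'0 (H (- j))}"
      using ideal_qXYZ_in_Ass_iff[OF N p] N unfolding j by (intro CollectI conjI; (linarith | blast))
  qed
  ultimately show "infinite {j::int. j \<ge> 3 \<and> ideal_qXYZ p \<in> Ass R'0 (H (- j))}"
    using infinite_super by blast
  have pos: "1 < p ^ Suc t" for t using p2 by (intro one_less_power) auto
  have "inj (\<lambda>t. int (p ^ Suc t - 1 + 2))"
  proof (rule injI)
    fix x y assume "int (p ^ Suc x - 1 + 2) = int (p ^ Suc y - 1 + 2)"
    then have "p ^ Suc x = p ^ Suc y" using pos[of x] pos[of y] by linarith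
    then show "x = y" using p2 power_inject_exp[of p "Suc x" "Suc y"] by simp
  qed
  then have "infinite (range (\<lambda>t. int (p ^ Suc t - 1 + 2)))" by (rule range_inj_infinite)
  moreover have "range (\<lambda>t. int (p ^ Suc t - 1 + 2)) \<subseteq> {j::int. j \<ge> 3 \<and> ideal_qXYZ p \<notin> Ass R'0 (H (- j))}"
  proof (intro subsetI)
    fix j assume "j \<in> range (\<lambda>t. int (p ^ Suc t - 1 + 2))"
    then obtain t where j: "j = int (p ^ Suc t - 1 + 2)" by blast
    have N: "0 < p ^ Suc t - 1" using pos[of t] by simp
    show "j \<in> {j::int. j \<ge> 3 \<and> ideal_qXYZ p \<notin> Ass R'0 (H (- j))}"
      using ideal_qXYZ_in_Ass_iff[OF N p] prime_power_notin_binom_primes[OF p, of "Suc t"] N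
      unfolding j by (intro CollectI conjI; (linarith | blast))
  qed
  ultimately show "infinite {j::int. j \<ge> 3 \<and> ideal_qXYZ p \<notin> Ass R'0 (H (- j))}"
    using infinite_super by blast
qed

text \<open>The prime 2 already decides: monotonicity would make \<open>(2, X, Y, Z)\<close>
  permanent once it occurs far enough out, against its infinitely many absences.\<close>

lemma not_asymptotically_increasing: "\<not> asymptotically_increasing (\<lambda>n. Ass R'0 (H n))"
proof
  assume "asymptotically_increasing (\<lambda>n. Ass R'0 (H n))"
  then obtain n0 where n0: "\<And>n. n \<le> n0 \<Longrightarrow> Ass R'0 (H n) \<subseteq> Ass R'0 (H (n - 1))"
    unfolding asymptotically_increasing_def by blast
  let ?J = "\<lambda>j::int. ideal_qXYZ 2 \<in> Ass R'0 (H (- j))"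
  have unb: "\<exists>j\<in>S. m \<le> j" if "infinite S" "S \<subseteq> {3..}" for S :: "int set" and m
  proof (rule ccontr)
    assume no: "\<not> (\<exists>j\<in>S. m \<le> j)"
    have "S \<subseteq> {3..m}"
    proof
      fix x assume "x \<in> S"
      then show "x \<in> {3..m}" using no that(2) by force
    qed
    then show False using that(1) finite_subset by blast
  qed
  obtain j where j: "- n0 \<le> j" "?J j"
    using unb[OF infinite_in_Ass(1)[of 2], of "- n0"] by (auto simp: two_is_prime_nat)
  have inc: "?J (j + int k)" for k
  proof (induction k)
    case (Suc k)
    have eq: "- (j + int (Suc k)) = - (j + int k) - 1" by simp
    have "- (j + int k) \<le> n0" using j(1) by linarith
    then show ?case unfolding eq using n0 Suc by blast
  qed (use j in simp)
  obtain l where "j \<le> l" "\<not> ?J l"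
    using unb[OF infinite_in_Ass(2)[of 2], of j] by (auto simp: two_is_prime_nat)
  then show False using inc[of "nat (l - j)"] by simp
qed

end

theorem theorem2p17:
  fixes e :: "zpoly set \<Rightarrow> 'm"
    and E :: "nat \<Rightarrow> (zpoly set, 'm) module"
    and C :: "nat \<Rightarrow> int \<Rightarrow> 'm set"
    and \<delta> :: "nat \<Rightarrow> 'm \<Rightarrow> 'm"
    and d p :: nat
  assumes "graded_injective_resolution R' R'_part (regular_module R') R'_part e E C \<delta>"
    and "d \<ge> 3"
    and "Factorial_Ring.prime p"
  shows "(PIdl\<^bsub>\<Z>\<^esub> (int p) \<in> Ass \<Z> (int_module (H3 E C \<delta> (- int d)))
            \<longleftrightarrow> p \<in> binom_primes (d - 2))
    \<and> Ass R'0 (H3 E C \<delta> (- int d)) = {ideal_XYZ} \<union> {ideal_qXYZ q | q. q \<in> binom_primes (d - 2)}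
    \<and> ((\<forall>j::int. j \<ge> 3 \<longrightarrow> finite (Ass R'0 (H3 E C \<delta> (- j))))
        \<and> \<not> bdd_above {card (Ass R'0 (H3 E C \<delta> (- j))) | j::int. j \<ge> 3})
    \<and> (infinite {j::int. j \<ge> 3 \<and> ideal_qXYZ p \<in> Ass R'0 (H3 E C \<delta> (- j))}
        \<and> infinite {j::int. j \<ge> 3 \<and> ideal_qXYZ p \<notin> Ass R'0 (H3 E C \<delta> (- j))})
    \<and> \<not> asymptotically_increasing (\<lambda>n. Ass R'0 (H3 E C \<delta> n))"
proof -
  interpret R'_resolution e E C \<delta> by unfold_locales (rule assms(1))
  have N: "0 < d - 2" "d - 2 + 2 = d" using assms(2) by auto
  show ?thesis
    using prime_in_Ass_int_iff[OF N(1) assms(3)] Ass_R'0_eq[OF N(1)] finite_Ass card_Ass_unbounded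
      infinite_in_Ass[OF assms(3)] not_asymptotically_increasing
    unfolding N(2) by (intro conjI allI impI)
qed

end
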